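(* Let $\mathbb{F}$ be an algebraically closed field of characteristic zero, let $\mathcal{A}$ be a two-dimensional $\mathbb{F}$-algebra and let $m>0$. If the group $\mathrm{Aut}(\mathcal{A})$ is trivial, then $I_m(\mathcal{A})=\mathbb{F}[\mathcal{A}^m]$. Otherwise, up to isomorphism, $\mathcal{A}$ belongs to the following list (with $\alpha,\beta\in\mathbb{F}$), and for each algebra in the list the indicated set is a minimal (with respect to inclusion) generating set of the algebra $I_m(\mathcal{A})$: - $\mathbf{A}_1(\alpha)$: $1$, $x_1,\ldots,x_m$, and $x_ry_s-y_rx_s$ ($1\leqslant r<s\leqslant m$); - $\mathbf{A}_2$: $1$, $x_1,\ldots,x_m$, and $x_ry_s-y_rx_s$ ($1\leqslant r<s\leqslant m$); - $\mathbf{A}_3$: $1$; - $\mathbf{A}_4(0)$: $1$, $x_rx_s$ ($1\leqslant r\leqslant s\leqslant m$), $y_1,\ldots,y_m$; - $\mathbf{B}_2(\alpha)$: $1$, $y_1,\ldots,y_m$; - $\mathbf{B}_3$: $1$, $x_1,\ldots,x_m$; - $\mathbf{C}(\alpha,0)$: $1$, $x_rx_s$ ($1\leqslant r\leqslant s\leqslant m$), $y_1,\ldots,y_m$; - $\mathbf{D}_1(\alpha,2\alpha-1)$ with $(\alpha,2\alpha-1)\in\mathcal{U}$: $1$, $2x_r+y_r$ ($1\leqslant r\leqslant m$), $y_ry_s$ ($1\leqslant r\leqslant s\leqslant m$); - $\mathbf{D}_2(\alpha,\beta)$ with $(\alpha,\beta)\notin\mathcal{T}$: $1$, $x_1,\ldots,x_m$;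 - $\mathbf{E}_1(\alpha,\beta,\beta,\alpha)$ with $(\alpha,\beta,\beta,\alpha)\in\mathcal{V}$ and $(\alpha,\beta)\neq(-1,-1)$: $1$, $x_r+y_r$, $x_ry_r$ ($1\leqslant r\leqslant m$), $x_ry_s+y_rx_s$ ($1\leqslant r<s\leqslant m$); - $\mathbf{E}_1(-1,-1,-1,-1)$: $1$, $2x_rx_s-x_ry_s-y_rx_s+2y_ry_s$ ($1\leqslant r\leqslant s\leqslant m$), and $2x_rx_sx_t-x_rx_sy_t-x_ry_sx_t-x_ry_sy_t-y_rx_sx_t-y_rx_sy_t-y_ry_sx_t+2y_ry_sy_t$ ($1\leqslant r\leqslant s\leqslant t\leqslant m$); - $\mathbf{E}_3(\alpha,\alpha,-1)$: $1$, $x_r+y_r$, $x_ry_r$ ($1\leqslant r\leqslant m$), $x_ry_s+y_rx_s$ ($1\leqslant r<s\leqslant m$); - $\mathbf{E}_5(\alpha)$: $1$ and $x_r+y_r$ ($1\leqslant r\leqslant m$); - $\mathbf{N}$: $1$.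
   Context: An algebra is a vector space with a bilinear multiplication, not necessarily associative. For a two-dimensional algebra $\mathcal{A}$ with fixed basis $e_1,e_2$, the coordinate ring of $\mathcal{A}^m$ is the polynomial ring $\mathbb{F}[\mathcal{A}^m]=\mathbb{F}[x_1,y_1,\ldots,x_m,y_m]$, where for $\underline{a}=(a_1,\ldots,a_m)\in\mathcal{A}^m$ the value $x_r(\underline{a})$ (resp. $y_r(\underline{a})$) is the coefficient of $a_r$ at $e_1$ (resp. $e_2$). The group $\mathrm{Aut}(\mathcal{A})$ of algebra automorphisms acts diagonally on $\mathcal{A}^m$, and $I_m(\mathcal{A})=\{f\in\mathbb{F}[\mathcal{A}^m] : f(g\cdot\underline{a})=f(\underline{a})\text{ for all }g\in\mathrm{Aut}(\mathcal{A}),\ \underline{a}\in\mathcal{A}^m\}$. The subalgebra generated by a set is the smallest subspace containing it and closed under multiplication (the unity $1$ is not included automatically, so it is listed among the generators). Each algebra below has basis $e_1,e_2$ and is given by the products $(e_1e_1,\;e_1e_2,\;e_2e_1,\;e_2e_2)$: $\mathbf{A}_1(\alpha)$: $(e_1+e_2,\;\alpha e_2,\;(1-\alpha)e_2,\;0)$; $\mathbf{A}_2$: $(e_2,\;e_2,\;-e_2,\;0)$; $\mathbf{A}_3$: $(e_2,\;0,\;0,\;0)$; $\mathbf{A}_4(0)$: $(e_2,\;e_1,\;-e_1,\;0)$; $\mathbf{B}_2(\alpha)$: $(0,\;(1-\alpha)e_1,\;\alpha e_1,\;0)$; $\mathbf{B}_3$: $(0,\;e_2,\;-e_2,\;0)$;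 $\mathbf{C}(\alpha,0)$: $(e_2,\;(1-\alpha)e_1,\;\alpha e_1,\;e_2)$; $\mathbf{D}_1(\alpha,\beta)$: $(e_1,\;(1-\alpha)e_1+\beta e_2,\;\alpha e_1-\beta e_2,\;0)$; $\mathbf{D}_2(\alpha,\beta)$: $(e_1,\;\alpha e_2,\;\beta e_2,\;0)$; $\mathbf{E}_1(\alpha,\beta,\gamma,\delta)$: $(e_1,\;\alpha e_1+\beta e_2,\;\gamma e_1+\delta e_2,\;e_2)$; $\mathbf{E}_3(\alpha,\alpha,-1)$: $(e_1,\;(\alpha-1)e_1-\alpha e_2,\;-\alpha e_1+(\alpha-1)e_2,\;e_2)$; $\mathbf{E}_5(\alpha)$: $(e_1,\;(1-\alpha)e_1+\alpha e_2,\;\alpha e_1+(1-\alpha)e_2,\;e_2)$; $\mathbf{N}$: $(0,0,0,0)$. Parameter sets (arbitrary but fixed choices of orbit representatives): $\mathcal{U}$ is a set of representatives of the orbits of $\mathbb{F}^2$ under the involution $(\alpha,\beta)\mapsto(1-\alpha+\beta,\beta)$. $\mathcal{T}=\{(\alpha,\beta)\in\mathbb{F}^2:\alpha+\beta=1\}$. For $\Gamma=(\alpha,\beta,\gamma,\delta)\in\mathbb{F}^4$ put $D(\Gamma)=(\alpha+\gamma)(\beta+\delta)-1$, $C_1(\Gamma)=(\beta,\delta)$, $C_2(\Gamma)=(\gamma,\alpha)$ and, if $D(\Gamma)\ne0$, $C_3(\Gamma)=\left(\frac{\beta\gamma-(\alpha-1)(\delta-1)}{D(\Gamma)},\frac{\alpha\delta-(\beta-1)(\gamma-1)}{D(\Gamma)}\right)$.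 The symmetric group $\mathcal{S}_3$ acts by permuting the components on the set of triples $(C_1(\Gamma),C_2(\Gamma),C_3(\Gamma))$ with $\Gamma\in\mathbb{F}^4$, $D(\Gamma)\neq0$, $C_1(\Gamma),C_2(\Gamma)\notin\mathcal{T}$. Fix a set $\widetilde{\mathcal{V}}$ of representatives of the orbits of this action such that for every $(C_1,C_2,C_3)\in\widetilde{\mathcal{V}}$ with $C_1\neq C_2$ one has $C_3\neq C_1$ and $C_3\neq C_2$. Then $\mathcal{V}$ is the set of all $\Gamma\in\mathbb{F}^4$ with $D(\Gamma)\neq0$, $C_1(\Gamma),C_2(\Gamma)\notin\mathcal{T}$ and $(C_1(\Gamma),C_2(\Gamma),C_3(\Gamma))\in\widetilde{\mathcal{V}}$. *)

theory Defs
  imports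
    "HOL-Analysis.Analysis"
    "HOL-Library.Poly_Mapping"
    "HOL-Computational_Algebra.Polynomial"
begin

locale two_dim_algebra = vector_space smul
  for smul :: "'a::field \<Rightarrow> 'v::ab_group_add \<Rightarrow> 'v" +
  fixes mul :: "'v \<Rightarrow> 'v \<Rightarrow> 'v" and e1 e2 :: 'v
  assumes linear_mul_left: "Vector_Spaces.linear smul smul (\<lambda>u. mul u v)"
    and linear_mul_right: "Vector_Spaces.linear smul smul (\<lambda>v. mul u v)"
    and basis_distinct: "e1 \<noteq> e2"
    and basis_independent: "\<not> dependent {e1, e2}"
    and basis_span: "span {e1, e2} = UNIV"

definition algebra_iso ::
  "('a::field \<Rightarrow> 'v::ab_group_add \<Rightarrow> 'v) \<Rightarrow> ('v \<Rightarrow> 'v \<Rightarrow> 'v) \<Rightarrow>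
   ('a \<Rightarrow> 'w::ab_group_add \<Rightarrow> 'w) \<Rightarrow> ('w \<Rightarrow> 'w \<Rightarrow> 'w) \<Rightarrow> ('v \<Rightarrow> 'w) \<Rightarrow> bool" where
  "algebra_iso smul mul smul' mul' g \<longleftrightarrow>
     Vector_Spaces.linear smul smul' g \<and> bij g \<and> (\<forall>u v. g (mul u v) = mul' (g u) (g v))"

definition Aut :: "('a::field \<Rightarrow> 'v::ab_group_add \<Rightarrow> 'v) \<Rightarrow> ('v \<Rightarrow> 'v \<Rightarrow> 'v) \<Rightarrow> ('v \<Rightarrow> 'v) set" where
  "Aut smul mul = {g. algebra_iso smul mul smul mul g}"

text \<open>The variables \<open>X r\<close> and \<open>Y r\<close> are the coordinates of the \<open>r\<close>-th component of a tuple at the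
  first and the second basis vector. A polynomial is a finitely supported map from monomials
  (finitely supported exponent maps) to coefficients; its multiplication is the convolution product
  of \<^theory>\<open>HOL-Library.Poly_Mapping\<close>.\<close>

datatype coord = X nat | Y nat

type_synonym 'a mpoly = "(coord \<Rightarrow>\<^sub>0 nat) \<Rightarrow>\<^sub>0 'a"

definition xvar :: "nat \<Rightarrow> 'a::comm_ring_1 mpoly" where
  "xvar r = Poly_Mapping.single (Poly_Mapping.single (X r) 1) 1"

definition yvar :: "nat \<Rightarrow> 'a::comm_ring_1 mpoly" where
  "yvar r = Poly_Mapping.single (Poly_Mapping.single (Y r) 1) 1"

definition pscale :: "'a::comm_ring_1 \<Rightarrow> 'a mpoly \<Rightarrow> 'a mpoly" where
  "pscale c p = Poly_Mapping.single 0 c * p"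

definition peval :: "(coord \<Rightarrow> 'a::comm_ring_1) \<Rightarrow> 'a mpoly \<Rightarrow> 'a" where
  "peval \<nu> p = (\<Sum>t\<in>Poly_Mapping.keys p. Poly_Mapping.lookup p t *
                  (\<Prod>v\<in>Poly_Mapping.keys t. \<nu> v ^ Poly_Mapping.lookup t v))"

definition coord_ring :: "nat \<Rightarrow> 'a::comm_ring_1 mpoly set" where
  "coord_ring m = {p. \<forall>t\<in>Poly_Mapping.keys p. Poly_Mapping.keys t \<subseteq> X ` {1..m} \<union> Y ` {1..m}}"

text \<open>A tuple \<open>(a\<^sub>1, \<dots>, a\<^sub>m)\<close> is given as a function on \<open>nat\<close>; polynomials in \<open>coord_ring m\<close> only
  read its values at \<open>1, \<dots>, m\<close>.\<close>

definition tuple_coords ::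
  "('a::field \<Rightarrow> 'v::ab_group_add \<Rightarrow> 'v) \<Rightarrow> 'v \<Rightarrow> 'v \<Rightarrow> (nat \<Rightarrow> 'v) \<Rightarrow> coord \<Rightarrow> 'a" where
  "tuple_coords smul e1 e2 a v =
     (case v of X r \<Rightarrow> module.representation smul {e1, e2} (a r) e1
              | Y r \<Rightarrow> module.representation smul {e1, e2} (a r) e2)"

definition invariants ::
  "('a::field \<Rightarrow> 'v::ab_group_add \<Rightarrow> 'v) \<Rightarrow> ('v \<Rightarrow> 'v \<Rightarrow> 'v) \<Rightarrow> 'v \<Rightarrow> 'v \<Rightarrow> nat \<Rightarrow> 'a mpoly set" where
  "invariants smul mul e1 e2 m =
     {f \<in> coord_ring m. \<forall>g\<in>Aut smul mul. \<forall>a.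
        peval (tuple_coords smul e1 e2 (\<lambda>r. g (a r))) f = peval (tuple_coords smul e1 e2 a) f}"

text \<open>Subalgebras need not contain \<open>1\<close>.\<close>

definition subalgebra :: "'a::comm_ring_1 mpoly set \<Rightarrow> bool" where
  "subalgebra W \<longleftrightarrow> module.subspace pscale W \<and> (\<forall>p\<in>W. \<forall>q\<in>W. p * q \<in> W)"

definition generates :: "'a::comm_ring_1 mpoly set \<Rightarrow> 'a mpoly set \<Rightarrow> bool" where
  "generates S W \<longleftrightarrow> subalgebra hull S = W"

definition minimal_generating_set :: "'a::comm_ring_1 mpoly set \<Rightarrow> 'a mpoly set \<Rightarrow> bool" where
  "minimal_generating_set S W \<longleftrightarrow> generates S W \<and> (\<forall>T. T \<subset> S \<longrightarrow> \<not> generates T W)"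

text \<open>The concrete algebras live on \<open>'a ^ 2\<close> with scalar multiplication \<open>(*s)\<close> and the standard basis.\<close>

definition b1 :: "'a::field ^ 2" where "b1 = axis 1 1"
definition b2 :: "'a::field ^ 2" where "b2 = axis 2 1"

definition alg ::
  "'a::field ^ 2 \<Rightarrow> 'a ^ 2 \<Rightarrow> 'a ^ 2 \<Rightarrow> 'a ^ 2 \<Rightarrow> 'a ^ 2 \<Rightarrow> 'a ^ 2 \<Rightarrow> 'a ^ 2" where
  "alg p11 p12 p21 p22 u v =
     (u $ 1 * v $ 1) *s p11 + (u $ 1 * v $ 2) *s p12 + (u $ 2 * v $ 1) *s p21 + (u $ 2 * v $ 2) *s p22"

definition "alg_A1 \<alpha> = alg (b1 + b2) (\<alpha> *s b2) ((1 - \<alpha>) *s b2) 0"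
definition "alg_A2 = alg b2 b2 (- b2) 0"
definition "alg_A3 = alg b2 0 0 0"
definition "alg_A4_0 = alg b2 b1 (- b1) 0"
definition "alg_B2 \<alpha> = alg 0 ((1 - \<alpha>) *s b1) (\<alpha> *s b1) 0"
definition "alg_B3 = alg 0 b2 (- b2) 0"
definition \<comment> \<open>the algebra \<open>C(\<alpha>, 0)\<close>\<close>
  "alg_C_0 \<alpha> = alg b2 ((1 - \<alpha>) *s b1) (\<alpha> *s b1) b2"
definition "alg_D1 \<alpha> \<beta> = alg b1 ((1 - \<alpha>) *s b1 + \<beta> *s b2) (\<alpha> *s b1 - \<beta> *s b2) 0"
definition "alg_D2 \<alpha> \<beta> = alg b1 (\<alpha> *s b2) (\<beta> *s b2) 0"
definition "alg_E1 \<alpha> \<beta> \<gamma> \<delta> = alg b1 (\<alpha> *s b1 + \<beta> *s b2) (\<gamma> *s b1 + \<delta> *s b2) b2"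
definition \<comment> \<open>the algebra \<open>E\<^sub>3(\<alpha>, \<alpha>, -1)\<close>\<close>
  "alg_E3 \<alpha> = alg b1 ((\<alpha> - 1) *s b1 - \<alpha> *s b2) (- \<alpha> *s b1 + (\<alpha> - 1) *s b2) b2"
definition "alg_E5 \<alpha> = alg b1 ((1 - \<alpha>) *s b1 + \<alpha> *s b2) (\<alpha> *s b1 + (1 - \<alpha>) *s b2) b2"
definition "alg_N = alg 0 0 0 0"

definition orbit_representatives :: "('b \<Rightarrow> 'b set) \<Rightarrow> 'b set \<Rightarrow> 'b set \<Rightarrow> bool" where
  "orbit_representatives orb S R \<longleftrightarrow> R \<subseteq> S \<and> (\<forall>s\<in>S. \<exists>!r. r \<in> R \<and> r \<in> orb s)"

definition U_orbit :: "'a::field \<times> 'a \<Rightarrow> ('a \<times> 'a) set" where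
  "U_orbit = (\<lambda>(\<alpha>, \<beta>). {(\<alpha>, \<beta>), (1 - \<alpha> + \<beta>, \<beta>)})"

definition is_U :: "('a::field \<times> 'a) set \<Rightarrow> bool" where
  "is_U U \<longleftrightarrow> orbit_representatives U_orbit UNIV U"

definition T_set :: "('a::field \<times> 'a) set" where
  "T_set = {(\<alpha>, \<beta>). \<alpha> + \<beta> = 1}"

type_synonym 'a quad = "'a \<times> 'a \<times> 'a \<times> 'a"
type_synonym 'a triple = "('a \<times> 'a) \<times> ('a \<times> 'a) \<times> ('a \<times> 'a)"

definition par_D :: "'a::field quad \<Rightarrow> 'a" where
  "par_D = (\<lambda>(\<alpha>, \<beta>, \<gamma>, \<delta>). (\<alpha> + \<gamma>) * (\<beta> + \<delta>) - 1)"

definition par_C1 :: "'a::field quad \<Rightarrow> 'a \<times> 'a" where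
  "par_C1 = (\<lambda>(\<alpha>, \<beta>, \<gamma>, \<delta>). (\<beta>, \<delta>))"

definition par_C2 :: "'a::field quad \<Rightarrow> 'a \<times> 'a" where
  "par_C2 = (\<lambda>(\<alpha>, \<beta>, \<gamma>, \<delta>). (\<gamma>, \<alpha>))"

text \<open>Only meaningful, and only used, for \<open>par_D \<Gamma> \<noteq> 0\<close>.\<close>

definition par_C3 :: "'a::field quad \<Rightarrow> 'a \<times> 'a" where
  "par_C3 = (\<lambda>(\<alpha>, \<beta>, \<gamma>, \<delta>).
     ((\<beta> * \<gamma> - (\<alpha> - 1) * (\<delta> - 1)) / par_D (\<alpha>, \<beta>, \<gamma>, \<delta>),
      (\<alpha> * \<delta> - (\<beta> - 1) * (\<gamma> - 1)) / par_D (\<alpha>, \<beta>, \<gamma>, \<delta>)))"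

definition admissible :: "'a::field quad set" where
  "admissible = {\<Gamma>. par_D \<Gamma> \<noteq> 0 \<and> par_C1 \<Gamma> \<notin> T_set \<and> par_C2 \<Gamma> \<notin> T_set}"

definition triples :: "'a::field triple set" where
  "triples = (\<lambda>\<Gamma>. (par_C1 \<Gamma>, par_C2 \<Gamma>, par_C3 \<Gamma>)) ` admissible"

definition S3_orbit :: "'a triple \<Rightarrow> 'a triple set" where
  "S3_orbit = (\<lambda>(p, q, r). {(p, q, r), (p, r, q), (q, p, r), (q, r, p), (r, p, q), (r, q, p)})"

definition is_V_tilde :: "'a::field triple set \<Rightarrow> bool" where
  "is_V_tilde Vt \<longleftrightarrow> orbit_representatives S3_orbit triples Vt \<and>
     (\<forall>(p, q, r)\<in>Vt. p \<noteq> q \<longrightarrow> r \<noteq> p \<and> r \<noteq> q)"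

definition V_set :: "'a::field triple set \<Rightarrow> 'a quad set" where
  "V_set Vt = {\<Gamma> \<in> admissible. (par_C1 \<Gamma>, par_C2 \<Gamma>, par_C3 \<Gamma>) \<in> Vt}"

text \<open>\<open>listed U Vt m mul S\<close>: the algebra on \<open>'a ^ 2\<close> with multiplication \<open>mul\<close> occurs in the list,
  with \<open>S\<close> as the indicated generating set of its algebra of invariants of \<open>m\<close>-tuples.\<close>

inductive listed ::
  "('a::field \<times> 'a) set \<Rightarrow> 'a triple set \<Rightarrow> nat \<Rightarrow> ('a ^ 2 \<Rightarrow> 'a ^ 2 \<Rightarrow> 'a ^ 2) \<Rightarrow> 'a mpoly set \<Rightarrow> bool"
  for U Vt m where
  A1: "listed U Vt m (alg_A1 \<alpha>)
    ({1} \<union> {xvar r |r. 1 \<le> r \<and> r \<le> m}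
         \<union> {xvar r * yvar s - yvar r * xvar s |r s. 1 \<le> r \<and> r < s \<and> s \<le> m})"
| A2: "listed U Vt m alg_A2
    ({1} \<union> {xvar r |r. 1 \<le> r \<and> r \<le> m}
         \<union> {xvar r * yvar s - yvar r * xvar s |r s. 1 \<le> r \<and> r < s \<and> s \<le> m})"
| A3: "listed U Vt m alg_A3 {1}"
| A4_0: "listed U Vt m alg_A4_0
    ({1} \<union> {xvar r * xvar s |r s. 1 \<le> r \<and> r \<le> s \<and> s \<le> m} \<union> {yvar r |r. 1 \<le> r \<and> r \<le> m})"
| B2: "listed U Vt m (alg_B2 \<alpha>) ({1} \<union> {yvar r |r. 1 \<le> r \<and> r \<le> m})"
| B3: "listed U Vt m alg_B3 ({1} \<union> {xvar r |r. 1 \<le> r \<and> r \<le> m})"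
| C_0: "listed U Vt m (alg_C_0 \<alpha>)
    ({1} \<union> {xvar r * xvar s |r s. 1 \<le> r \<and> r \<le> s \<and> s \<le> m} \<union> {yvar r |r. 1 \<le> r \<and> r \<le> m})"
| D1: "(\<alpha>, 2 * \<alpha> - 1) \<in> U \<Longrightarrow> listed U Vt m (alg_D1 \<alpha> (2 * \<alpha> - 1))
    ({1} \<union> {2 * xvar r + yvar r |r. 1 \<le> r \<and> r \<le> m}
         \<union> {yvar r * yvar s |r s. 1 \<le> r \<and> r \<le> s \<and> s \<le> m})"
| D2: "(\<alpha>, \<beta>) \<notin> T_set \<Longrightarrow> listed U Vt m (alg_D2 \<alpha> \<beta>) ({1} \<union> {xvar r |r. 1 \<le> r \<and> r \<le> m})"
| E1: "(\<alpha>, \<beta>, \<beta>, \<alpha>) \<in> V_set Vt \<Longrightarrow> (\<alpha>, \<beta>) \<noteq> (- 1, - 1) \<Longrightarrow> listed U Vt m (alg_E1 \<alpha> \<beta> \<beta> \<alpha>)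
    ({1} \<union> {xvar r + yvar r |r. 1 \<le> r \<and> r \<le> m} \<union> {xvar r * yvar r |r. 1 \<le> r \<and> r \<le> m}
         \<union> {xvar r * yvar s + yvar r * xvar s |r s. 1 \<le> r \<and> r < s \<and> s \<le> m})"
| E1_special: "listed U Vt m (alg_E1 (- 1) (- 1) (- 1) (- 1))
    ({1} \<union> {2 * xvar r * xvar s - xvar r * yvar s - yvar r * xvar s + 2 * yvar r * yvar s
               |r s. 1 \<le> r \<and> r \<le> s \<and> s \<le> m}
         \<union> {2 * xvar r * xvar s * xvar t - xvar r * xvar s * yvar t - xvar r * yvar s * xvar t
              - xvar r * yvar s * yvar t - yvar r * xvar s * xvar t - yvar r * xvar s * yvar t
              - yvar r * yvar s * xvar t + 2 * yvar r * yvar s * yvar t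
               |r s t. 1 \<le> r \<and> r \<le> s \<and> s \<le> t \<and> t \<le> m})"
| E3: "listed U Vt m (alg_E3 \<alpha>)
    ({1} \<union> {xvar r + yvar r |r. 1 \<le> r \<and> r \<le> m} \<union> {xvar r * yvar r |r. 1 \<le> r \<and> r \<le> m}
         \<union> {xvar r * yvar s + yvar r * xvar s |r s. 1 \<le> r \<and> r < s \<and> s \<le> m})"
| E5: "listed U Vt m (alg_E5 \<alpha>) ({1} \<union> {xvar r + yvar r |r. 1 \<le> r \<and> r \<le> m})"
| N: "listed U Vt m alg_N {1}"

end

theory Submission
  imports Defs
begin

text \<open>
  Classification: a nontrivial automorphism is brought to Jordan form. The eigenvalue equations
  leave only three small families of structure constants (unipotent Jordan block, one eigenvalue
  \<open>1\<close>, or no eigenvalue \<open>1\<close>), and rescaling or passing to a basis of idempotents turns each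
  member into a listed algebra.

  Invariants: since the field is infinite, polynomials are determined by their values. For tori one
  lets the parameter tend to \<open>0\<close>. For groups of order two the coordinate ring is the sum of the
  proposed algebra \<open>H\<close> and of \<open>H \<cdot> D\<close>, with \<open>D\<close> consisting of odd elements whose pairwise
  products lie in \<open>H\<close>; the odd summand of an invariant vanishes. The group \<open>S\<^sub>3\<close> is handled by
  first splitting into eigenspaces of a 3-cycle. For the additive group \<open>y \<mapsto> y + b x\<close> one
  inducts on the number of pairs and on the weight (degree in \<open>x\<close> minus degree in \<open>y\<close>): modulo
  \<open>x\<^sub>m\<^sub>+\<^sub>1\<close> an invariant is a polynomial in \<open>y\<^sub>m\<^sub>+\<^sub>1\<close> whose \<open>j\<close>-th coefficient is an invariant of
  \<open>j\<close> higher weight in fewer variables, hence a combination of products with at least \<open>j\<close>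
  factors \<open>x\<^sub>i\<close>, and these can be replaced by brackets \<open>[i, m + 1]\<close>.

  Minimality: for every generator there is a subalgebra, defined by vanishing coefficients, that
  contains all the other generators.
\<close>

section \<open>Evaluation of polynomials and subalgebras\<close>

text \<open>A shear group has closed orbits and is infinite, so neither a limit nor a finite average
  is available for it. The substitute is the torus \<open>(x, y) -> (a x, y / a)\<close>: it need
  not consist of automorphisms, but it normalises the shears and therefore grades their invariants.
  In negative weight there is only 0, which is what stops the induction. For finite groups the
  average is replaced by an explicit decomposition into eigenspaces whose generators are known,
  because membership in a concrete subalgebra has to come out, not just invariance. Algebraic
  closedness supplies the eigenvalues and the square and cube roots that rescale basis vectors or
  reach idempotents; most changes of basis are found by solving for idempotents or for vectors of
  square zero. In the symmetric family a parameter has two equal components \<open>C1 = C2\<close>;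
  the extra condition on \<open>Vt\<close> makes sure that the chosen representative keeps them in
  the first two places.\<close>

lemma pscale_module: "module (pscale :: 'a::comm_ring_1 \<Rightarrow> 'a mpoly \<Rightarrow> 'a mpoly)"
  by unfold_locales (simp_all add: pscale_def algebra_simps single_add mult_single flip: mult.assoc)

lemma subalgebra_iff:
  "subalgebra W \<longleftrightarrow> 0 \<in> W \<and> (\<forall>p\<in>W. \<forall>q\<in>W. p + q \<in> W) \<and> (\<forall>c. \<forall>p\<in>W. pscale c p \<in> W) \<and>
     (\<forall>p\<in>W. \<forall>q\<in>W. p * q \<in> W)"
  by (auto simp: subalgebra_def module.subspace_def[OF pscale_module])

lemma subalgebra_Inter: "(\<And>W. W \<in> F \<Longrightarrow> subalgebra W) \<Longrightarrow> subalgebra (\<Inter>F)"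
  by (auto simp: subalgebra_iff)

lemma subalgebra_hull [intro, simp]: "subalgebra (subalgebra hull S)"
  by (rule hull_in) (auto intro: subalgebra_Inter)

context
  fixes W :: "'a::comm_ring_1 mpoly set"
  assumes W: "subalgebra W"
begin

lemma subalgebra_zero: "0 \<in> W"
  and subalgebra_add: "p \<in> W \<Longrightarrow> q \<in> W \<Longrightarrow> p + q \<in> W"
  and subalgebra_mult: "p \<in> W \<Longrightarrow> q \<in> W \<Longrightarrow> p * q \<in> W"
  and subalgebra_scale: "p \<in> W \<Longrightarrow> pscale c p \<in> W"
  using W by (auto simp: subalgebra_iff)

lemma subalgebra_uminus: "p \<in> W \<Longrightarrow> - p \<in> W"
  using subalgebra_scale[of p "- 1"] by (simp add: pscale_def single_uminus)

lemma subalgebra_diff: "p \<in> W \<Longrightarrow> q \<in> W \<Longrightarrow> p - q \<in> W"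
  using subalgebra_add[of p "- q"] subalgebra_uminus[of q] by simp

lemma subalgebra_sum: "(\<And>i. i \<in> I \<Longrightarrow> f i \<in> W) \<Longrightarrow> sum f I \<in> W"
  by (induction I rule: infinite_finite_induct) (auto intro: subalgebra_zero subalgebra_add)

lemma subalgebra_power: "1 \<in> W \<Longrightarrow> p \<in> W \<Longrightarrow> p ^ n \<in> W"
  by (induction n) (auto intro: subalgebra_mult)

lemma subalgebra_prod: "1 \<in> W \<Longrightarrow> (\<And>i. i \<in> I \<Longrightarrow> f i \<in> W) \<Longrightarrow> prod f I \<in> W"
  by (induction I rule: infinite_finite_induct) (auto intro: subalgebra_mult)

end

definition cst :: "'a::comm_ring_1 \<Rightarrow> 'a mpoly" where
  "cst c = Poly_Mapping.single 0 c"

lemma cst_hom [simp]: "cst 0 = 0" "cst 1 = 1" "cst (numeral n) = numeral n" 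
  and cst_add: "cst (a + b) = cst a + cst b" and cst_mult: "cst (a * b) = cst a * cst b"
  and cst_uminus: "cst (- a) = - cst a"
  by (simp_all add: cst_def single_add mult_single single_uminus)

lemma pscale_cst: "pscale c p = cst c * p"
  by (simp add: pscale_def cst_def)

lemma subalgebra_cst_mult: "subalgebra W \<Longrightarrow> p \<in> W \<Longrightarrow> cst c * p \<in> W"
  using subalgebra_scale[of W p c] by (simp add: pscale_cst)

text \<open>The elements \<open>q\<close> for which multiplication by \<open>q\<close> preserves
  \<open>P\<close> form a subalgebra containing \<open>S\<close>, so \<open>f\<close> is among them;
  apply this to the element 1. The gain over plain hull induction is that only products with a
  single generator on the left have to be treated.\<close>

lemma hull_induct_left [consumes 2, case_names one add scale mult]:
  assumes "f \<in> subalgebra hull S" "1 \<in> S"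
    and one: "P 1" and add: "\<And>p q. P p \<Longrightarrow> P q \<Longrightarrow> P (p + q)"
    and scale: "\<And>c p. P p \<Longrightarrow> P (cst c * p)"
    and mult: "\<And>s p. s \<in> S \<Longrightarrow> P p \<Longrightarrow> P (s * p)"
  shows "P f"
proof -
  have "subalgebra {q. \<forall>p. P p \<longrightarrow> P (q * p)}"
    unfolding subalgebra_iff using add scale scale[of _ 0]
    by (auto simp: pscale_cst ring_distribs mult.assoc)
  hence "\<forall>p. P p \<longrightarrow> P (f * p)"
    using hull_minimal[of S "{q. \<forall>p. P p \<longrightarrow> P (q * p)}" subalgebra] assms(1) mult by blast
  from this[rule_format, OF one] show ?thesis by simp
qed

text \<open>Evaluation along a ring homomorphism \<open>\<phi>\<close> of the coefficients; it covers evaluation at a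
  point, substitution of polynomials, and restriction to a polynomial curve.\<close>

definition monom_val :: "('i \<Rightarrow> 'b::comm_ring_1) \<Rightarrow> ('i \<Rightarrow>\<^sub>0 nat) \<Rightarrow> 'b" where
  "monom_val \<nu> t = (\<Prod>v\<in>Poly_Mapping.keys t. \<nu> v ^ Poly_Mapping.lookup t v)"

definition ev :: "('a::comm_ring_1 \<Rightarrow> 'b::comm_ring_1) \<Rightarrow> (coord \<Rightarrow> 'b) \<Rightarrow> 'a mpoly \<Rightarrow> 'b" where
  "ev \<phi> \<nu> p = (\<Sum>t\<in>Poly_Mapping.keys p. \<phi> (Poly_Mapping.lookup p t) * monom_val \<nu> t)"

definition ring_map :: "('a::comm_ring_1 \<Rightarrow> 'b::comm_ring_1) \<Rightarrow> bool" where
  "ring_map \<phi> \<longleftrightarrow> \<phi> 0 = 0 \<and> \<phi> 1 = 1 \<and> (\<forall>a b. \<phi> (a + b) = \<phi> a + \<phi> b) \<and> (\<forall>a b. \<phi> (a * b) = \<phi> a * \<phi> b)"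

lemma monom_val_superset:
  assumes "finite K" "Poly_Mapping.keys t \<subseteq> K"
  shows "monom_val \<nu> t = (\<Prod>v\<in>K. \<nu> v ^ Poly_Mapping.lookup t v)"
  unfolding monom_val_def
  by (rule prod.mono_neutral_left) (use assms in \<open>auto simp: in_keys_iff\<close>)

lemma monom_val_0 [simp]: "monom_val \<nu> 0 = 1"
  by (simp add: monom_val_def)

lemma monom_val_single [simp]: "monom_val \<nu> (Poly_Mapping.single v n) = \<nu> v ^ n"
  by (simp add: monom_val_def)

lemma monom_val_add: "monom_val \<nu> (s + t) = monom_val \<nu> s * monom_val \<nu> t"
proof -
  let ?K = "Poly_Mapping.keys s \<union> Poly_Mapping.keys t"
  have "monom_val \<nu> u = (\<Prod>v\<in>?K. \<nu> v ^ Poly_Mapping.lookup u v)" if "u \<in> {s, t, s + t}" for u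
    by (rule monom_val_superset) (use that keys_add[of s t] in auto)
  thus ?thesis by (simp add: lookup_add power_add prod.distrib)
qed

lemma ring_mapD:
  assumes "ring_map \<phi>"
  shows "\<phi> 0 = 0" "\<phi> 1 = 1" "\<phi> (a + b) = \<phi> a + \<phi> b" "\<phi> (a * b) = \<phi> a * \<phi> b"
  using assms by (auto simp: ring_map_def)

lemma ring_map_sum: "ring_map \<phi> \<Longrightarrow> \<phi> (sum f I) = (\<Sum>i\<in>I. \<phi> (f i))"
  by (induction I rule: infinite_finite_induct) (auto simp: ring_mapD)

lemma ring_map_power: "ring_map \<phi> \<Longrightarrow> \<phi> (a ^ n) = \<phi> a ^ n"
  by (induction n) (auto simp: ring_mapD)

lemma ring_map_prod: "ring_map \<phi> \<Longrightarrow> \<phi> (prod f I) = (\<Prod>i\<in>I. \<phi> (f i))"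
  by (induction I rule: infinite_finite_induct) (auto simp: ring_mapD)

lemma sum_single_lookup:
  "p = (\<Sum>t\<in>Poly_Mapping.keys p. Poly_Mapping.single t (Poly_Mapping.lookup p t))"
  by (rule poly_mapping_eqI)
     (auto simp: lookup_sum lookup_single when_def in_keys_iff sum.delta)

context
  fixes \<phi> :: "'a::comm_ring_1 \<Rightarrow> 'b::comm_ring_1"
  assumes \<phi>: "ring_map \<phi>"
begin

lemma ev_superset:
  assumes "finite K" "Poly_Mapping.keys p \<subseteq> K"
  shows "ev \<phi> \<nu> p = (\<Sum>t\<in>K. \<phi> (Poly_Mapping.lookup p t) * monom_val \<nu> t)"
  unfolding ev_def
  by (rule sum.mono_neutral_left) (use assms in \<open>auto simp: in_keys_iff ring_mapD[OF \<phi>]\<close>)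

lemma ev_0 [simp]: "ev \<phi> \<nu> 0 = 0"
  by (simp add: ev_def)

lemma ev_add: "ev \<phi> \<nu> (p + q) = ev \<phi> \<nu> p + ev \<phi> \<nu> q"
proof -
  let ?K = "Poly_Mapping.keys p \<union> Poly_Mapping.keys q"
  have "ev \<phi> \<nu> u = (\<Sum>t\<in>?K. \<phi> (Poly_Mapping.lookup u t) * monom_val \<nu> t)" if "u \<in> {p, q, p + q}" for u
    by (rule ev_superset) (use that keys_add[of p q] in auto)
  thus ?thesis by (simp add: lookup_add ring_mapD[OF \<phi>] sum.distrib ring_distribs)
qed

lemma ev_sum: "ev \<phi> \<nu> (sum f I) = (\<Sum>i\<in>I. ev \<phi> \<nu> (f i))"
  by (induction I rule: infinite_finite_induct) (auto simp: ev_add)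

lemma ev_single: "ev \<phi> \<nu> (Poly_Mapping.single t c) = \<phi> c * monom_val \<nu> t"
  by (simp add: ev_def ring_mapD[OF \<phi>])

lemma ev_mult: "ev \<phi> \<nu> (p * q) = ev \<phi> \<nu> p * ev \<phi> \<nu> q"
proof -
  have "ev \<phi> \<nu> (p * q) = ev \<phi> \<nu> ((\<Sum>s\<in>Poly_Mapping.keys p. Poly_Mapping.single s (Poly_Mapping.lookup p s)) *
      (\<Sum>t\<in>Poly_Mapping.keys q. Poly_Mapping.single t (Poly_Mapping.lookup q t)))"
    using sum_single_lookup[of p] sum_single_lookup[of q] by simp
  also have "\<dots> = ev \<phi> \<nu> p * ev \<phi> \<nu> q"
    unfolding ev_def[of _ _ p] ev_def[of _ _ q]
    by (simp add: sum_product ev_sum mult_single ev_single monom_val_add ring_mapD[OF \<phi>] ac_simps)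
  finally show ?thesis .
qed

lemma ev_cst [simp]: "ev \<phi> \<nu> (cst c) = \<phi> c"
  by (simp add: cst_def ev_single)

lemma ring_map_ev: "ring_map (ev \<phi> \<nu>)"
  using ev_cst[of \<nu> 1] by (simp add: ring_map_def ev_add ev_mult ring_mapD[OF \<phi>])

lemma ev_var [simp]: "ev \<phi> \<nu> (xvar r) = \<nu> (X r)" "ev \<phi> \<nu> (yvar r) = \<nu> (Y r)"
  by (simp_all add: xvar_def yvar_def ev_single ring_mapD[OF \<phi>])

end

text \<open>Proved once for an arbitrary ring homomorphism \<open>\<psi>\<close>, this gives both
  the evaluation of a substituted polynomial and the values of a polynomial restricted to a
  curve.\<close>

lemma ev_compose:
  assumes "ring_map \<psi>"
  shows "\<psi> (ev \<phi> \<nu> p) = ev (\<lambda>c. \<psi> (\<phi> c)) (\<lambda>v. \<psi> (\<nu> v)) p"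
  by (simp add: ev_def monom_val_def assms ring_map_sum ring_mapD ring_map_prod ring_map_power)

lemma ring_map_id: "ring_map (\<lambda>c. c)"
  by (simp add: ring_map_def)

lemma ring_map_cst: "ring_map cst"
  by (simp add: ring_map_def cst_add cst_mult)

lemma peval_ev: "peval \<nu> = ev (\<lambda>c. c) \<nu>"
  by (rule ext) (simp add: peval_def ev_def monom_val_def)

lemma ring_map_peval: "ring_map (peval \<nu>)"
  unfolding peval_ev by (rule ring_map_ev[OF ring_map_id])

lemma peval_simps [simp]:
  "peval \<nu> 0 = 0" "peval \<nu> 1 = 1" "peval \<nu> (p + q) = peval \<nu> p + peval \<nu> q"
  "peval \<nu> (p * q) = peval \<nu> p * peval \<nu> q" "peval \<nu> (cst c) = c"
  "peval \<nu> (xvar r) = \<nu> (X r)" "peval \<nu> (yvar r) = \<nu> (Y r)"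
  by (simp_all add: ring_mapD[OF ring_map_peval]) (simp_all add: peval_ev ring_map_id)

lemma peval_uminus [simp]: "peval \<nu> (- p) = - peval \<nu> p"
  using peval_simps(3)[of \<nu> p "- p"] by (simp add: eq_neg_iff_add_eq_0 add.commute)

lemma peval_diff [simp]: "peval \<nu> (p - q) = peval \<nu> p - peval \<nu> q"
  using peval_simps(3)[of \<nu> p "- q"] by simp

lemma peval_numeral [simp]: "peval \<nu> (numeral n) = numeral n"
  using peval_simps(5)[of \<nu> "numeral n"] by simp

lemma peval_power [simp]: "peval \<nu> (p ^ n) = peval \<nu> p ^ n"
  by (rule ring_map_power[OF ring_map_peval])

lemma peval_sum [simp]: "peval \<nu> (sum f I) = (\<Sum>i\<in>I. peval \<nu> (f i))"
  by (rule ring_map_sum[OF ring_map_peval])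

definition psub :: "(coord \<Rightarrow> 'a mpoly) \<Rightarrow> 'a mpoly \<Rightarrow> 'a::comm_ring_1 mpoly" where
  "psub = ev cst"

lemma ring_map_psub: "ring_map (psub \<sigma>)"
  unfolding psub_def by (rule ring_map_ev[OF ring_map_cst])

lemma psub_simps [simp]:
  "psub \<sigma> 0 = 0" "psub \<sigma> 1 = 1" "psub \<sigma> (p + q) = psub \<sigma> p + psub \<sigma> q"
  "psub \<sigma> (p * q) = psub \<sigma> p * psub \<sigma> q" "psub \<sigma> (cst c) = cst c"
  "psub \<sigma> (xvar r) = \<sigma> (X r)" "psub \<sigma> (yvar r) = \<sigma> (Y r)"
  by (simp_all add: ring_mapD[OF ring_map_psub]) (simp_all add: psub_def ring_map_cst)

lemma psub_numeral [simp]: "psub \<sigma> (numeral n) = numeral n"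
  using psub_simps(5)[of \<sigma> "numeral n"] by simp

lemma peval_psub: "peval \<nu> (psub \<sigma> p) = peval (\<lambda>v. peval \<nu> (\<sigma> v)) p"
  unfolding psub_def peval_ev using ev_compose[OF ring_map_peval[of \<nu>], of cst \<sigma> p]
  by (simp add: peval_ev ring_map_id)

lemma psub_in_subalgebra:
  assumes "subalgebra W" "1 \<in> W" "f \<in> coord_ring m"
    and "\<And>r. 1 \<le> r \<Longrightarrow> r \<le> m \<Longrightarrow> \<sigma> (X r) \<in> W" "\<And>r. 1 \<le> r \<Longrightarrow> r \<le> m \<Longrightarrow> \<sigma> (Y r) \<in> W"
  shows "psub \<sigma> f \<in> W"
  unfolding psub_def ev_def monom_val_def
proof (intro subalgebra_sum[OF assms(1)] subalgebra_cst_mult[OF assms(1)]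
    subalgebra_prod[OF assms(1,2)] subalgebra_power[OF assms(1,2)])
  fix t v assume "t \<in> Poly_Mapping.keys f" "v \<in> Poly_Mapping.keys t"
  hence "v \<in> X ` {1..m} \<union> Y ` {1..m}"
    using assms(3) by (auto simp: coord_ring_def)
  thus "\<sigma> v \<in> W" using assms(4,5) by auto
qed

section \<open>Polynomials are determined by their values\<close>

text \<open>Dedekind's argument: evaluating the relation at \<open>opr z x\<close> and subtracting
  \<open>\<theta> j z\<close> times the relation at \<open>x\<close> removes the index
  \<open>j\<close>, and the induction hypothesis applies to the coefficients
  \<open>c i * (\<theta> i z - \<theta> j z)\<close>. The monoid \<open>M\<close> is abstract
  because there are two uses: monomials as characters of points under pointwise multiplication, and
  integer powers as characters of the nonzero scalars.\<close>

lemma characters_independent: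
  fixes \<theta> :: "'i \<Rightarrow> 'm \<Rightarrow> 'a::field"
  assumes "finite S" "e \<in> M"
    and closed: "\<And>x y. x \<in> M \<Longrightarrow> y \<in> M \<Longrightarrow> opr x y \<in> M"
    and mult: "\<And>i x y. i \<in> S \<Longrightarrow> x \<in> M \<Longrightarrow> y \<in> M \<Longrightarrow> \<theta> i (opr x y) = \<theta> i x * \<theta> i y"
    and one: "\<And>i. i \<in> S \<Longrightarrow> \<theta> i e = 1"
    and distinct: "\<And>i j. i \<in> S \<Longrightarrow> j \<in> S \<Longrightarrow> i \<noteq> j \<Longrightarrow> \<exists>x\<in>M. \<theta> i x \<noteq> \<theta> j x"
    and "\<And>x. x \<in> M \<Longrightarrow> (\<Sum>i\<in>S. c i * \<theta> i x) = 0"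
    and "i \<in> S"
  shows "c i = 0"
  using assms(1,4-)
proof (induction S arbitrary: c i rule: finite_induct)
  case (insert j S)
  have S0: "c i = 0" if i: "i \<in> S" for i
  proof -
    obtain z where z: "z \<in> M" "\<theta> i z \<noteq> \<theta> j z"
      using insert.prems(3)[of i j] insert.hyps(2) i by auto
    have "c i * (\<theta> i z - \<theta> j z) = 0"
    proof (rule insert.IH[where c = "\<lambda>i. c i * (\<theta> i z - \<theta> j z)"])
      fix x assume x: "x \<in> M"
      have "0 = (\<Sum>i\<in>insert j S. c i * \<theta> i (opr z x)) - \<theta> j z * (\<Sum>i\<in>insert j S. c i * \<theta> i x)"
        using insert.prems(4) x z closed by simp
      also have "\<dots> = (\<Sum>i\<in>insert j S. c i * (\<theta> i z - \<theta> j z) * \<theta> i x)"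
        unfolding sum_distrib_left sum_subtractf[symmetric]
        by (rule sum.cong) (use insert.prems(1) x z in \<open>simp_all add: algebra_simps\<close>)
      also have "\<dots> = (\<Sum>i\<in>S. c i * (\<theta> i z - \<theta> j z) * \<theta> i x)"
        using insert.hyps by simp
      finally show "(\<Sum>i\<in>S. c i * (\<theta> i z - \<theta> j z) * \<theta> i x) = 0" by simp
    qed (use insert.prems i in auto)
    thus ?thesis using z by simp
  qed
  moreover have "c j = 0"
    using insert.prems(4)[OF assms(2)] insert.hyps S0 insert.prems(2)[of j] by simp
  ultimately show ?case using insert.prems(5) by auto
qed simp

lemma char_0_power_inject:
  "(2::'a::field_char_0) ^ m = 2 ^ n \<longleftrightarrow> m = n"
proof -
  have "(2::'a) ^ m = 2 ^ n \<longleftrightarrow> of_nat (2 ^ m) = (of_nat (2 ^ n) :: 'a)" by simp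
  also have "\<dots> \<longleftrightarrow> m = n" by (subst of_nat_eq_iff) simp
  finally show ?thesis .
qed

text \<open>Putting 2 at one variable and 1 at all others turns a monomial into 2 to the exponent of
  that variable, and powers of 2 are distinct in characteristic zero.\<close>

lemma monom_val_distinct:
  assumes "s \<noteq> t"
  shows "\<exists>\<nu>. monom_val \<nu> s \<noteq> (monom_val \<nu> t :: 'a::field_char_0)"
proof -
  obtain v where v: "Poly_Mapping.lookup s v \<noteq> Poly_Mapping.lookup t v"
    using assms by (auto simp: poly_mapping_eq_iff fun_eq_iff)
  have "monom_val (\<lambda>w. if w = v then 2 else 1 :: 'a) u = 2 ^ Poly_Mapping.lookup u v" for u
  proof -
    have "monom_val (\<lambda>w. if w = v then 2 else 1 :: 'a) u =
        (\<Prod>w\<in>insert v (Poly_Mapping.keys u). if w = v then 2 ^ Poly_Mapping.lookup u v else 1)"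
      by (rule trans[OF monom_val_superset prod.cong]) auto
    thus ?thesis by (simp add: prod.delta)
  qed
  hence "monom_val (\<lambda>w. if w = v then 2 else 1 :: 'a) s \<noteq> monom_val (\<lambda>w. if w = v then 2 else 1) t"
    using v by (simp add: char_0_power_inject)
  thus ?thesis by blast
qed

text \<open>Distinct monomials are distinct multiplicative functions of the point, so their
  independence gives all coefficients at once, without induction on the number of variables.\<close>

lemma peval_eq_0:
  fixes p :: "'a::field_char_0 mpoly"
  assumes "\<And>\<nu>. peval \<nu> p = 0"
  shows "p = 0"
proof (rule poly_mapping_eqI)
  fix t
  show "Poly_Mapping.lookup p t = Poly_Mapping.lookup 0 t"
  proof (cases "t \<in> Poly_Mapping.keys p")
    case True
    have "Poly_Mapping.lookup p t = 0"
    proof (rule characters_independent[where e = "\<lambda>_. 1" and M = UNIV and i = t and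
          c = "Poly_Mapping.lookup p" and S = "Poly_Mapping.keys p" and
          opr = "\<lambda>\<mu> \<nu> v. \<mu> v * \<nu> v" and \<theta> = "\<lambda>t \<nu>. monom_val \<nu> t"])
      show "\<exists>\<nu>\<in>UNIV. monom_val \<nu> s \<noteq> (monom_val \<nu> u :: 'a)" if "s \<noteq> u" for s u :: "coord \<Rightarrow>\<^sub>0 nat"
        using monom_val_distinct[OF that] by blast
      show "(\<Sum>t\<in>Poly_Mapping.keys p. Poly_Mapping.lookup p t * monom_val \<nu> t) = 0" for \<nu>
        using assms[of \<nu>] by (simp add: peval_ev ev_def)
      show "monom_val (\<lambda>v. \<mu> v * \<nu> v) u = monom_val \<mu> u * monom_val \<nu> u"
        for \<mu> \<nu> :: "coord \<Rightarrow> 'a" and u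
        by (simp add: monom_val_def power_mult_distrib prod.distrib)
    qed (use True in \<open>simp_all add: monom_val_def\<close>)
    thus ?thesis by simp
  qed (simp add: in_keys_iff)
qed
lemma peval_ext:
  fixes p q :: "'a::field_char_0 mpoly"
  assumes "\<And>\<nu>. peval \<nu> p = peval \<nu> q"
  shows "p = q"
  using peval_eq_0[of "p - q"] assms by simp

lemma poly_eq_of_nonzero_values:
  fixes p q :: "'a::field_char_0 poly"
  assumes "\<And>a. a \<noteq> 0 \<Longrightarrow> poly p a = poly q a"
  shows "p = q"
proof (rule ccontr)
  assume "p \<noteq> q"
  hence "finite {a. poly (p - q) a = 0}" by (intro poly_roots_finite) simp
  moreover have "UNIV - {0} \<subseteq> {a. poly (p - q) a = 0}" using assms by auto
  ultimately have "finite (UNIV - {0::'a})" using finite_subset by blast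
  thus False using infinite_UNIV_char_0[where 'a='a] by simp
qed

section \<open>Limits along polynomial curves\<close>

definition curve_poly :: "(coord \<Rightarrow> 'a poly) \<Rightarrow> 'a mpoly \<Rightarrow> 'a::comm_ring_1 poly" where
  "curve_poly = ev (\<lambda>c. [:c:])"

lemma poly_curve_poly: "poly (curve_poly P f) a = peval (\<lambda>v. poly (P v) a) f"
proof -
  have "ring_map (\<lambda>q. poly q a)" by (simp add: ring_map_def)
  from ev_compose[OF this, of "\<lambda>c. [:c:]" P f] show ?thesis
    by (simp add: curve_poly_def peval_ev)
qed

text \<open>The restriction of \<open>f\<close> to the curve is a univariate polynomial with the
  value \<open>c\<close> at infinitely many parameters, hence constant.\<close>

lemma peval_limit:
  fixes f :: "'a::field_char_0 mpoly"
  assumes "\<And>a. a \<noteq> 0 \<Longrightarrow> peval (\<lambda>v. poly (P v) a) f = c"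
  shows "peval (\<lambda>v. poly (P v) 0) f = c"
proof -
  have "curve_poly P f = [:c:]"
    by (rule poly_eq_of_nonzero_values) (simp add: poly_curve_poly assms)
  hence "poly (curve_poly P f) 0 = c" by simp
  thus ?thesis by (simp add: poly_curve_poly)
qed

text \<open>\<open>P \<nu>\<close> is a curve along which a one-parameter family moves the point
  \<open>\<nu>\<close>; its end at parameter 0 has the coordinates \<open>\<sigma>\<close>, which
  are polynomials in \<open>\<nu>\<close>. Invariance gives \<open>f = psub \<sigma> f\<close>, so
  \<open>f\<close> is a polynomial in the elements \<open>\<sigma> v\<close> of
  \<open>W\<close>.\<close>

lemma hull_limit:
  fixes f :: "'a::field_char_0 mpoly"
  assumes f: "f \<in> coord_ring m" and W: "subalgebra W" "1 \<in> W"
    and "\<And>r. 1 \<le> r \<Longrightarrow> r \<le> m \<Longrightarrow> \<sigma> (X r) \<in> W" "\<And>r. 1 \<le> r \<Longrightarrow> r \<le> m \<Longrightarrow> \<sigma> (Y r) \<in> W"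
    and inv: "\<And>a \<nu>. a \<noteq> 0 \<Longrightarrow> peval (\<lambda>v. poly (P \<nu> v) a) f = peval \<nu> f"
    and lim: "\<And>\<nu> v. poly (P \<nu> v) 0 = peval \<nu> (\<sigma> v)"
  shows "f \<in> W"
proof -
  have "f = psub \<sigma> f"
  proof (rule peval_ext)
    fix \<nu>
    show "peval \<nu> f = peval \<nu> (psub \<sigma> f)"
      using peval_limit[of "P \<nu>" f "peval \<nu> f"] inv by (simp add: lim peval_psub)
  qed
  moreover have "psub \<sigma> f \<in> W"
    by (rule psub_in_subalgebra[OF W f]) (use assms in auto)
  ultimately show ?thesis by simp
qed

section \<open>Splitting into even and odd elements\<close>

text \<open>The module over \<open>H\<close> spanned by \<open>D\<close>; the inductive form lets
  closure properties be checked on one product \<open>b * d\<close> at a time.\<close>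

inductive_set odd_part :: "'a::comm_ring_1 mpoly set \<Rightarrow> 'a mpoly set \<Rightarrow> 'a mpoly set" for H D where
  zero: "0 \<in> odd_part H D"
| add: "p \<in> odd_part H D \<Longrightarrow> b \<in> H \<Longrightarrow> d \<in> D \<Longrightarrow> b * d + p \<in> odd_part H D"

lemma odd_part_add:
  assumes "p \<in> odd_part H D" "q \<in> odd_part H D"
  shows "p + q \<in> odd_part H D"
  using assms by (induction rule: odd_part.induct) (auto intro: odd_part.intros simp: add.assoc)

lemma odd_part_mult:
  assumes "p \<in> odd_part H D" "subalgebra H'" "\<And>b d. b \<in> H \<Longrightarrow> d \<in> D \<Longrightarrow> s * (b * d) \<in> H'"
  shows "s * p \<in> H'"
  using assms(1)
  by induction (auto simp: ring_distribs intro: subalgebra_zero subalgebra_add assms)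

lemma odd_part_mult_odd:
  assumes "p \<in> odd_part H D" "\<And>b d. b \<in> H \<Longrightarrow> d \<in> D \<Longrightarrow> s * (b * d) \<in> odd_part H' D'"
  shows "s * p \<in> odd_part H' D'"
  using assms(1)
  by induction (auto simp: ring_distribs intro: odd_part.zero odd_part_add assms)

lemma odd_part_base: "b \<in> H \<Longrightarrow> d \<in> D \<Longrightarrow> b * d \<in> odd_part H D"
  using odd_part.add[OF odd_part.zero] by force

text \<open>Since products of two elements of \<open>D\<close> fall back into the hull of
  \<open>S\<close>, multiplication by an element of \<open>D\<close> exchanges the two summands,
  while multiplication by an element of \<open>S\<close> keeps them: a grading by parity. The sum is
  not claimed to be direct.\<close>

lemma hull_even_odd:
  assumes "f \<in> subalgebra hull (S \<union> D)" "1 \<in> S"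
    and DD: "\<And>d d'. d \<in> D \<Longrightarrow> d' \<in> D \<Longrightarrow> d * d' \<in> subalgebra hull S"
  shows "\<exists>b\<in>subalgebra hull S. \<exists>c\<in>odd_part (subalgebra hull S) D. f = b + c"
proof -
  let ?H = "subalgebra hull S" and ?O = "odd_part (subalgebra hull S) D"
  note sub = subalgebra_hull[of S]
  have 1: "1 \<in> ?H" using assms(2) hull_inc by metis
  have mult_H: "s * c \<in> ?O" if "s \<in> ?H" "c \<in> ?O" for s c
    by (rule odd_part_mult_odd[OF that(2)])
       (metis that(1) mult.assoc odd_part_base subalgebra_mult[OF sub])
  show ?thesis
    using assms(1) UnI1[OF assms(2)]
  proof (induction rule: hull_induct_left)
    case one
    have "1 = 1 + (0::'a mpoly)" by simp
    thus ?case using 1 odd_part.zero by blast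
  next
    case (add p q)
    then obtain b c b' c' where "b \<in> ?H" "c \<in> ?O" "b' \<in> ?H" "c' \<in> ?O" "p = b + c" "q = b' + c'"
      by blast
    hence "p + q = (b + b') + (c + c')" "b + b' \<in> ?H" "c + c' \<in> ?O"
      by (auto simp: algebra_simps intro: subalgebra_add[OF sub] odd_part_add)
    thus ?case by blast
  next
    case (scale k p)
    have "cst k \<in> ?H" using subalgebra_cst_mult[OF sub 1, of k] by simp
    moreover obtain b c where "b \<in> ?H" "c \<in> ?O" "p = b + c" using scale by blast
    ultimately have "cst k * p = cst k * b + cst k * c" "cst k * b \<in> ?H" "cst k * c \<in> ?O"
      by (auto simp: ring_distribs intro: subalgebra_mult[OF sub] mult_H)
    thus ?case by blast
  next
    case (mult s p)
    then obtain b c where bc: "b \<in> ?H" "c \<in> ?O" "p = b + c" by blast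
    show ?case
    proof (cases "s \<in> S")
      case True
      hence "s \<in> ?H" by (rule hull_inc)
      with bc have "s * p = s * b + s * c" "s * b \<in> ?H" "s * c \<in> ?O"
        by (auto simp: ring_distribs intro: subalgebra_mult[OF sub] mult_H)
      thus ?thesis by blast
    next
      case False
      hence D: "s \<in> D" using mult by blast
      have "s * c \<in> ?H"
      proof (rule odd_part_mult[OF bc(2) sub])
        fix b d assume "b \<in> ?H" "d \<in> D"
        moreover have "s * (b * d) = b * (s * d)" by (simp add: ac_simps)
        ultimately show "s * (b * d) \<in> ?H" using DD[OF D] subalgebra_mult[OF sub] by metis
      qed
      moreover have "s * b \<in> ?O" using odd_part_base[OF bc(1) D] by (simp add: mult.commute)
      moreover have "s * p = s * c + s * b" by (simp add: bc ring_distribs add.commute)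
      ultimately show ?thesis by blast
    qed
  qed
qed

lemma peval_hull_invariant:
  assumes "f \<in> subalgebra hull S" "\<And>s. s \<in> S \<Longrightarrow> peval \<mu> s = peval \<nu> s"
  shows "peval \<mu> f = peval \<nu> f"
  using assms(1)
  by (rule hull_induct) (auto simp: assms(2) subalgebra_iff pscale_cst)

text \<open>In the decomposition \<open>f = b + c\<close> the map \<open>T\<close> fixes
  \<open>b\<close> and negates \<open>c\<close>, so invariance of \<open>f\<close> gives
  \<open>2 c = 0\<close> at every point. This plays the role of averaging over a group of order
  two.\<close>

lemma hull_even:
  fixes f :: "'a::field_char_0 mpoly"
  assumes "f \<in> subalgebra hull (S \<union> D)" "1 \<in> S"
    and DD: "\<And>d d'. d \<in> D \<Longrightarrow> d' \<in> D \<Longrightarrow> d * d' \<in> subalgebra hull S"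
    and S: "\<And>s \<nu>. s \<in> S \<Longrightarrow> peval (T \<nu>) s = peval \<nu> s"
    and D: "\<And>d \<nu>. d \<in> D \<Longrightarrow> peval (T \<nu>) d = - peval \<nu> d"
    and f: "\<And>\<nu>. peval (T \<nu>) f = peval \<nu> f"
  shows "f \<in> subalgebra hull S"
proof -
  obtain b c where bc: "b \<in> subalgebra hull S" "c \<in> odd_part (subalgebra hull S) D" "f = b + c"
    using hull_even_odd[OF assms(1-3)] by blast
  have b: "peval (T \<nu>) g = peval \<nu> g" if "g \<in> subalgebra hull S" for g \<nu>
    using that S by (rule peval_hull_invariant)
  have c: "peval (T \<nu>) c = - peval \<nu> c" for \<nu>
    using bc(2) by induction (auto simp: b D)
  have "c = 0"
  proof (rule peval_eq_0)
    show "peval \<nu> c = 0" for \<nu>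
      using f[of \<nu>] b[OF bc(1), of \<nu>] c[of \<nu>] by (simp add: bc(3))
  qed
  thus ?thesis using bc by simp
qed

lemma subalgebra_coord_ring: "subalgebra (coord_ring m :: 'a::comm_ring_1 mpoly set)"
proof -
  have "p + q \<in> coord_ring m" "p * q \<in> coord_ring m"
    if "p \<in> coord_ring m" "q \<in> coord_ring m" for p q :: "'a mpoly"
  proof -
    have "Poly_Mapping.keys t \<subseteq> X ` {1..m} \<union> Y ` {1..m}" if "t \<in> Poly_Mapping.keys (p + q)" for t
      using subsetD[OF keys_add that] \<open>p \<in> _\<close> \<open>q \<in> _\<close> by (auto simp: coord_ring_def)
    thus "p + q \<in> coord_ring m" by (auto simp: coord_ring_def)
    have "Poly_Mapping.keys t \<subseteq> X ` {1..m} \<union> Y ` {1..m}" if t: "t \<in> Poly_Mapping.keys (p * q)" for t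
    proof -
      obtain s u where "s \<in> Poly_Mapping.keys p" "u \<in> Poly_Mapping.keys q" "t = s + u"
        using keys_mult[of p q] t by blast
      thus ?thesis using keys_add[of s u] \<open>p \<in> _\<close> \<open>q \<in> _\<close> unfolding coord_ring_def by blast
    qed
    thus "p * q \<in> coord_ring m" by (auto simp: coord_ring_def)
  qed
  moreover have "cst c \<in> coord_ring m" for c :: 'a
    by (simp add: coord_ring_def cst_def)
  moreover have "0 \<in> coord_ring m" by (simp add: coord_ring_def)
  ultimately show ?thesis unfolding subalgebra_iff pscale_cst by blast
qed

lemma coord_ring_base [simp]:
  "1 \<in> coord_ring m" "cst c \<in> coord_ring m"
  "1 \<le> r \<Longrightarrow> r \<le> m \<Longrightarrow> xvar r \<in> coord_ring m" "1 \<le> r \<Longrightarrow> r \<le> m \<Longrightarrow> yvar r \<in> coord_ring m"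
  by (simp_all add: coord_ring_def cst_def xvar_def yvar_def)

lemma psub_id:
  fixes f :: "'a::field_char_0 mpoly"
  shows "psub (case_coord xvar yvar) f = f"
proof (rule peval_ext)
  have "(\<lambda>v. peval \<nu> (case_coord xvar yvar v)) = (\<nu> :: _ \<Rightarrow> 'a)" for \<nu>
    by (rule ext) (simp split: coord.split)
  thus "peval \<nu> (psub (case_coord xvar yvar) f) = peval \<nu> f" for \<nu> :: "_ \<Rightarrow> 'a"
    by (simp add: peval_psub)
qed

lemma coord_ring_subset:
  fixes W :: "'a::field_char_0 mpoly set"
  assumes "subalgebra W" "1 \<in> W" "\<And>r. 1 \<le> r \<Longrightarrow> r \<le> m \<Longrightarrow> xvar r \<in> W" "\<And>r. 1 \<le> r \<Longrightarrow> r \<le> m \<Longrightarrow> yvar r \<in> W"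
  shows "coord_ring m \<subseteq> W"
proof
  fix f :: "'a mpoly" assume "f \<in> coord_ring m"
  from psub_in_subalgebra[OF assms(1,2) this, of "case_coord xvar yvar"] show "f \<in> W"
    using assms by (simp add: psub_id)
qed

section \<open>Invariants of a unipotent one-parameter group\<close>

definition bracket :: "nat \<Rightarrow> nat \<Rightarrow> 'a::comm_ring_1 mpoly" where
  "bracket r s = xvar r * yvar s - yvar r * xvar s"

lemma peval_bracket [simp]: "peval \<nu> (bracket r s) = \<nu> (X r) * \<nu> (Y s) - \<nu> (Y r) * \<nu> (X s)"
  by (simp add: bracket_def)

definition shear :: "'a::comm_ring_1 \<Rightarrow> (coord \<Rightarrow> 'a) \<Rightarrow> coord \<Rightarrow> 'a" where
  "shear b \<nu> = case_coord (\<lambda>r. \<nu> (X r)) (\<lambda>r. \<nu> (Y r) + b * \<nu> (X r))"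

text \<open>These maps have determinant 1 and normalise the shears. They serve to grade the shear
  invariants and need not come from automorphisms of the algebra.\<close>

definition torus :: "'a::field \<Rightarrow> (coord \<Rightarrow> 'a) \<Rightarrow> coord \<Rightarrow> 'a" where
  "torus a \<nu> = case_coord (\<lambda>r. a * \<nu> (X r)) (\<lambda>r. \<nu> (Y r) / a)"

definition shear_inv :: "'a::field mpoly \<Rightarrow> bool" where
  "shear_inv f \<longleftrightarrow> (\<forall>b \<nu>. peval (shear b \<nu>) f = peval \<nu> f)"

definition has_weight :: "int \<Rightarrow> 'a::field mpoly \<Rightarrow> bool" where
  "has_weight w f \<longleftrightarrow> (\<forall>a \<nu>. a \<noteq> 0 \<longrightarrow> peval (torus a \<nu>) f = a powi w * peval \<nu> f)"

lemma shear_simps [simp]: "shear b \<nu> (X r) = \<nu> (X r)" "shear b \<nu> (Y r) = \<nu> (Y r) + b * \<nu> (X r)"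
  and torus_simps [simp]: "torus a \<nu> (X r) = a * \<nu> (X r)" "torus a \<nu> (Y r) = \<nu> (Y r) / a"
  by (simp_all add: shear_def torus_def)

lemma coord_fun_eqI: "(\<And>r. f (X r) = g (X r)) \<Longrightarrow> (\<And>r. f (Y r) = g (Y r)) \<Longrightarrow> f = g"
  by (rule ext) (metis coord.exhaust)

lemma peval_cong:
  assumes "f \<in> coord_ring m" "\<And>r. 1 \<le> r \<Longrightarrow> r \<le> m \<Longrightarrow> \<mu> (X r) = \<nu> (X r)"
    "\<And>r. 1 \<le> r \<Longrightarrow> r \<le> m \<Longrightarrow> \<mu> (Y r) = \<nu> (Y r)"
  shows "peval \<mu> f = peval \<nu> f"
  unfolding peval_ev ev_def monom_val_def
proof (intro sum.cong prod.cong refl arg_cong2[where f = "(*)"] arg_cong2[where f = "(^)"])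
  fix t v assume "t \<in> Poly_Mapping.keys f" "v \<in> Poly_Mapping.keys t"
  hence "v \<in> X ` {1..m} \<union> Y ` {1..m}"
    using assms(1) by (auto simp: coord_ring_def)
  thus "\<mu> v = \<nu> v" using assms(2,3) by auto
qed

text \<open>A point with zero coordinate \<open>v\<close> lies on the line that varies this
  coordinate alone, and the polynomial vanishes at all other points of that line. This is what
  permits cancelling a variable in an identity.\<close>

lemma var_cancel:
  fixes p :: "'a::field_char_0 mpoly"
  assumes "\<And>\<nu>. \<nu> v \<noteq> 0 \<Longrightarrow> peval \<nu> p = 0"
  shows "p = 0"
proof (rule peval_eq_0)
  fix \<nu> :: "coord \<Rightarrow> 'a"
  show "peval \<nu> p = 0"
  proof (cases "\<nu> v = 0")
    case True
    let ?P = "\<lambda>u. if u = v then [:0, 1:] else [:\<nu> u:]"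
    have "peval (\<lambda>u. poly (?P u) 0) p = 0"
      by (rule peval_limit) (rule assms, simp)
    moreover have "(\<lambda>u. poly (?P u) 0) = \<nu>" using True by auto
    ultimately show ?thesis by simp
  qed (rule assms)
qed

text \<open>The polynomial \<open>F z\<close> is the value of \<open>f\<close> at \<open>(x + ((z - x\<^sub>1) / y\<^sub>1) y, y)\<close>. Shearing by
  \<open>- y\<^sub>1 / z\<close> and rescaling by the torus shows that it tends to \<open>0\<close> as \<open>z\<close> tends to infinity.\<close>

lemma shear_inv_negative_weight:
  fixes f :: "'a::field_char_0 mpoly"
  assumes inv: "shear_inv f" and wt: "has_weight w f" and neg: "w < 0"
  shows "f = 0"
proof (rule var_cancel[of "Y 1"])
  fix \<nu> :: "coord \<Rightarrow> 'a" assume y1: "\<nu> (Y 1) \<noteq> 0"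
  define x where "x r = \<nu> (X r)" for r
  define c where "c = \<nu> (Y 1)"
  define t where "t r = \<nu> (Y r) / c" for r
  have c: "c \<noteq> 0" using y1 by (simp add: c_def)
  define P where "P = case_coord (\<lambda>r. [:x r - x 1 * t r, t r:]) (\<lambda>r. [:t r * c:])"
  define Q where "Q = case_coord (\<lambda>r. [:t r, x r - x 1 * t r:]) (\<lambda>r. [:c * (x 1 * t r - x r):])"
  define F where "F = curve_poly P f"
  define H where "H = curve_poly Q f"
  define n where "n = nat (- w)"
  have FH: "poly F (1 / e) = e ^ n * poly H e" if e: "e \<noteq> 0" for e
  proof -
    define \<mu> where "\<mu> = (\<lambda>v. poly (P v) (1 / e))"
    define \<kappa> where "\<kappa> = (\<lambda>v. poly (Q v) e)"
    have "shear (- c * e) \<mu> = torus (1 / e) \<kappa>"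
      using e by (intro coord_fun_eqI) (simp_all add: \<mu>_def \<kappa>_def P_def Q_def algebra_simps)
    moreover have "peval (shear (- c * e) \<mu>) f = peval \<mu> f"
      using inv by (simp only: shear_inv_def)
    ultimately have "peval \<mu> f = peval (torus (1 / e) \<kappa>) f" by (simp only:)
    also have "\<dots> = (1 / e) powi w * peval \<kappa> f"
      using wt e by (simp add: has_weight_def)
    also have "(1 / e) powi w = e ^ n"
      using neg by (simp add: n_def power_int_def power_inverse[symmetric] inverse_eq_divide)
    finally show ?thesis by (simp add: F_def H_def \<mu>_def \<kappa>_def poly_curve_poly)
  qed
  \<comment> \<open>Reversal moves the behaviour of \<open>F\<close> at infinity to 0: the constant
    coefficient of \<open>reflect_poly F\<close> is the leading coefficient of \<open>F\<close>,
    whereas the right side is divisible by the variable because \<open>n > 0\<close>.\<close>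
  have "reflect_poly F = monom 1 (degree F + n) * H"
  proof (rule poly_eq_of_nonzero_values)
    fix e :: 'a assume e: "e \<noteq> 0"
    have "poly (reflect_poly F) e = e ^ degree F * poly F (inverse e)"
      using e by (rule poly_reflect_poly_nz)
    thus "poly (reflect_poly F) e = poly (monom 1 (degree F + n) * H) e"
      using FH[OF e] by (simp add: poly_monom power_add inverse_eq_divide)
  qed
  hence "coeff (reflect_poly F) 0 = coeff (monom 1 (degree F + n) * H) 0" by simp
  hence "lead_coeff F = 0" using neg by (simp add: coeff_monom_mult n_def)
  hence "poly F (x 1) = 0" by simp
  moreover have "(\<lambda>v. poly (P v) (x 1)) = \<nu>"
    using c by (intro coord_fun_eqI) (simp_all add: P_def x_def t_def)
  ultimately show "peval \<nu> f = 0" by (simp add: F_def poly_curve_poly)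
qed

section \<open>Combinations of coordinates and brackets, sorted by weight\<close>

text \<open>Every product in the combination has exactly \<open>w\<close> factors
  \<open>x_i\<close>. This count is part of the predicate because lifting has to know how many such
  factors are available for replacement.\<close>

inductive covariant :: "nat \<Rightarrow> nat \<Rightarrow> 'a::comm_ring_1 mpoly \<Rightarrow> bool" for m where
  const: "covariant m 0 (cst c)"
| zero: "covariant m w 0"
| add: "covariant m w p \<Longrightarrow> covariant m w q \<Longrightarrow> covariant m w (p + q)"
| xvar: "1 \<le> r \<Longrightarrow> r \<le> m \<Longrightarrow> covariant m w p \<Longrightarrow> covariant m (Suc w) (xvar r * p)"
| bracket: "1 \<le> r \<Longrightarrow> r < s \<Longrightarrow> s \<le> m \<Longrightarrow> covariant m w p \<Longrightarrow> covariant m w (bracket r s * p)"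

lemma covariant_sum: "(\<And>i. i \<in> I \<Longrightarrow> covariant m w (f i)) \<Longrightarrow> covariant m w (sum f I)"
  by (induction I rule: infinite_finite_induct) (auto intro: covariant.intros)

lemma covariant_coord_ring: "covariant m w f \<Longrightarrow> f \<in> coord_ring m"
  by (induction rule: covariant.induct)
     (auto simp: bracket_def intro!: subalgebra_zero subalgebra_add subalgebra_mult subalgebra_diff subalgebra_coord_ring)

lemma covariant_shear_inv: "covariant m w f \<Longrightarrow> shear_inv f"
  by (induction rule: covariant.induct) (auto simp: shear_inv_def algebra_simps)

lemma covariant_weight: "covariant m w f \<Longrightarrow> has_weight (int w) f"
  by (induction rule: covariant.induct)
     (auto simp: has_weight_def power_int_add algebra_simps)

text \<open>The lift replaces \<open>j\<close> of the factors \<open>x\<^sub>i\<close> by brackets \<open>[i, m + 1]\<close>.\<close>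

lemma covariant_lift:
  assumes "covariant m (w + j) g"
  shows "\<exists>G. covariant (Suc m) w G \<and>
    (\<forall>\<nu>. \<nu> (X (Suc m)) = 0 \<longrightarrow> peval \<nu> G = \<nu> (Y (Suc m)) ^ j * peval \<nu> g)"
  using assms
proof (induction "w + j" g arbitrary: w j rule: covariant.induct)
  case (const c)
  thus ?case by (intro exI[of _ "cst c"]) (auto intro: covariant.const)
next
  case zero
  show ?case by (intro exI[of _ 0]) (auto intro: covariant.zero)
next
  case (add p q)
  from add(2)[OF refl] add(4)[OF refl] obtain G H where
    "covariant (Suc m) w G" "\<forall>\<nu>. \<nu> (X (Suc m)) = 0 \<longrightarrow> peval \<nu> G = \<nu> (Y (Suc m)) ^ j * peval \<nu> p"
    "covariant (Suc m) w H" "\<forall>\<nu>. \<nu> (X (Suc m)) = 0 \<longrightarrow> peval \<nu> H = \<nu> (Y (Suc m)) ^ j * peval \<nu> q"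
    by blast
  thus ?case by (intro exI[of _ "G + H"]) (auto intro: covariant.add simp: algebra_simps)
next
  case (xvar r k p)
  show ?case
  proof (cases j)
    case 0
    then obtain G where "covariant (Suc m) k G"
      "\<forall>\<nu>. \<nu> (X (Suc m)) = 0 \<longrightarrow> peval \<nu> G = \<nu> (Y (Suc m)) ^ 0 * peval \<nu> p"
      using xvar(4)[of k 0] by auto
    moreover have "w = Suc k" using xvar 0 by simp
    ultimately show ?thesis using xvar(1,2) 0
      by (intro exI[of _ "xvar r * G"]) (auto intro: covariant.xvar)
  next
    \<comment> \<open>Where \<open>x_{m+1}\<close> vanishes, the bracket of \<open>r\<close> and
      \<open>m + 1\<close> equals \<open>x_r y_{m+1}\<close>. Exchanging the factor
      \<open>x_r\<close> for it lowers the weight by one and produces one of the required factors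
      \<open>y_{m+1}\<close>.\<close>
    case (Suc i)
    then obtain G where "covariant (Suc m) w G"
      "\<forall>\<nu>. \<nu> (X (Suc m)) = 0 \<longrightarrow> peval \<nu> G = \<nu> (Y (Suc m)) ^ i * peval \<nu> p"
      using xvar(4)[of w i] xvar(5) by auto
    thus ?thesis using xvar(1,2) Suc
      by (intro exI[of _ "bracket r (Suc m) * G"]) (auto intro: covariant.bracket)
  qed
next
  case (bracket r s p)
  from bracket(5)[OF refl] obtain G where "covariant (Suc m) w G"
      "\<forall>\<nu>. \<nu> (X (Suc m)) = 0 \<longrightarrow> peval \<nu> G = \<nu> (Y (Suc m)) ^ j * peval \<nu> p" by blast
  thus ?case using bracket(1-3)
    by (intro exI[of _ "bracket r s * G"]) (auto intro: covariant.bracket)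
qed

lemma coord_ring_mono:
  assumes "m \<le> n"
  shows "coord_ring m \<subseteq> coord_ring n"
proof -
  have "X ` {1..m} \<union> Y ` {1..m} \<subseteq> X ` {1..n} \<union> Y ` {1..n}" using assms by auto
  thus ?thesis unfolding coord_ring_def by blast
qed

text \<open>Division by \<open>x_{m+1}\<close>, with the remainder kept as a univariate polynomial
  in \<open>y_{m+1}\<close> over the ring of the first \<open>m\<close> pairs, so that its
  coefficients can be compared one by one. The elements that split this way are stable under
  multiplication by each variable.\<close>

lemma coord_ring_split:
  fixes f :: "'a::field_char_0 mpoly"
  assumes "f \<in> coord_ring (Suc m)"
  shows "\<exists>P q. (\<forall>j. coeff P j \<in> coord_ring m) \<and> q \<in> coord_ring (Suc m) \<and>
    f = poly P (yvar (Suc m)) + xvar (Suc m) * q"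
proof -
  define S :: "'a mpoly set" where
    "S = {1} \<union> xvar ` {1..Suc m} \<union> yvar ` {1..Suc m}"
  have S: "S \<subseteq> coord_ring (Suc m)" by (auto simp: S_def)
  have "coord_ring (Suc m) \<subseteq> subalgebra hull S"
    by (rule coord_ring_subset) (auto simp: S_def intro: hull_inc)
  hence "f \<in> subalgebra hull S" "1 \<in> S" using assms by (auto simp: S_def)
  note sub = subalgebra_coord_ring[where 'a = 'a]
  let ?y = "yvar (Suc m) :: 'a mpoly"
  define splits where "splits g \<longleftrightarrow> (\<exists>P q. (\<forall>j. coeff P j \<in> coord_ring m) \<and> q \<in> coord_ring (Suc m) \<and>
      g = poly P ?y + xvar (Suc m) * q)" for g
  have splitsI: "splits g" if "\<And>j. coeff P j \<in> coord_ring m" "q \<in> coord_ring (Suc m)"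
      "g = poly P ?y + xvar (Suc m) * q" for g P q
    unfolding splits_def using that by blast
  have mult_splits: "splits (s * g)" if s: "s \<in> coord_ring m" and "splits g" for s g
  proof -
    from \<open>splits g\<close> obtain P q where Pq: "\<forall>j. coeff P j \<in> coord_ring m" "q \<in> coord_ring (Suc m)"
      and g: "g = poly P ?y + xvar (Suc m) * q" unfolding splits_def by blast
    show ?thesis
    proof (rule splitsI)
      show "coeff (smult s P) j \<in> coord_ring m" for j
        using s Pq(1) by (auto intro: subalgebra_mult[OF sub])
      show "s * q \<in> coord_ring (Suc m)"
        using s Pq(2) coord_ring_mono[of m "Suc m"] by (auto intro: subalgebra_mult[OF sub])
      show "s * g = poly (smult s P) ?y + xvar (Suc m) * (s * q)"
        by (simp add: g ring_distribs mult.left_commute)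
    qed
  qed
  from \<open>f \<in> subalgebra hull S\<close> \<open>1 \<in> S\<close> have "f \<in> coord_ring (Suc m) \<and> splits f"
  proof (induction rule: hull_induct_left)
    case one
    have "splits 1"
      by (rule splitsI[of 1 0]) (auto simp: coeff_1 subalgebra_zero[OF sub])
    thus ?case by simp
  next
    case (add p q)
    then obtain P P' r r' where *: "\<forall>j. coeff P j \<in> coord_ring m" "\<forall>j. coeff P' j \<in> coord_ring m"
      "r \<in> coord_ring (Suc m)" "r' \<in> coord_ring (Suc m)"
      "p = poly P ?y + xvar (Suc m) * r" "q = poly P' ?y + xvar (Suc m) * r'"
      unfolding splits_def by blast
    have "splits (p + q)"
    proof (rule splitsI)
      show "coeff (P + P') j \<in> coord_ring m" for j using * by (auto intro: subalgebra_add[OF sub])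
      show "r + r' \<in> coord_ring (Suc m)" using * by (auto intro: subalgebra_add[OF sub])
      show "p + q = poly (P + P') ?y + xvar (Suc m) * (r + r')" by (simp add: *(5,6) ring_distribs)
    qed
    thus ?case using add subalgebra_add[OF sub] by blast
  next
    case (scale c p)
    thus ?case using mult_splits[of "cst c" p] subalgebra_cst_mult[OF sub] by simp
  next
    case (mult s p)
    then obtain P q where Pq: "\<forall>j. coeff P j \<in> coord_ring m" "q \<in> coord_ring (Suc m)"
      and p: "p = poly P ?y + xvar (Suc m) * q" unfolding splits_def by blast
    consider "s \<in> coord_ring m" | "s = ?y" | "s = xvar (Suc m)"
      using mult(1) by (force simp: S_def le_Suc_eq)
    hence "splits (s * p)"
    proof cases
      case 1
      thus ?thesis using mult mult_splits by blast
    next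
      case 2
      show ?thesis
      proof (rule splitsI)
        show "coeff (pCons 0 P) j \<in> coord_ring m" for j
          using Pq(1) by (auto simp: coeff_pCons subalgebra_zero[OF sub] split: nat.split)
        show "?y * q \<in> coord_ring (Suc m)" using Pq(2) by (auto intro: subalgebra_mult[OF sub])
        show "s * p = poly (pCons 0 P) ?y + xvar (Suc m) * (?y * q)"
          by (simp add: 2 p ring_distribs mult.left_commute)
      qed
    next
      case 3
      show ?thesis by (rule splitsI[of 0 p]) (use mult 3 in \<open>auto simp: subalgebra_zero[OF sub]\<close>)
    qed
    thus ?case using mult S subalgebra_mult[OF sub] by blast
  qed
  thus ?thesis unfolding splits_def by blast
qed

lemma peval_poly: "peval \<nu> (poly P p) = poly (map_poly (peval \<nu>) P) (peval \<nu> p)"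
  by (induction P) (simp_all add: map_poly_pCons)

text \<open>The coefficients of \<open>P\<close> do not see the last pair. Once
  \<open>x_{m+1}\<close> is 0, the value \<open>y\<close> is therefore free, and an identity in
  \<open>y\<close> descends to each coefficient.\<close>

lemma peval_split:
  fixes P :: "'a::field_char_0 mpoly poly"
  assumes "\<forall>j. coeff P j \<in> coord_ring m"
  shows "peval (\<nu>(X (Suc m) := 0, Y (Suc m) := y)) (poly P (yvar (Suc m)) + xvar (Suc m) * q) =
    poly (map_poly (peval \<nu>) P) y"
proof -
  have "map_poly (peval (\<nu>(X (Suc m) := 0, Y (Suc m) := y))) P = map_poly (peval \<nu>) P"
    by (rule poly_eqI) (auto simp: coeff_map_poly intro!: peval_cong[of _ m] assms[rule_format])
  thus ?thesis by (simp add: peval_poly)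
qed

lemma divisible_by_xvar:
  fixes f :: "'a::field_char_0 mpoly"
  assumes "f \<in> coord_ring (Suc m)" "\<And>\<nu>. \<nu> (X (Suc m)) = 0 \<Longrightarrow> peval \<nu> f = 0"
  shows "\<exists>q\<in>coord_ring (Suc m). f = xvar (Suc m) * q"
proof -
  obtain P q where Pq: "\<forall>j. coeff P j \<in> coord_ring m" "q \<in> coord_ring (Suc m)"
      "f = poly P (yvar (Suc m)) + xvar (Suc m) * q"
    using coord_ring_split[OF assms(1)] by blast
  have "P = 0"
  proof (rule poly_eqI, rule peval_ext)
    fix j \<nu>
    have "map_poly (peval \<nu>) P = 0"
      by (rule poly_eq_of_nonzero_values)
         (simp add: peval_split[OF Pq(1), of \<nu> _ q, symmetric] Pq(3)[symmetric] assms(2))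
    hence "coeff (map_poly (peval \<nu>) P) j = 0" by simp
    thus "peval \<nu> (coeff P j) = peval \<nu> (coeff 0 j)" by (simp add: coeff_map_poly)
  qed
  thus ?thesis using Pq by auto
qed

text \<open>Since \<open>x_r\<close> is itself fixed by shears, it cancels wherever it is nonzero,
  and \<open>var_cancel\<close> extends the equality to all points. The shear is written as a
  substitution because \<open>var_cancel\<close> speaks about a single polynomial.\<close>

lemma shear_inv_xvar_factor:
  fixes q :: "'a::field_char_0 mpoly"
  assumes "shear_inv (xvar r * q)"
  shows "shear_inv q"
proof -
  have "psub (case_coord xvar (\<lambda>s. yvar s + cst b * xvar s)) q - q = 0" for b
  proof (rule var_cancel[of "X r"])
    fix \<nu> :: "coord \<Rightarrow> 'a" assume "\<nu> (X r) \<noteq> 0"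
    moreover have "(\<lambda>v. peval \<nu> (case_coord xvar (\<lambda>s. yvar s + cst b * xvar s) v)) = shear b \<nu>"
      by (rule coord_fun_eqI) simp_all
    moreover have "peval (shear b \<nu>) (xvar r * q) = peval \<nu> (xvar r * q)"
      using assms by (simp only: shear_inv_def)
    ultimately show "peval \<nu> (psub (case_coord xvar (\<lambda>s. yvar s + cst b * xvar s)) q - q) = 0"
      by (simp add: peval_psub)
  qed
  note * = this
  show ?thesis unfolding shear_inv_def
  proof (intro allI)
    fix b :: 'a and \<nu>
    have "(\<lambda>v. peval \<nu> (case_coord xvar (\<lambda>s. yvar s + cst b * xvar s) v)) = shear b \<nu>"
      by (rule coord_fun_eqI) simp_all
    thus "peval (shear b \<nu>) q = peval \<nu> q"
      using arg_cong[OF *[of b], of "peval \<nu>"] by (simp add: peval_psub)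
  qed
qed

lemma has_weight_xvar_factor:
  fixes q :: "'a::field_char_0 mpoly"
  assumes "has_weight w (xvar r * q)"
  shows "has_weight (w - 1) q"
proof -
  have sub: "(\<lambda>v. peval \<nu> (case_coord (\<lambda>s. cst a * xvar s) (\<lambda>s. cst (1 / a) * yvar s) v)) = torus a \<nu>"
    for a :: 'a and \<nu>
    by (rule coord_fun_eqI) simp_all
  have *: "psub (case_coord (\<lambda>s. cst a * xvar s) (\<lambda>s. cst (1 / a) * yvar s)) q - cst (a powi (w - 1)) * q = 0"
    if a: "a \<noteq> 0" for a
  proof (rule var_cancel[of "X r"])
    fix \<nu> :: "coord \<Rightarrow> 'a" assume \<nu>: "\<nu> (X r) \<noteq> 0"
    have "peval (torus a \<nu>) (xvar r * q) = a powi w * peval \<nu> (xvar r * q)"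
      using assms a unfolding has_weight_def by blast
    also have "a powi w = a * a powi (w - 1)"
      using a by (simp add: power_int_diff)
    finally have "peval (torus a \<nu>) q = a powi (w - 1) * peval \<nu> q"
      using a \<nu> by simp
    thus "peval \<nu> (psub (case_coord (\<lambda>s. cst a * xvar s) (\<lambda>s. cst (1 / a) * yvar s)) q - cst (a powi (w - 1)) * q) = 0"
      by (simp add: peval_psub sub)
  qed
  show ?thesis unfolding has_weight_def
  proof (intro allI impI)
    fix a :: 'a and \<nu> assume "a \<noteq> 0"
    from arg_cong[OF *[OF this], of "peval \<nu>"]
    show "peval (torus a \<nu>) q = a powi (w - 1) * peval \<nu> q" by (simp add: peval_psub sub)
  qed
qed

lemma covariant_of_invariant:
  fixes f :: "'a::field_char_0 mpoly"
  assumes "f \<in> coord_ring m" "shear_inv f" "has_weight (int w) f"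
  shows "covariant m w f"
  using assms
proof (induction m arbitrary: f w)
  case 0
  hence "f = cst (peval (\<lambda>_. 0) f)"
    by (intro peval_ext) (auto intro!: peval_cong[of f 0])
  then obtain c where f: "f = cst c" by blast
  \<comment> \<open>Without variables \<open>f\<close> is a constant \<open>c\<close>; the scalar 2
    gives \<open>c = 2^w c\<close>, so a nonzero constant occurs only in weight 0.\<close>
  have "peval (torus 2 (\<lambda>_. 0)) f = 2 powi int w * peval (\<lambda>_. 0) f"
    using 0(3) unfolding has_weight_def by (metis zero_neq_numeral)
  hence "c = 2 ^ w * c" by (simp add: f)
  hence "w = 0 \<or> c = 0" using char_0_power_inject[of w 0, where 'a = 'a] by auto
  thus ?case by (auto simp: f intro: covariant.intros)
next
  case (Suc m)
  from Suc.prems show ?case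
  proof (induction w arbitrary: f rule: less_induct)
    case (less w)
    obtain P q where Pq: "\<forall>j. coeff P j \<in> coord_ring m" "q \<in> coord_ring (Suc m)"
        and f: "f = poly P (yvar (Suc m)) + xvar (Suc m) * q"
      using coord_ring_split[OF less.prems(1)] by blast
    note split = peval_split[OF Pq(1), of _ _ q, folded f]
    have inv: "shear_inv (coeff P j)" for j
      unfolding shear_inv_def
    proof (intro allI)
      fix b \<nu>
      have "map_poly (peval (shear b \<nu>)) P = map_poly (peval \<nu>) P"
      proof (rule poly_eq_of_nonzero_values)
        fix y
        \<comment> \<open>With \<open>x_{m+1} = 0\<close> a shear leaves \<open>y_{m+1}\<close>
          unchanged, so it commutes with the specialisation and acts on each coefficient
          separately.\<close>
        have "shear b (\<nu>(X (Suc m) := 0, Y (Suc m) := y)) = (shear b \<nu>)(X (Suc m) := 0, Y (Suc m) := y)"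
          by (rule coord_fun_eqI) simp_all
        thus "poly (map_poly (peval (shear b \<nu>)) P) y = poly (map_poly (peval \<nu>) P) y"
          using less.prems(2) by (metis split shear_inv_def)
      qed
      from arg_cong[OF this, of "\<lambda>p. coeff p j"]
      show "peval (shear b \<nu>) (coeff P j) = peval \<nu> (coeff P j)" by (simp add: coeff_map_poly)
    qed
    \<comment> \<open>The power \<open>y_{m+1}^j\<close> has weight \<open>- j\<close>, so its
      coefficient carries weight \<open>w + j\<close>; this surplus is what the lift spends.\<close>
    have wt: "has_weight (int (w + j)) (coeff P j)" for j
      unfolding has_weight_def
    proof (intro allI impI)
      fix a \<nu> assume a: "(a :: 'a) \<noteq> 0"
      have "map_poly (peval (torus a \<nu>)) P = smult (a ^ w) (pcompose (map_poly (peval \<nu>) P) [:0, a:])"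
      proof (rule poly_eq_of_nonzero_values)
        fix z
        have "torus a (\<nu>(X (Suc m) := 0, Y (Suc m) := a * z)) = (torus a \<nu>)(X (Suc m) := 0, Y (Suc m) := z)"
          using a by (intro coord_fun_eqI) simp_all
        hence "poly (map_poly (peval (torus a \<nu>)) P) z = a powi int w * poly (map_poly (peval \<nu>) P) (a * z)"
          using less.prems(3) a by (metis split has_weight_def)
        thus "poly (map_poly (peval (torus a \<nu>)) P) z =
            poly (smult (a ^ w) (pcompose (map_poly (peval \<nu>) P) [:0, a:])) z"
          by (simp add: poly_pcompose mult.commute)
      qed
      from arg_cong[OF this, of "\<lambda>p. coeff p j"]
      have "peval (torus a \<nu>) (coeff P j) = a ^ (w + j) * peval \<nu> (coeff P j)"
        by (simp add: coeff_map_poly coeff_pcompose_linear power_add)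
      thus "peval (torus a \<nu>) (coeff P j) = a powi int (w + j) * peval \<nu> (coeff P j)"
        by (simp only: power_int_of_nat)
    qed
    have "\<exists>G. covariant (Suc m) w G \<and>
      (\<forall>\<nu>. \<nu> (X (Suc m)) = 0 \<longrightarrow> peval \<nu> G = \<nu> (Y (Suc m)) ^ j * peval \<nu> (coeff P j))" for j
      using Suc.IH[OF _ inv wt] Pq(1) covariant_lift by blast
    then obtain G where G: "\<And>j. covariant (Suc m) w (G j)"
      "\<And>j \<nu>. \<nu> (X (Suc m)) = 0 \<Longrightarrow> peval \<nu> (G j) = \<nu> (Y (Suc m)) ^ j * peval \<nu> (coeff P j)"
      by metis
    \<comment> \<open>The sum \<open>g\<close> agrees with \<open>f\<close> on the hyperplane
      \<open>x_{m+1} = 0\<close>, so the difference is divisible by \<open>x_{m+1}\<close>, with a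
      quotient of weight \<open>w - 1\<close>.\<close>
    define g where "g = (\<Sum>j\<le>degree P. G j)"
    have g: "covariant (Suc m) w g" unfolding g_def by (intro covariant_sum G)
    have "\<exists>q\<in>coord_ring (Suc m). f - g = xvar (Suc m) * q"
    proof (rule divisible_by_xvar)
      show "f - g \<in> coord_ring (Suc m)"
        using subalgebra_diff[OF subalgebra_coord_ring] less.prems(1) covariant_coord_ring[OF g] .
      fix \<nu> :: "coord \<Rightarrow> 'a" assume "\<nu> (X (Suc m)) = 0"
      thus "peval \<nu> (f - g) = 0"
        by (simp add: f g_def G poly_altdef mult.commute)
    qed
    then obtain h where h: "h \<in> coord_ring (Suc m)" "f - g = xvar (Suc m) * h" by blast
    have "shear_inv (f - g)" "has_weight (int w) (f - g)"
      using less.prems covariant_shear_inv[OF g] covariant_weight[OF g]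
      by (auto simp: shear_inv_def has_weight_def algebra_simps)
    hence h_inv: "shear_inv h" "has_weight (int w - 1) h"
      unfolding h(2) by (auto intro: shear_inv_xvar_factor has_weight_xvar_factor)
    have "covariant (Suc m) w (xvar (Suc m) * h)"
    proof (cases w)
      \<comment> \<open>The quotient has weight -1 here, and a shear invariant of negative weight is
        0: the base of the induction on the weight.\<close>
      case 0
      hence "h = 0" using shear_inv_negative_weight[OF h_inv] by simp
      thus ?thesis by (simp add: covariant.zero)
    next
      case (Suc k)
      thus ?thesis using less.IH[of k h] h(1) h_inv by (auto intro: covariant.xvar)
    qed
    hence "covariant (Suc m) w (g + (f - g))" unfolding h(2) by (rule covariant.add[OF g])
    thus ?case by simp
  qed
qed

section \<open>Decomposition into weight components\<close>

definition weight :: "(coord \<Rightarrow>\<^sub>0 nat) \<Rightarrow> int" where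
  "weight t = (\<Sum>v\<in>Poly_Mapping.keys t. case_coord (\<lambda>_. 1) (\<lambda>_. - 1) v * int (Poly_Mapping.lookup t v))"

definition weight_part :: "int \<Rightarrow> 'a::comm_ring_1 mpoly \<Rightarrow> 'a mpoly" where
  "weight_part k f = (\<Sum>t | t \<in> Poly_Mapping.keys f \<and> weight t = k. Poly_Mapping.single t (Poly_Mapping.lookup f t))"

lemma monom_val_torus:
  assumes "a \<noteq> 0"
  shows "monom_val (torus a \<nu>) t = a powi weight t * monom_val \<nu> t"
proof -
  have "(\<Prod>v\<in>K. torus a \<nu> v ^ Poly_Mapping.lookup t v) =
    a powi (\<Sum>v\<in>K. case_coord (\<lambda>_. 1) (\<lambda>_. - 1) v * int (Poly_Mapping.lookup t v)) *
    (\<Prod>v\<in>K. \<nu> v ^ Poly_Mapping.lookup t v)" if "finite K" for K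
    using that
  proof (induction K rule: finite_induct)
    case (insert v K)
    have "torus a \<nu> v ^ n = a powi (case_coord (\<lambda>_. 1) (\<lambda>_. - 1) v * int n) * \<nu> v ^ n" for n
      by (cases v) (simp_all add: power_mult_distrib power_divide power_int_minus field_simps)
    thus ?case using insert assms by (simp add: power_int_add)
  qed simp
  thus ?thesis by (simp add: monom_val_def weight_def)
qed

lemma weight_part_weight: "has_weight k (weight_part k f)"
  by (auto simp: has_weight_def weight_part_def peval_ev ev_sum[OF ring_map_id] ev_single[OF ring_map_id]
      monom_val_torus sum_distrib_left intro!: sum.cong)

lemma weight_part_coord_ring:
  assumes "f \<in> coord_ring m"
  shows "weight_part k f \<in> coord_ring m"
  unfolding weight_part_def
  by (rule subalgebra_sum[OF subalgebra_coord_ring]) (use assms in \<open>auto simp: coord_ring_def\<close>)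

lemma sum_weight_part: "f = (\<Sum>k\<in>weight ` Poly_Mapping.keys f. weight_part k f)"
proof -
  have "(\<Sum>k\<in>weight ` Poly_Mapping.keys f. weight_part k f) =
      (\<Sum>t\<in>Poly_Mapping.keys f. Poly_Mapping.single t (Poly_Mapping.lookup f t))"
    unfolding weight_part_def by (rule sum.image_gen[symmetric]) simp
  thus ?thesis using sum_single_lookup[of f] by simp
qed

text \<open>Shearing by \<open>b\<close> and then applying the torus element \<open>a\<close> equals
  applying \<open>a\<close> first and then shearing by \<open>b / a^2\<close>, so torus translates
  of an invariant are again invariant. Expanded by weights this is a linear relation between the
  functions \<open>a powi k\<close>, whose coefficients are the defects of invariance of the single
  components; independence makes each of them 0.\<close>

lemma weight_part_shear_inv:
  fixes f :: "'a::field_char_0 mpoly"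
  assumes "shear_inv f"
  shows "shear_inv (weight_part k f)"
  unfolding shear_inv_def
proof (intro allI)
  fix b \<nu>
  show "peval (shear b \<nu>) (weight_part k f) = peval \<nu> (weight_part k f)"
  proof (cases "k \<in> weight ` Poly_Mapping.keys f")
    case True
    have inj: "\<exists>x\<in>-{0}. x powi i \<noteq> (x powi j :: 'a)" if "i \<noteq> j" for i j
    proof -
      have "(2::'a) powi i \<noteq> 2 powi j"
        using that
      proof (induction i j rule: linorder_wlog)
        case (le i j)
        have "(2::'a) powi j = 2 powi i * 2 ^ nat (j - i)"
          using le by (simp flip: power_int_of_nat add: power_int_add[symmetric])
        moreover have "(2::'a) ^ nat (j - i) \<noteq> 1"
          using le char_0_power_inject[of "nat (j - i)" 0, where 'a = 'a] by simp
        ultimately show ?case by simp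
      qed auto
      thus ?thesis by (intro bexI[of _ 2]) auto
    qed
    have "peval (shear b \<nu>) (weight_part k f) - peval \<nu> (weight_part k f) = 0"
    proof (rule characters_independent[where S = "weight ` Poly_Mapping.keys f" and e = 1 and M = "- {0}" and
          opr = "(*)" and \<theta> = "\<lambda>k a. a powi k" and i = k and
          c = "\<lambda>k. peval (shear b \<nu>) (weight_part k f) - peval \<nu> (weight_part k f)"])
      fix a :: 'a assume "a \<in> - {0}"
      hence a: "a \<noteq> 0" by simp
      have tor: "peval (torus a \<mu>) f = (\<Sum>k\<in>weight ` Poly_Mapping.keys f. a powi k * peval \<mu> (weight_part k f))" for \<mu>
      proof -
        have "peval (torus a \<mu>) f = peval (torus a \<mu>) (\<Sum>k\<in>weight ` Poly_Mapping.keys f. weight_part k f)"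
          using sum_weight_part[of f] by simp
        thus ?thesis
          using weight_part_weight[of _ f, unfolded has_weight_def, rule_format, OF a] by simp
      qed
      have "torus a (shear b \<nu>) = shear (b / a\<^sup>2) (torus a \<nu>)"
        using a by (intro coord_fun_eqI) (simp_all add: field_simps power2_eq_square)
      hence "peval (torus a (shear b \<nu>)) f = peval (torus a \<nu>) f"
        using assms by (simp add: shear_inv_def)
      thus "(\<Sum>i\<in>weight ` Poly_Mapping.keys f.
          (peval (shear b \<nu>) (weight_part i f) - peval \<nu> (weight_part i f)) * a powi i) = 0"
        by (simp add: tor algebra_simps sum_subtractf)
    qed (use True inj in \<open>auto simp: power_int_mult_distrib\<close>)
    thus ?thesis by simp
  next
    case False
    hence "weight_part k f = 0" by (auto simp: weight_part_def intro!: sum.neutral)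
    thus ?thesis by simp
  qed
qed

lemma shear_invariants:
  fixes f :: "'a::field_char_0 mpoly"
  assumes "f \<in> coord_ring m" "shear_inv f" "subalgebra W" "1 \<in> W"
    and "\<And>r. 1 \<le> r \<Longrightarrow> r \<le> m \<Longrightarrow> xvar r \<in> W"
    and "\<And>r s. 1 \<le> r \<Longrightarrow> r < s \<Longrightarrow> s \<le> m \<Longrightarrow> xvar r * yvar s - yvar r * xvar s \<in> W"
  shows "f \<in> W"
proof -
  have cov: "g \<in> W" if "covariant m w g" for w g
    using that assms subalgebra_cst_mult[OF assms(3,4)]
    by induction (auto simp: bracket_def intro: subalgebra_zero subalgebra_add subalgebra_mult)
  have "weight_part k f \<in> W" for k
  proof (cases "k < 0")
    case True
    hence "weight_part k f = 0"
      using shear_inv_negative_weight weight_part_shear_inv[OF assms(2)] weight_part_weight by blast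
    thus ?thesis using assms(3) by (simp add: subalgebra_zero)
  next
    case False
    hence "has_weight (int (nat k)) (weight_part k f)" by (simp add: weight_part_weight)
    thus ?thesis
      using cov covariant_of_invariant weight_part_coord_ring assms(1) weight_part_shear_inv[OF assms(2)]
      by blast
  qed
  hence "(\<Sum>k\<in>weight ` Poly_Mapping.keys f. weight_part k f) \<in> W"
    by (intro subalgebra_sum assms)
  thus ?thesis using sum_weight_part[of f] by simp
qed

section \<open>Minimality and automorphism matrices\<close>

lemma minimal_generating_setI:
  assumes "subalgebra I" "S \<subseteq> I" "I \<subseteq> subalgebra hull S"
    and "\<And>s. s \<in> S \<Longrightarrow> \<exists>W. subalgebra W \<and> S - {s} \<subseteq> W \<and> s \<notin> W"
  shows "minimal_generating_set S I"
proof -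
  have gen: "subalgebra hull S = I"
    using hull_minimal[of S I subalgebra] assms(1-3) by blast
  have "subalgebra hull T \<noteq> I" if T: "T \<subset> S" for T
  proof
    assume eq: "subalgebra hull T = I"
    obtain s where s: "s \<in> S" "s \<notin> T" using T by blast
    then obtain W where W: "subalgebra W" "S - {s} \<subseteq> W" "s \<notin> W" using assms(4) by blast
    have "subalgebra hull T \<subseteq> W" using W T s by (intro hull_minimal) auto
    thus False using eq assms(2) s W by blast
  qed
  thus ?thesis using gen by (simp add: minimal_generating_set_def generates_def)
qed

section \<open>Coefficients and separating subalgebras\<close>

text \<open>Monomials are named by multisets of variables: their products become multiset sums, and
  equality of explicit monomials is decided by simplifying multisets.\<close>

definition expo :: "coord multiset \<Rightarrow> coord \<Rightarrow>\<^sub>0 nat" where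
  "expo M = Abs_poly_mapping (count M)"

definition coef :: "'a::comm_ring_1 mpoly \<Rightarrow> coord multiset \<Rightarrow> 'a" where
  "coef p M = Poly_Mapping.lookup p (expo M)"

lemma lookup_expo: "Poly_Mapping.lookup (expo M) = count M"
proof -
  have "{v. count M v \<noteq> 0} = set_mset M" by auto
  thus ?thesis by (simp add: expo_def)
qed

lemma expo_inject [simp]: "expo M = expo N \<longleftrightarrow> M = N"
  by (metis lookup_expo count_inject)

lemma expo_add: "expo (M + N) = expo M + expo N"
  by (rule poly_mapping_eqI) (simp add: lookup_expo lookup_add)

lemma expo_surj: "\<exists>M. t = expo M"
proof
  have "finite {v. 0 < Poly_Mapping.lookup t v}" by simp
  thus "t = expo (Abs_multiset (Poly_Mapping.lookup t))"
    by (intro poly_mapping_eqI) (simp add: lookup_expo)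
qed

lemma expo_empty: "expo {#} = 0"
  by (rule poly_mapping_eqI) (simp add: lookup_expo)

lemma single_expo_mult:
  "Poly_Mapping.single (expo A) a * Poly_Mapping.single (expo B) b = Poly_Mapping.single (expo (A + B)) (a * b)"
  by (simp add: mult_single expo_add)

lemma var_expo:
  "xvar r = Poly_Mapping.single (expo {#X r#}) 1" "yvar r = Poly_Mapping.single (expo {#Y r#}) 1"
proof -
  have "expo {#v#} = Poly_Mapping.single v 1" for v
    by (rule poly_mapping_eqI) (simp add: lookup_expo lookup_single when_def)
  thus "xvar r = Poly_Mapping.single (expo {#X r#}) 1" "yvar r = Poly_Mapping.single (expo {#Y r#}) 1"
    by (simp_all add: xvar_def yvar_def)
qed

lemma const_expo:
  "cst c = Poly_Mapping.single (expo {#}) c" "1 = Poly_Mapping.single (expo {#}) 1"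
  "numeral n = Poly_Mapping.single (expo {#}) (numeral n)"
  by (simp_all add: cst_def expo_empty)

lemma coef_single: "coef (Poly_Mapping.single (expo A) c) M = (if A = M then c else 0)"
  by (simp add: coef_def lookup_single when_def)

lemma coef_arith:
  "coef 0 M = 0" "coef (p + q) M = coef p M + coef q M" "coef (p - q) M = coef p M - coef q M"
  "coef (- p) M = - coef p M"
  by (simp_all add: coef_def lookup_add lookup_minus)

lemmas coef_calc = var_expo const_expo single_expo_mult coef_single coef_arith

text \<open>The coefficient of a product at \<open>M\<close> collects the splittings
  \<open>M = A + B\<close>, and each of them has a part in \<open>E\<close>, where the corresponding
  factor has coefficient 0. In other words, the complement of \<open>E\<close> is closed under
  addition. Substitution is multiplicative, so the condition may be imposed after it.\<close>

lemma subalgebra_vanishing: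
  assumes closed: "\<And>A B. A + B \<in> E \<Longrightarrow> A \<in> E \<or> B \<in> E"
  shows "subalgebra {p. \<forall>M\<in>E. coef (psub \<sigma> p) M = 0}"
proof -
  have mult: "coef (p * q) M = 0"
    if "\<forall>M\<in>E. coef p M = 0" "\<forall>M\<in>E. coef q M = 0" "M \<in> E" for p q :: "'a mpoly" and M
  proof (rule ccontr)
    assume "coef (p * q) M \<noteq> 0"
    hence "expo M \<in> Poly_Mapping.keys (p * q)" by (simp add: coef_def in_keys_iff)
    then obtain s t where st: "s \<in> Poly_Mapping.keys p" "t \<in> Poly_Mapping.keys q" "expo M = s + t"
      using keys_mult[of p q] by blast
    obtain A B where AB: "s = expo A" "t = expo B" using expo_surj by metis
    have "M = A + B" using st(3) by (simp add: AB expo_add[symmetric])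
    with closed that(3) have "A \<in> E \<or> B \<in> E" by blast
    thus False using st that by (auto simp: AB coef_def in_keys_iff)
  qed
  have scale: "coef (cst c * p) M = 0" if "coef p M = 0" for c and p :: "'a mpoly" and M
  proof (rule ccontr)
    assume "coef (cst c * p) M \<noteq> 0"
    hence "expo M \<in> Poly_Mapping.keys (cst c * p)" by (simp add: coef_def in_keys_iff)
    then obtain s t where "s \<in> Poly_Mapping.keys (cst c)" "t \<in> Poly_Mapping.keys p" "expo M = s + t"
      using keys_mult[of "cst c" p] by blast
    thus False using that by (auto simp: cst_def coef_def in_keys_iff split: if_splits)
  qed
  show ?thesis unfolding subalgebra_iff by (auto simp: pscale_cst coef_arith mult scale)
qed

definition lower :: "coord multiset \<Rightarrow> coord multiset set" where
  "lower M = insert M ((\<lambda>v. {#v#}) ` set_mset M)"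

text \<open>A splitting of a monomial of degree at most 3 has a part of degree at most 1. An empty
  part leaves all of \<open>M\<close> to the other one, and a part of degree 1 is a variable of
  \<open>M\<close>. In degree 4 two quadratic parts could escape.\<close>

lemma lower_closed:
  assumes "size M \<le> 3" "A + B \<in> lower M"
  shows "A \<in> lower M \<or> B \<in> lower M"
proof -
  have single: "C \<in> lower M" if "size C = 1" "C \<subseteq># M" for C
  proof -
    obtain v where "C = {#v#}" using \<open>size C = 1\<close> by (rule size_1_singleton_mset[THEN exE])
    thus ?thesis using that by (auto simp: lower_def)
  qed
  from assms(2) consider "A + B = M" | v where "v \<in># M" "A + B = {#v#}"
    by (auto simp: lower_def)
  thus ?thesis
  proof cases
    case 1
    hence "size A + size B \<le> 3" using assms(1) by (metis size_union)
    hence "size A = 0 \<or> size B = 0 \<or> size A = 1 \<or> size B = 1" by arith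
    then consider "A = {#}" | "B = {#}" | "size A = 1" | "size B = 1" by auto
    thus ?thesis
    proof cases
      case 3 thus ?thesis using single[of A] 1 by auto
    next
      case 4 thus ?thesis using single[of B] 1 by auto
    qed (use 1 in \<open>auto simp: lower_def\<close>)
  next
    case 2
    thus ?thesis by (auto simp: lower_def union_is_single)
  qed
qed

text \<open>The subalgebra is cut out, after the substitution \<open>\<sigma>\<close>, by the vanishing of the coefficients
  at the monomials in \<open>E\<close>.\<close>

lemma separated:
  fixes S :: "'a::comm_ring_1 mpoly set"
  assumes "\<And>A B. A + B \<in> E \<Longrightarrow> A \<in> E \<or> B \<in> E"
    and "\<And>g M. g \<in> S \<Longrightarrow> g \<noteq> s \<Longrightarrow> M \<in> E \<Longrightarrow> coef (psub \<sigma> g) M = 0"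
    and "M \<in> E" "coef (psub \<sigma> s) M \<noteq> 0"
  shows "\<exists>W. subalgebra W \<and> S - {s} \<subseteq> W \<and> s \<notin> W"
  by (rule exI[of _ "{p. \<forall>M\<in>E. coef (psub \<sigma> p) M = 0}"])
     (use assms subalgebra_vanishing[of E \<sigma>] in blast)

lemma separated_lower:
  fixes S :: "'a::comm_ring_1 mpoly set"
  assumes "size M \<le> 3"
    and "\<And>g. g \<in> S \<Longrightarrow> g \<noteq> s \<Longrightarrow> coef (psub \<sigma> g) M = 0"
    and "\<And>g v. g \<in> S \<Longrightarrow> g \<noteq> s \<Longrightarrow> v \<in># M \<Longrightarrow> coef (psub \<sigma> g) {#v#} = 0"
    and "coef (psub \<sigma> s) M \<noteq> 0"
  shows "\<exists>W. subalgebra W \<and> S - {s} \<subseteq> W \<and> s \<notin> W"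
  by (rule separated[of "lower M" S s \<sigma> M]) (use assms lower_closed in \<open>auto simp: lower_def\<close>)

section \<open>Linear maps and automorphisms as matrices\<close>

text \<open>The arguments are listed by columns: \<open>(a, b)\<close> is the image of
  \<open>b1\<close> and \<open>(c, d)\<close> the image of \<open>b2\<close>.\<close>

definition lin2 :: "'a \<Rightarrow> 'a \<Rightarrow> 'a \<Rightarrow> 'a \<Rightarrow> 'a::field ^ 2 \<Rightarrow> 'a ^ 2" where
  "lin2 a b c d u = vector [a * u $ 1 + c * u $ 2, b * u $ 1 + d * u $ 2]"

definition act :: "'a \<Rightarrow> 'a \<Rightarrow> 'a \<Rightarrow> 'a \<Rightarrow> (coord \<Rightarrow> 'a::field) \<Rightarrow> coord \<Rightarrow> 'a" where
  "act a b c d \<nu> = case_coord (\<lambda>r. a * \<nu> (X r) + c * \<nu> (Y r)) (\<lambda>r. b * \<nu> (X r) + d * \<nu> (Y r))"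

lemma act_simps [simp]:
  "act a b c d \<nu> (X r) = a * \<nu> (X r) + c * \<nu> (Y r)" "act a b c d \<nu> (Y r) = b * \<nu> (X r) + d * \<nu> (Y r)"
  by (simp_all add: act_def)

definition aut_matrix :: "('a::field ^ 2 \<Rightarrow> 'a ^ 2 \<Rightarrow> 'a ^ 2) \<Rightarrow> 'a \<Rightarrow> 'a \<Rightarrow> 'a \<Rightarrow> 'a \<Rightarrow> bool" where
  "aut_matrix mul a b c d \<longleftrightarrow> a * d - b * c \<noteq> 0 \<and>
     (\<forall>u v. lin2 a b c d (mul u v) = mul (lin2 a b c d u) (lin2 a b c d v))"

lemma vec2_eq_iff: "(u :: 'a ^ 2) = v \<longleftrightarrow> u $ 1 = v $ 1 \<and> u $ 2 = v $ 2"
  by (simp add: vec_eq_iff forall_2)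

lemma b_nth [simp]: "b1 $ 1 = 1" "b1 $ 2 = 0" "b2 $ 1 = 0" "b2 $ 2 = 1"
  by (simp_all add: b1_def b2_def axis_def)

lemma lin2_nth [simp]:
  "lin2 a b c d u $ 1 = a * u $ 1 + c * u $ 2" "lin2 a b c d u $ 2 = b * u $ 1 + d * u $ 2"
  by (simp_all add: lin2_def)

lemma alg_nth [simp]:
  "alg p q r s u v $ i = u $ 1 * v $ 1 * p $ i + u $ 1 * v $ 2 * q $ i + u $ 2 * v $ 1 * r $ i + u $ 2 * v $ 2 * s $ i"
  by (simp add: alg_def)

lemma b_expand: "u = u $ 1 *s b1 + u $ 2 *s b2"
  by (simp add: vec2_eq_iff)

lemma lin2_linear: "Vector_Spaces.linear (*s) (*s) (lin2 a b c d)"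
  by unfold_locales (simp_all add: vec2_eq_iff algebra_simps)

lemma linear_lin2:
  assumes "Vector_Spaces.linear (*s) (*s) (g :: 'a::field ^ 2 \<Rightarrow> 'a ^ 2)"
  shows "g = lin2 (g b1 $ 1) (g b1 $ 2) (g b2 $ 1) (g b2 $ 2)"
proof
  fix u
  interpret Vector_Spaces.linear "(*s)" "(*s)" g by fact
  have "g u = g (u $ 1 *s b1 + u $ 2 *s b2)" using b_expand[of u] by simp
  also have "\<dots> = u $ 1 *s g b1 + u $ 2 *s g b2" by (simp add: add scale)
  finally show "g u = lin2 (g b1 $ 1) (g b1 $ 2) (g b2 $ 1) (g b2 $ 2) u"
    by (simp add: vec2_eq_iff mult.commute)
qed

lemma bij_lin2_iff: "bij (lin2 a b c d) \<longleftrightarrow> a * d - b * c \<noteq> 0"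
proof
  assume det: "a * d - b * c \<noteq> 0"
  let ?D = "a * d - b * c"
  let ?h = "lin2 (d / ?D) (- b / ?D) (- c / ?D) (a / ?D)"
  have 1: "?h (lin2 a b c d u) = u" for u
  proof -
    have "?h (lin2 a b c d u) $ 1 = ?D * u $ 1 / ?D" "?h (lin2 a b c d u) $ 2 = ?D * u $ 2 / ?D"
      by (simp_all add: add_divide_distrib diff_divide_distrib algebra_simps)
    thus ?thesis using det by (simp add: vec2_eq_iff)
  qed
  have 2: "lin2 a b c d (?h u) = u" for u
  proof -
    have "lin2 a b c d (?h u) $ 1 = ?D * u $ 1 / ?D" "lin2 a b c d (?h u) $ 2 = ?D * u $ 2 / ?D"
      by (simp_all add: add_divide_distrib diff_divide_distrib algebra_simps)
    thus ?thesis using det by (simp add: vec2_eq_iff)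
  qed
  show "bij (lin2 a b c d)" using 1 2 by (metis bijI')
next
  assume bij: "bij (lin2 a b c d)"
  show "a * d - b * c \<noteq> 0"
  proof
    assume "a * d - b * c = 0"
    hence ad: "a * d = b * c" by simp
    have z: "lin2 a b c d 0 = 0" by (simp add: vec2_eq_iff)
    \<comment> \<open>These vectors are the columns of the adjugate matrix, which the map kills when
      the determinant is 0. Injectivity then makes all four entries 0.\<close>
    have "lin2 a b c d (vector [d, - b]) = 0" "lin2 a b c d (vector [- c, a]) = 0"
      using ad by (simp_all add: vec2_eq_iff mult.commute)
    hence "vector [d, - b] = (0 :: 'a ^ 2)" "vector [- c, a] = (0 :: 'a ^ 2)"
      using bij z by (metis bij_pointE)+
    hence "a = 0" "b = 0" "c = 0" "d = 0" by (auto simp: vec2_eq_iff)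
    hence "lin2 a b c d b1 = 0" by (simp add: vec2_eq_iff)
    hence "b1 = (0 :: 'a ^ 2)" using bij z by (metis bij_pointE)
    thus False by (simp add: vec2_eq_iff)
  qed
qed

lemma Aut_iff: "g \<in> Aut (*s) mul \<longleftrightarrow> (\<exists>a b c d. aut_matrix mul a b c d \<and> g = lin2 a b c d)"
proof
  assume "g \<in> Aut (*s) mul"
  hence g: "Vector_Spaces.linear (*s) (*s) g" "bij g" "\<forall>u v. g (mul u v) = mul (g u) (g v)"
    by (auto simp: Aut_def algebra_iso_def)
  let ?h = "lin2 (g b1 $ 1) (g b1 $ 2) (g b2 $ 1) (g b2 $ 2)"
  have "g = ?h" using g(1) by (rule linear_lin2)
  thus "\<exists>a b c d. aut_matrix mul a b c d \<and> g = lin2 a b c d"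
    using g(2,3) unfolding aut_matrix_def by (metis bij_lin2_iff)
next
  assume "\<exists>a b c d. aut_matrix mul a b c d \<and> g = lin2 a b c d"
  thus "g \<in> Aut (*s) mul"
    by (auto simp: Aut_def algebra_iso_def aut_matrix_def lin2_linear bij_lin2_iff)
qed

text \<open>Both sides of the multiplicativity condition are bilinear, so the four products of basis
  vectors decide it, with two scalar equations each.\<close>

lemma aut_matrix_alg:
  "aut_matrix (alg p q r s) a b c d \<longleftrightarrow> a * d - b * c \<noteq> 0 \<and>
     a * p $ 1 + c * p $ 2 = a * a * p $ 1 + a * b * q $ 1 + b * a * r $ 1 + b * b * s $ 1 \<and>
     b * p $ 1 + d * p $ 2 = a * a * p $ 2 + a * b * q $ 2 + b * a * r $ 2 + b * b * s $ 2 \<and>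
     a * q $ 1 + c * q $ 2 = a * c * p $ 1 + a * d * q $ 1 + b * c * r $ 1 + b * d * s $ 1 \<and>
     b * q $ 1 + d * q $ 2 = a * c * p $ 2 + a * d * q $ 2 + b * c * r $ 2 + b * d * s $ 2 \<and>
     a * r $ 1 + c * r $ 2 = c * a * p $ 1 + c * b * q $ 1 + d * a * r $ 1 + d * b * s $ 1 \<and>
     b * r $ 1 + d * r $ 2 = c * a * p $ 2 + c * b * q $ 2 + d * a * r $ 2 + d * b * s $ 2 \<and>
     a * s $ 1 + c * s $ 2 = c * c * p $ 1 + c * d * q $ 1 + d * c * r $ 1 + d * d * s $ 1 \<and>
     b * s $ 1 + d * s $ 2 = c * c * p $ 2 + c * d * q $ 2 + d * c * r $ 2 + d * d * s $ 2"
  (is "_ \<longleftrightarrow> ?D \<and> ?E")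
proof -
  let ?g = "lin2 a b c d" and ?m = "alg p q r s"
  have "(\<forall>u v. ?g (?m u v) = ?m (?g u) (?g v)) \<longleftrightarrow>
      ?g p = ?m (?g b1) (?g b1) \<and> ?g q = ?m (?g b1) (?g b2) \<and>
      ?g r = ?m (?g b2) (?g b1) \<and> ?g s = ?m (?g b2) (?g b2)"
    (is "?L \<longleftrightarrow> ?R")
  proof
    assume ?L
    moreover have "?m b1 b1 = p" "?m b1 b2 = q" "?m b2 b1 = r" "?m b2 b2 = s"
      by (simp_all add: vec2_eq_iff)
    ultimately show ?R by metis
  next
    assume R: ?R
    show ?L
    proof (intro allI)
      fix u v
      have "?g (?m u v) = (u $ 1 * v $ 1) *s ?g p + (u $ 1 * v $ 2) *s ?g q +
          (u $ 2 * v $ 1) *s ?g r + (u $ 2 * v $ 2) *s ?g s"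
        by (simp add: vec2_eq_iff algebra_simps)
      also have "\<dots> = (u $ 1 * v $ 1) *s ?m (?g b1) (?g b1) + (u $ 1 * v $ 2) *s ?m (?g b1) (?g b2) +
          (u $ 2 * v $ 1) *s ?m (?g b2) (?g b1) + (u $ 2 * v $ 2) *s ?m (?g b2) (?g b2)"
        using R by simp
      also have "\<dots> = ?m (?g u) (?g v)"
        by (simp add: vec2_eq_iff algebra_simps)
      finally show "?g (?m u v) = ?m (?g u) (?g v)" .
    qed
  qed
  also have "\<dots> \<longleftrightarrow> ?E" by (simp add: vec2_eq_iff)
  finally show ?thesis by (simp add: aut_matrix_def)
qed

lemma b_basis: "b1 \<noteq> (b2 :: 'a::field ^ 2)" "vec.independent {b1, b2 :: 'a ^ 2}"
  "vec.span {b1, b2 :: 'a ^ 2} = UNIV"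
proof -
  show ne: "b1 \<noteq> (b2 :: 'a ^ 2)" by (simp add: vec2_eq_iff)
  have "b1 \<notin> vec.span {b2 :: 'a ^ 2}" by (auto simp: vec.span_singleton vec2_eq_iff)
  moreover have "b2 \<noteq> (0 :: 'a ^ 2)" by (simp add: vec2_eq_iff)
  ultimately show "vec.independent {b1, b2 :: 'a ^ 2}"
    using ne by (simp add: vec.independent_insert)
  have "u \<in> vec.span {b1, b2}" for u :: "'a ^ 2"
    by (subst b_expand[of u]) (intro vec.span_add vec.span_scale vec.span_base; simp)
  thus "vec.span {b1, b2 :: 'a ^ 2} = UNIV" by blast
qed

lemma representation_b [simp]:
  fixes u :: "'a::field ^ 2"
  shows "vec.representation {b1, b2} u b1 = u $ 1" "vec.representation {b1, b2} u b2 = u $ 2"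
proof -
  have sp: "v \<in> vec.span {b1, b2}" for v :: "'a ^ 2" using b_basis(3) by blast
  have rep: "vec.representation {b1, b2} b1 = (\<lambda>b :: 'a ^ 2. if b = b1 then 1 else 0)"
    "vec.representation {b1, b2} b2 = (\<lambda>b :: 'a ^ 2. if b = b2 then 1 else 0)"
    by (rule vec.representation_basis[OF b_basis(2)]; simp)+
  have "vec.representation {b1, b2} u = vec.representation {b1, b2} (u $ 1 *s b1 + u $ 2 *s b2)"
    using b_expand[of u] by simp
  also have "\<dots> = (\<lambda>b. u $ 1 * (if b = b1 then 1 else 0) + u $ 2 * (if b = b2 then 1 else 0))"
    by (simp add: vec.representation_add[OF b_basis(2)] vec.representation_scale[OF b_basis(2)] sp rep)
  finally show "vec.representation {b1, b2} u b1 = u $ 1" "vec.representation {b1, b2} u b2 = u $ 2"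
    using b_basis(1)[where 'a = 'a] by simp_all
qed

lemma invariants_iff:
  "f \<in> invariants (*s) mul b1 b2 m \<longleftrightarrow> f \<in> coord_ring m \<and>
     (\<forall>a b c d \<nu>. aut_matrix mul a b c d \<longrightarrow> peval (act a b c d \<nu>) f = peval \<nu> f)"
proof -
  have act: "tuple_coords (*s) b1 b2 (\<lambda>r. lin2 a b c d (A r)) = act a b c d (tuple_coords (*s) b1 b2 A)"
    for a b c d and A :: "nat \<Rightarrow> 'a ^ 2"
    by (rule coord_fun_eqI) (simp_all add: tuple_coords_def)
  have surj: "tuple_coords (*s) b1 b2 (\<lambda>r. vector [\<nu> (X r), \<nu> (Y r)]) = \<nu>" for \<nu> :: "coord \<Rightarrow> 'a"
    by (rule coord_fun_eqI) (simp_all add: tuple_coords_def)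
  have "(\<forall>g\<in>Aut (*s) mul. \<forall>A. peval (tuple_coords (*s) b1 b2 (\<lambda>r. g (A r))) f =
      peval (tuple_coords (*s) b1 b2 A) f) \<longleftrightarrow>
      (\<forall>a b c d \<nu>. aut_matrix mul a b c d \<longrightarrow> peval (act a b c d \<nu>) f = peval \<nu> f)" (is "?L \<longleftrightarrow> ?R")
  proof
    assume L: ?L
    show ?R
    proof (intro allI impI)
      fix a b c d \<nu> assume "aut_matrix mul a b c d"
      hence "lin2 a b c d \<in> Aut (*s) mul" by (auto simp: Aut_iff)
      from bspec[OF L this, THEN spec, of "\<lambda>r. vector [\<nu> (X r), \<nu> (Y r)]"]
      show "peval (act a b c d \<nu>) f = peval \<nu> f" by (simp only: act surj)
    qed
  qed (auto simp: Aut_iff act)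
  thus ?thesis by (simp add: invariants_def)
qed

lemma subalgebra_invariants: "subalgebra (invariants (*s) mul b1 b2 m)"
  using subalgebra_coord_ring[of m]
  by (auto simp: subalgebra_iff invariants_iff pscale_cst)

lemma minimal_generating_set_invariants:
  fixes mul :: "'a::field ^ 2 \<Rightarrow> 'a ^ 2 \<Rightarrow> 'a ^ 2"
  assumes "S \<subseteq> coord_ring m"
    and "\<And>s a b c d \<nu>. s \<in> S \<Longrightarrow> aut_matrix mul a b c d \<Longrightarrow> peval (act a b c d \<nu>) s = peval \<nu> s"
    and "\<And>f. f \<in> coord_ring m \<Longrightarrow>
      (\<And>a b c d \<nu>. aut_matrix mul a b c d \<Longrightarrow> peval (act a b c d \<nu>) f = peval \<nu> f) \<Longrightarrow>
      f \<in> subalgebra hull S"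
    and "\<And>s. s \<in> S \<Longrightarrow> \<exists>W. subalgebra W \<and> S - {s} \<subseteq> W \<and> s \<notin> W"
  shows "minimal_generating_set S (invariants (*s) mul b1 b2 m)"
  by (rule minimal_generating_setI[OF subalgebra_invariants])
     (use assms in \<open>auto simp: invariants_iff\<close>)

section \<open>Automorphisms of the listed algebras\<close>

lemma aut_matrix_algD:
  assumes "aut_matrix (alg p q r s) a b c d"
  shows "a * d - b * c \<noteq> 0"
    "a * p $ 1 + c * p $ 2 = a * a * p $ 1 + a * b * q $ 1 + b * a * r $ 1 + b * b * s $ 1"
    "b * p $ 1 + d * p $ 2 = a * a * p $ 2 + a * b * q $ 2 + b * a * r $ 2 + b * b * s $ 2"
    "a * q $ 1 + c * q $ 2 = a * c * p $ 1 + a * d * q $ 1 + b * c * r $ 1 + b * d * s $ 1"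
    "b * q $ 1 + d * q $ 2 = a * c * p $ 2 + a * d * q $ 2 + b * c * r $ 2 + b * d * s $ 2"
    "a * r $ 1 + c * r $ 2 = c * a * p $ 1 + c * b * q $ 1 + d * a * r $ 1 + d * b * s $ 1"
    "b * r $ 1 + d * r $ 2 = c * a * p $ 2 + c * b * q $ 2 + d * a * r $ 2 + d * b * s $ 2"
    "a * s $ 1 + c * s $ 2 = c * c * p $ 1 + c * d * q $ 1 + d * c * r $ 1 + d * d * s $ 1"
    "b * s $ 1 + d * s $ 2 = c * c * p $ 2 + c * d * q $ 2 + d * c * r $ 2 + d * d * s $ 2"
  using assms unfolding aut_matrix_alg by auto

lemma aut_matrix_A1: "aut_matrix (alg_A1 \<alpha>) a b c d \<longleftrightarrow> a = 1 \<and> c = 0 \<and> d = 1"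
  unfolding alg_A1_def aut_matrix_alg by (auto simp: algebra_simps)

lemma aut_matrix_A2: "aut_matrix alg_A2 a b c d \<longleftrightarrow> a = 1 \<and> c = 0 \<and> d = 1"
  unfolding alg_A2_def aut_matrix_alg by (auto simp: algebra_simps)

text \<open>Only a torus is recorded. Its weights 1 and 2 are both positive, and this alone reduces
  the invariants to constants.\<close>

lemma aut_matrix_A3: "t \<noteq> 0 \<Longrightarrow> aut_matrix alg_A3 t 0 0 (t\<^sup>2)"
  unfolding alg_A3_def aut_matrix_alg by (simp add: power2_eq_square)

lemma aut_matrix_A4_0:
  "aut_matrix alg_A4_0 a b c d \<longleftrightarrow> (a = 1 \<or> a = - 1) \<and> b = 0 \<and> c = 0 \<and> d = 1"
  unfolding alg_A4_0_def aut_matrix_alg by (auto simp: square_eq_1_iff)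

lemma aut_matrix_B2:
  "aut_matrix (alg_B2 \<alpha>) a b c d \<longleftrightarrow> a \<noteq> 0 \<and> b = 0 \<and> c = 0 \<and> d = 1"
  unfolding alg_B2_def aut_matrix_alg by (auto simp: algebra_simps)

lemma aut_matrix_B3: "aut_matrix alg_B3 a b c d \<longleftrightarrow> a = 1 \<and> c = 0 \<and> d \<noteq> 0"
  unfolding alg_B3_def aut_matrix_alg by (auto simp: algebra_simps)

text \<open>The vector \<open>b2\<close> is idempotent, which pins down its image: the coordinates
  satisfy \<open>c = c d\<close> and \<open>d = c^2 + d^2\<close>. The mixed products then give
  \<open>b = 0\<close>, and the square of \<open>b1\<close> gives \<open>a^2 = 1\<close>.\<close>

lemma aut_matrix_C_0:
  fixes a b c d :: "'a::field_char_0"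
  shows "aut_matrix (alg_C_0 \<alpha>) a b c d \<longleftrightarrow> (a = 1 \<or> a = - 1) \<and> b = 0 \<and> c = 0 \<and> d = 1"
proof
  assume "aut_matrix (alg_C_0 \<alpha>) a b c d"
  note E = aut_matrix_algD[OF this[unfolded alg_C_0_def], simplified]
  have "c * (d - 1) = 0" using E(8) by algebra
  hence "c = 0 \<or> d = 1" by simp
  hence c: "c = 0" using E(9) by auto
  hence d: "d = 1" using E(1,9) by auto
  have b: "b = 0" using E(5,7) c d by auto
  hence "a * a = 1" using E(3) d by simp
  thus "(a = 1 \<or> a = - 1) \<and> b = 0 \<and> c = 0 \<and> d = 1"
    using b c d by (simp add: square_eq_1_iff)
next
  assume "(a = 1 \<or> a = - 1) \<and> b = 0 \<and> c = 0 \<and> d = 1"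
  thus "aut_matrix (alg_C_0 \<alpha>) a b c d"
    unfolding alg_C_0_def aut_matrix_alg by auto
qed

text \<open>The square of \<open>b2\<close> is 0, so its image satisfies
  \<open>c (c + d) = 0\<close>, and adding the two mixed products gives \<open>2 c + d = 1\<close>.
  The involution sending \<open>b2\<close> to \<open>b1 - b2\<close> respects the mixed products
  precisely because the second parameter is \<open>2 * \<alpha> - 1\<close>.\<close>

lemma aut_matrix_D1:
  fixes a b c d :: "'a::field_char_0"
  shows "aut_matrix (alg_D1 \<alpha> (2 * \<alpha> - 1)) a b c d \<longleftrightarrow>
    a = 1 \<and> b = 0 \<and> (c = 0 \<and> d = 1 \<or> c = 1 \<and> d = - 1)"
proof
  assume "aut_matrix (alg_D1 \<alpha> (2 * \<alpha> - 1)) a b c d"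
  note e = aut_matrix_algD[OF this[unfolded alg_D1_def]]
  have b: "b = 0" using e(3) by (simp add: algebra_simps)
  have a: "a = 1" using e(1,2) b by simp
  have cd: "c * (c + d) = 0" using e(8) by (simp add: algebra_simps)
  have s: "2 * c + d = 1"
    using e(4,6) a b by (simp add: algebra_simps)
  from cd have "c = 0 \<or> c + d = 0" by simp
  moreover have "c + d = 0 \<Longrightarrow> c = 1" "c + d = 0 \<Longrightarrow> c = 1 \<Longrightarrow> d = - 1"
    using s by algebra+
  ultimately show "a = 1 \<and> b = 0 \<and> (c = 0 \<and> d = 1 \<or> c = 1 \<and> d = - 1)"
    using s a b by auto
next
  assume "a = 1 \<and> b = 0 \<and> (c = 0 \<and> d = 1 \<or> c = 1 \<and> d = - 1)"
  thus "aut_matrix (alg_D1 \<alpha> (2 * \<alpha> - 1)) a b c d"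
    unfolding alg_D1_def aut_matrix_alg by (auto simp: algebra_simps)
qed

lemma aut_matrix_D2:
  assumes "(\<alpha>, \<beta>) \<notin> T_set"
  shows "aut_matrix (alg_D2 \<alpha> \<beta>) a b c d \<longleftrightarrow> a = 1 \<and> b = 0 \<and> c = 0 \<and> d \<noteq> 0"
proof
  assume "aut_matrix (alg_D2 \<alpha> \<beta>) a b c d"
  note E = aut_matrix_algD[OF this[unfolded alg_D2_def]]
  have c: "c = 0" using E(8) by simp
  moreover have "a = 1" using E(1,2) c by simp
  moreover have "d \<noteq> 0" using E(1) c by auto
  moreover have "b * (1 - (\<alpha> + \<beta>)) = 0" using E(3) \<open>a = 1\<close> by (simp add: algebra_simps)
  ultimately show "a = 1 \<and> b = 0 \<and> c = 0 \<and> d \<noteq> 0" using assms by (auto simp: T_set_def)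
next
  assume "a = 1 \<and> b = 0 \<and> c = 0 \<and> d \<noteq> 0"
  thus "aut_matrix (alg_D2 \<alpha> \<beta>) a b c d"
    unfolding alg_D2_def aut_matrix_alg by auto
qed

text \<open>Let \<open>l\<close> be the sum of the coordinates. The product of \<open>u\<close> and
  \<open>v\<close> is \<open>(1 - \<alpha>) l(v) u + \<alpha> l(u) v\<close>, so every invertible
  map that preserves \<open>l\<close> is an automorphism. Conversely \<open>l\<close> is
  multiplicative; the equations for the values of \<open>l\<close> at the images of
  \<open>b1\<close> and \<open>b2\<close> leave only 0 and 1, and 0 would make the matrix
  singular.\<close>

lemma aut_matrix_E5:
  fixes a b c d :: "'a::field"
  shows "aut_matrix (alg_E5 \<alpha>) a b c d \<longleftrightarrow> a * d - b * c \<noteq> 0 \<and> a + b = 1 \<and> c + d = 1"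
proof
  assume "aut_matrix (alg_E5 \<alpha>) a b c d"
  note E = aut_matrix_algD[OF this[unfolded alg_E5_def], simplified]
  have 1: "(a + b) * (a + b) = a + b" using E(2,3) by algebra
  have s1: "(c + d) * (c + d) = c + d" using E(8,9) by algebra
  have 2: "(1 - \<alpha>) * (a + b) + \<alpha> * (c + d) = (a + b) * (c + d)" using E(4,5) by algebra
  have s2: "\<alpha> * (a + b) + (1 - \<alpha>) * (c + d) = (a + b) * (c + d)" using E(6,7) by algebra
  have det: "a * d - b * c = (a + b) * d - b * (c + d)" by (simp add: algebra_simps)
  have "a + b \<noteq> 0"
  proof
    assume "a + b = 0"
    with 2 s2 have "c + d = 0" by algebra
    thus False using E(1) \<open>a + b = 0\<close> det by simp
  qed
  moreover have "c + d \<noteq> 0"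
  proof
    assume "c + d = 0"
    with 2 s2 have "a + b = 0" by algebra
    thus False using E(1) \<open>c + d = 0\<close> det by simp
  qed
  ultimately show "a * d - b * c \<noteq> 0 \<and> a + b = 1 \<and> c + d = 1" using 1 s1 E(1) by simp
next
  assume "a * d - b * c \<noteq> 0 \<and> a + b = 1 \<and> c + d = 1"
  moreover from this have bd: "b = 1 - a" "d = 1 - c" by (metis add_diff_cancel_left')+
  ultimately have "a \<noteq> c" by (auto simp: algebra_simps)
  thus "aut_matrix (alg_E5 \<alpha>) a b c d"
    unfolding alg_E5_def aut_matrix_alg bd by (simp add: algebra_simps)
qed

text \<open>Automorphisms permute the nonzero idempotents, and these are just \<open>b1\<close> and
  \<open>b2\<close>: for two nonzero coordinates both \<open>x - y\<close> and \<open>y - x\<close>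
  would be 1.\<close>

lemma aut_matrix_E3:
  fixes a b c d :: "'a::field_char_0"
  shows "aut_matrix (alg_E3 \<alpha>) a b c d \<longleftrightarrow>
    a = 1 \<and> b = 0 \<and> c = 0 \<and> d = 1 \<or> a = 0 \<and> b = 1 \<and> c = 1 \<and> d = 0"
proof
  assume "aut_matrix (alg_E3 \<alpha>) a b c d"
  hence E: "a * d - b * c \<noteq> 0" "a = a * (a - b)" "b = b * (b - a)" "c = c * (c - d)" "d = d * (d - c)"
    unfolding alg_E3_def aut_matrix_alg by (simp_all add: algebra_simps)
  have idem: "x = 1 \<and> y = 0 \<or> x = 0 \<and> y = 1 \<or> x = 0 \<and> y = 0"
    if "x = x * (x - y)" "y = y * (y - x)" for x y :: 'a
  proof -
    have "x = 0 \<or> y = 0"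
    proof (rule ccontr)
      assume "\<not> (x = 0 \<or> y = 0)"
      hence "x - y = 1" "y - x = 1" using that by auto
      hence "(x - y) + (y - x) = 2" by simp
      thus False by simp
    qed
    thus ?thesis using that by auto
  qed
  from idem[OF E(2,3)] idem[OF E(4,5)] E(1)
  show "a = 1 \<and> b = 0 \<and> c = 0 \<and> d = 1 \<or> a = 0 \<and> b = 1 \<and> c = 1 \<and> d = 0" by auto
next
  assume "a = 1 \<and> b = 0 \<and> c = 0 \<and> d = 1 \<or> a = 0 \<and> b = 1 \<and> c = 1 \<and> d = 0"
  thus "aut_matrix (alg_E3 \<alpha>) a b c d"
    unfolding alg_E3_def aut_matrix_alg by auto
qed

text \<open>For \<open>t = \<alpha> + \<beta>\<close> the equations say that
  \<open>x b1 + y b2\<close> is idempotent in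
  \<open>alg_E1 \<alpha> \<beta> \<beta> \<alpha>\<close>. If both coordinates are nonzero they
  become linear: \<open>t \<noteq> 1\<close> forces \<open>x = y\<close>, and
  \<open>t \<noteq> - 1\<close> makes the common value exist.\<close>

lemma idempotents_E1:
  fixes x y t :: "'a::field"
  assumes "x = x * (x + t * y)" "y = y * (y + t * x)" "t \<noteq> 1" "t \<noteq> - 1"
  shows "x = 0 \<and> y = 0 \<or> x = 1 \<and> y = 0 \<or> x = 0 \<and> y = 1 \<or> x = 1 / (1 + t) \<and> y = 1 / (1 + t)"
proof (cases "x = 0 \<or> y = 0")
  case False
  hence xy: "x + t * y = 1" "y + t * x = 1" using assms(1,2) by auto
  have "(1 - t) * (x - y) = 0"  using xy by (simp add: algebra_simps)
  hence "x = y" using assms(3) by simp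
  moreover have "1 + t \<noteq> 0" using assms(4) by (simp add: eq_neg_iff_add_eq_0 add.commute)
  ultimately show ?thesis using xy by (simp add: field_simps)
qed (use assms in auto)

text \<open>The nonzero idempotents are \<open>b1\<close>, \<open>b2\<close> and
  \<open>k (b1 + b2)\<close>. If the last one is the image of a basis vector, the mixed products
  give \<open>2 k = t\<close> for \<open>t = \<alpha> + \<beta>\<close>, which together with
  \<open>k (1 + t) = 1\<close> means \<open>(t - 1) (t + 2) = 0\<close>. Hence
  \<open>t = - 2\<close> and \<open>k = - 1\<close>, and then both parameters are -1.\<close>

lemma aut_matrix_E1_symmetric:
  fixes \<alpha> \<beta> :: "'a::field_char_0"
  assumes t: "\<alpha> + \<beta> \<noteq> 1" "\<alpha> + \<beta> \<noteq> - 1" and special: "(\<alpha>, \<beta>) \<noteq> (- 1, - 1)"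
  shows "aut_matrix (alg_E1 \<alpha> \<beta> \<beta> \<alpha>) a b c d \<longleftrightarrow>
    a = 1 \<and> b = 0 \<and> c = 0 \<and> d = 1 \<or> a = 0 \<and> b = 1 \<and> c = 1 \<and> d = 0"
proof
  assume "aut_matrix (alg_E1 \<alpha> \<beta> \<beta> \<alpha>) a b c d"
  hence E: "a * d - b * c \<noteq> 0"
    "a = a * (a + (\<alpha> + \<beta>) * b)" "b = b * (b + (\<alpha> + \<beta>) * a)"
    "c = c * (c + (\<alpha> + \<beta>) * d)" "d = d * (d + (\<alpha> + \<beta>) * c)"
    "a * \<alpha> + c * \<beta> = a * c + a * d * \<alpha> + b * c * \<beta>"
    "b * \<alpha> + d * \<beta> = a * d * \<beta> + b * c * \<alpha> + b * d"
    "a * \<beta> + c * \<alpha> = a * c + b * c * \<alpha> + a * d * \<beta>"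
    "b * \<beta> + d * \<alpha> = b * c * \<beta> + a * d * \<alpha> + b * d"
    unfolding alg_E1_def aut_matrix_alg by (simp_all add: algebra_simps)
  define k where "k = 1 / (1 + (\<alpha> + \<beta>))"
  have k: "k * (1 + (\<alpha> + \<beta>)) = 1"
    using t(2) by (simp add: k_def eq_neg_iff_add_eq_0 add.commute)
  hence k0: "k \<noteq> 0" by auto
  have contra: False if "k * (1 + \<alpha>) = \<alpha> + \<beta> * k" "k * (1 + \<beta>) = \<beta> + \<alpha> * k"
  proof -
    have "k * (2 + (\<alpha> + \<beta>)) = \<alpha> + \<beta> + (\<alpha> + \<beta>) * k" using that by algebra
    hence "k * 2 = \<alpha> + \<beta>" by (simp add: algebra_simps)
    hence "(\<alpha> + \<beta> - 1) * (\<alpha> + \<beta> + 2) = 0" using k by algebra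
    hence s: "\<alpha> + \<beta> = - 2" using t(1) by (auto simp: eq_neg_iff_add_eq_0)
    have k1: "k = - 1" using \<open>k * 2 = \<alpha> + \<beta>\<close> s by algebra
    have b: "\<beta> = - 2 - \<alpha>" using s by algebra
    have "\<alpha> = - 1" using that(1) k1 b by algebra
    thus False using b special by simp
  qed
  note idem = idempotents_E1[OF E(2,3) t, folded k_def] idempotents_E1[OF E(4,5) t, folded k_def]
  consider "a = 1 \<and> b = 0 \<and> c = 0 \<and> d = 1" | "a = 0 \<and> b = 1 \<and> c = 1 \<and> d = 0"
    | "a = 1 \<and> b = 0 \<and> c = k \<and> d = k" | "a = 0 \<and> b = 1 \<and> c = k \<and> d = k"
    | "a = k \<and> b = k \<and> c = 1 \<and> d = 0" | "a = k \<and> b = k \<and> c = 0 \<and> d = 1"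
    using idem E(1) by (elim disjE conjE; simp)
  thus "a = 1 \<and> b = 0 \<and> c = 0 \<and> d = 1 \<or> a = 0 \<and> b = 1 \<and> c = 1 \<and> d = 0"
  proof cases
    case 3 thus ?thesis using E(6,8) contra by (simp add: algebra_simps)
  next
    case 4 thus ?thesis using E(7,9) contra by (simp add: algebra_simps)
  next
    case 5 thus ?thesis using E(6,8) contra by (simp add: algebra_simps)
  next
    case 6 thus ?thesis using E(7,9) contra by (simp add: algebra_simps)
  qed auto
next
  assume "a = 1 \<and> b = 0 \<and> c = 0 \<and> d = 1 \<or> a = 0 \<and> b = 1 \<and> c = 1 \<and> d = 0"
  thus "aut_matrix (alg_E1 \<alpha> \<beta> \<beta> \<alpha>) a b c d"
    unfolding alg_E1_def aut_matrix_alg by auto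
qed

text \<open>The third idempotent is \<open>- b1 - b2\<close>, on an equal footing with the other
  two. The six matrices list the ordered pairs of distinct nonzero idempotents as images of
  \<open>b1\<close> and \<open>b2\<close>.\<close>

lemma aut_matrix_E1_special:
  fixes a b c d :: "'a::field_char_0"
  shows "aut_matrix (alg_E1 (- 1) (- 1) (- 1) (- 1)) a b c d \<longleftrightarrow>
    (a, b, c, d) \<in> {(1, 0, 0, 1), (0, 1, 1, 0), (1, 0, - 1, - 1), (- 1, - 1, 1, 0), (0, 1, - 1, - 1), (- 1, - 1, 0, 1)}"
proof
  assume "aut_matrix (alg_E1 (- 1) (- 1) (- 1) (- 1)) a b c d"
  hence E: "a * d - b * c \<noteq> 0"
    "a = a * (a + (- 2) * b)" "b = b * (b + (- 2) * a)" "c = c * (c + (- 2) * d)" "d = d * (d + (- 2) * c)"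
    unfolding alg_E1_def aut_matrix_alg by (simp_all add: algebra_simps)
  have t: "(- 2 :: 'a) \<noteq> 1" "(- 2 :: 'a) \<noteq> - 1"
    by (simp_all add: eq_neg_iff_add_eq_0 neg_eq_iff_add_eq_0)
  have k: "1 / (1 + (- 2)) = (- 1 :: 'a)" by simp
  show "(a, b, c, d) \<in> {(1, 0, 0, 1), (0, 1, 1, 0), (1, 0, - 1, - 1), (- 1, - 1, 1, 0), (0, 1, - 1, - 1), (- 1, - 1, 0, 1)}"
    using idempotents_E1[OF E(2,3) t, unfolded k] idempotents_E1[OF E(4,5) t, unfolded k] E(1)
    by (elim disjE conjE; simp)
next
  assume "(a, b, c, d) \<in> {(1, 0, 0, 1), (0, 1, 1, 0), (1, 0, - 1, - 1), (- 1, - 1, 1, 0), (0, 1, - 1, - 1), (- 1, - 1, 0, 1)}"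
  thus "aut_matrix (alg_E1 (- 1) (- 1) (- 1) (- 1)) a b c d"
    unfolding alg_E1_def aut_matrix_alg by auto
qed

lemma aut_matrix_N: "t \<noteq> 0 \<Longrightarrow> aut_matrix alg_N t 0 0 t"
  unfolding alg_N_def aut_matrix_alg by simp

section \<open>Invariants of the individual groups\<close>

abbreviation std :: "coord \<Rightarrow> 'a::comm_ring_1 mpoly" where
  "std \<equiv> case_coord xvar yvar"

lemma separated_std:
  fixes S :: "'a::field_char_0 mpoly set"
  assumes "size M \<le> 3"
    and "\<And>g. g \<in> S \<Longrightarrow> g \<noteq> s \<Longrightarrow> coef g M = 0"
    and "\<And>g v. g \<in> S \<Longrightarrow> g \<noteq> s \<Longrightarrow> v \<in># M \<Longrightarrow> coef g {#v#} = 0"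
    and "coef s M \<noteq> 0"
  shows "\<exists>W. subalgebra W \<and> S - {s} \<subseteq> W \<and> s \<notin> W"
  by (rule separated_lower[of M S s std]) (use assms in \<open>simp_all add: psub_id\<close>)

text \<open>Meant for brackets: there the coordinate \<open>x_r\<close> is itself a generator, so
  its coefficient cannot be required to vanish and \<open>lower\<close> is too large. The smaller
  set still works, since a splitting of the pair into two singletons contains
  \<open>{#v#}\<close>.\<close>

lemma closed_pair:
  assumes "A + B \<in> {{#u, v :: coord#}, {#v#}}"
  shows "A \<in> {{#u, v#}, {#v#}} \<or> B \<in> {{#u, v#}, {#v#}}"
proof -
  have "A \<in> lower {#u, v#} \<or> B \<in> lower {#u, v#}"
    by (rule lower_closed) (use assms in \<open>auto simp: lower_def\<close>)
  thus ?thesis using assms by (auto simp: lower_def add_eq_conv_ex)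
qed

lemma in_hull_cst_mult: "p \<in> subalgebra hull S \<Longrightarrow> cst c * p \<in> subalgebra hull S"
  by (rule subalgebra_cst_mult[OF subalgebra_hull])

lemma in_hull_numeral_mult:
  assumes "p \<in> subalgebra hull S"
  shows "numeral n * p \<in> subalgebra hull S"
  using in_hull_cst_mult[OF assms, of "numeral n"] by simp

lemmas hull_closed =
  subalgebra_add[OF subalgebra_hull] subalgebra_diff[OF subalgebra_hull]
  subalgebra_mult[OF subalgebra_hull] subalgebra_zero[OF subalgebra_hull]
  in_hull_numeral_mult in_hull_cst_mult

lemmas coord_ring_closed =
  subalgebra_add[OF subalgebra_coord_ring] subalgebra_diff[OF subalgebra_coord_ring]
  subalgebra_mult[OF subalgebra_coord_ring]

lemma numeral_in_coord_ring [simp]: "numeral n \<in> coord_ring m"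
  using coord_ring_base(2)[of "numeral n"] by simp

lemma minimal_generating_set_shear:
  fixes mul :: "'a::field_char_0 ^ 2 \<Rightarrow> 'a ^ 2 \<Rightarrow> 'a ^ 2"
  assumes aut: "\<And>a b c d. aut_matrix mul a b c d \<longleftrightarrow> a = 1 \<and> c = 0 \<and> d = 1"
  shows "minimal_generating_set ({1} \<union> {xvar r |r. 1 \<le> r \<and> r \<le> m}
      \<union> {xvar r * yvar s - yvar r * xvar s |r s. 1 \<le> r \<and> r < s \<and> s \<le> m})
    (invariants (*s) mul b1 b2 m)" (is "minimal_generating_set ?S _")
proof (rule minimal_generating_set_invariants)
  show "?S \<subseteq> coord_ring m"
    by (auto intro!: coord_ring_closed)
  show "peval (act a b c d \<nu>) s = peval \<nu> s" if "s \<in> ?S" "aut_matrix mul a b c d" for s a b c d \<nu>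
    using that by (auto simp: aut; simp add: algebra_simps)
  show "f \<in> subalgebra hull ?S" if f: "f \<in> coord_ring m"
    and inv: "\<And>a b c d \<nu>. aut_matrix mul a b c d \<Longrightarrow> peval (act a b c d \<nu>) f = peval \<nu> f" for f
  proof (rule shear_invariants[OF f])
    have "act 1 b 0 1 \<nu> = shear b \<nu>" for b and \<nu> :: "coord \<Rightarrow> 'a"
      by (rule coord_fun_eqI) simp_all
    thus "shear_inv f" unfolding shear_inv_def using inv[of 1 _ 0 1] by (simp add: aut)
  qed (auto intro!: hull_inc)
  show "\<exists>W. subalgebra W \<and> ?S - {s} \<subseteq> W \<and> s \<notin> W" if s: "s \<in> ?S" for s
  proof -
    consider "s = 1" | r where "s = xvar r"
      | r t where "s = xvar r * yvar t - yvar r * xvar t" "r < t" using s by blast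
    thus ?thesis
    proof cases
      case 1 thus ?thesis by (intro separated_std[of "{#}"]) (auto simp: coef_calc)
    next
      case 2 thus ?thesis by (intro separated_std[of "{#X r#}"]) (auto simp: coef_calc)
    next
      case 3
      show ?thesis
      proof (rule separated[where E = "{{#X r, Y t#}, {#Y t#}}" and \<sigma> = std and M = "{#X r, Y t#}"])
        show "A \<in> {{#X r, Y t#}, {#Y t#}} \<or> B \<in> {{#X r, Y t#}, {#Y t#}}"
          if "A + B \<in> {{#X r, Y t#}, {#Y t#}}" for A B using that by (rule closed_pair)
      qed (use 3 in \<open>auto simp: psub_id coef_calc add_eq_conv_ex\<close>)
    qed
  qed
qed

text \<open>Both weights 1 and \<open>Suc n\<close> are positive, so the torus contracts every point
  to 0 and an invariant equals its value there. The exponent covers the torus of weights 1 and 2 as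
  well as plain scaling.\<close>

lemma minimal_generating_set_constants:
  fixes mul :: "'a::field_char_0 ^ 2 \<Rightarrow> 'a ^ 2 \<Rightarrow> 'a ^ 2"
  assumes aut: "\<And>t. t \<noteq> 0 \<Longrightarrow> aut_matrix mul t 0 0 (t ^ Suc n)"
  shows "minimal_generating_set {1} (invariants (*s) mul b1 b2 m)"
proof (rule minimal_generating_set_invariants)
  show "f \<in> subalgebra hull {1}" if f: "f \<in> coord_ring m"
    and inv: "\<And>a b c d \<nu>. aut_matrix mul a b c d \<Longrightarrow> peval (act a b c d \<nu>) f = peval \<nu> f" for f
  proof (rule hull_limit[OF f, where \<sigma> = "\<lambda>_. 0" and
        P = "\<lambda>\<nu>. case_coord (\<lambda>r. [:0, \<nu> (X r):]) (\<lambda>r. monom (\<nu> (Y r)) (Suc n))"])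
    fix t :: 'a and \<nu> assume "t \<noteq> 0"
    have "(\<lambda>v. poly (case_coord (\<lambda>r. [:0, \<nu> (X r):]) (\<lambda>r. monom (\<nu> (Y r)) (Suc n)) v) t) =
        act t 0 0 (t ^ Suc n) \<nu>"
      by (rule coord_fun_eqI) (simp_all add: poly_monom)
    thus "peval (\<lambda>v. poly (case_coord (\<lambda>r. [:0, \<nu> (X r):]) (\<lambda>r. monom (\<nu> (Y r)) (Suc n)) v) t) f = peval \<nu> f"
      using inv[OF aut[OF \<open>t \<noteq> 0\<close>], of \<nu>] by simp
  qed (auto simp: poly_monom hull_closed intro!: hull_inc split: coord.split)
  show "\<exists>W. subalgebra W \<and> {1} - {s} \<subseteq> W \<and> s \<notin> W" if "s \<in> {1}" for s :: "'a mpoly"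
    using that by (intro separated_std[of "{#}"]) (auto simp: coef_calc)
qed auto

lemma minimal_generating_set_sign:
  fixes mul :: "'a::field_char_0 ^ 2 \<Rightarrow> 'a ^ 2 \<Rightarrow> 'a ^ 2"
  assumes aut: "\<And>a b c d. aut_matrix mul a b c d \<longleftrightarrow> (a = 1 \<or> a = - 1) \<and> b = 0 \<and> c = 0 \<and> d = 1"
  shows "minimal_generating_set ({1} \<union> {xvar r * xvar s |r s. 1 \<le> r \<and> r \<le> s \<and> s \<le> m}
      \<union> {yvar r |r. 1 \<le> r \<and> r \<le> m})
    (invariants (*s) mul b1 b2 m)" (is "minimal_generating_set ?S _")
proof (rule minimal_generating_set_invariants)
  show "?S \<subseteq> coord_ring m"
    by (auto intro!: coord_ring_closed)
  show "peval (act a b c d \<nu>) s = peval \<nu> s" if "s \<in> ?S" "aut_matrix mul a b c d" for s a b c d \<nu>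
    using that by (auto simp: aut)
  show "f \<in> subalgebra hull ?S" if f: "f \<in> coord_ring m"
    and inv: "\<And>a b c d \<nu>. aut_matrix mul a b c d \<Longrightarrow> peval (act a b c d \<nu>) f = peval \<nu> f" for f
  proof (rule hull_even[where D = "{xvar r |r. 1 \<le> r \<and> r \<le> m}" and T = "act (- 1) 0 0 1"])
    show "f \<in> subalgebra hull (?S \<union> {xvar r |r. 1 \<le> r \<and> r \<le> m})"
      by (rule subsetD[OF coord_ring_subset f]) (auto intro!: hull_inc)
    have "xvar r * xvar s \<in> subalgebra hull ?S" if "1 \<le> r" "r \<le> m" "1 \<le> s" "s \<le> m" for r s
    proof (cases "r \<le> s")
      case True
      thus ?thesis using that by (intro hull_inc) blast
    next
      case False
      hence "xvar s * xvar r \<in> ?S" using that by (simp only: not_le) (blast dest: less_imp_le)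
      thus ?thesis by (subst mult.commute) (rule hull_inc)
    qed
    thus "d * d' \<in> subalgebra hull ?S" if "d \<in> {xvar r |r. 1 \<le> r \<and> r \<le> m}"
      "d' \<in> {xvar r |r. 1 \<le> r \<and> r \<le> m}" for d d' using that by blast
    show "peval (act (- 1) 0 0 1 \<nu>) f = peval \<nu> f" for \<nu> by (rule inv) (simp add: aut)
  qed auto
  show "\<exists>W. subalgebra W \<and> ?S - {s} \<subseteq> W \<and> s \<notin> W" if s: "s \<in> ?S" for s
  proof -
    consider "s = 1" | r t where "s = xvar r * xvar t" "r \<le> t" | r where "s = yvar r"
      using s by blast
    thus ?thesis
    proof cases
      case 1 thus ?thesis by (intro separated_std[of "{#}"]) (auto simp: coef_calc)
    next
      case 2 thus ?thesis by (intro separated_std[of "{#X r, X t#}"]) (auto simp: coef_calc add_eq_conv_ex)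
    next
      case 3 thus ?thesis by (intro separated_std[of "{#Y r#}"]) (auto simp: coef_calc)
    qed
  qed
qed

lemma minimal_generating_set_yvar:
  fixes mul :: "'a::field_char_0 ^ 2 \<Rightarrow> 'a ^ 2 \<Rightarrow> 'a ^ 2"
  assumes aut: "\<And>a b c d. aut_matrix mul a b c d \<longleftrightarrow> a \<noteq> 0 \<and> b = 0 \<and> c = 0 \<and> d = 1"
  shows "minimal_generating_set ({1} \<union> {yvar r |r. 1 \<le> r \<and> r \<le> m}) (invariants (*s) mul b1 b2 m)"
    (is "minimal_generating_set ?S _")
proof (rule minimal_generating_set_invariants)
  show "f \<in> subalgebra hull ?S" if f: "f \<in> coord_ring m"
    and inv: "\<And>a b c d \<nu>. aut_matrix mul a b c d \<Longrightarrow> peval (act a b c d \<nu>) f = peval \<nu> f" for f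
  proof (rule hull_limit[OF f, where \<sigma> = "case_coord (\<lambda>_. 0) yvar" and
        P = "\<lambda>\<nu>. case_coord (\<lambda>r. [:0, \<nu> (X r):]) (\<lambda>r. [:\<nu> (Y r):])"])
    fix t :: 'a and \<nu> assume "t \<noteq> 0"
    have "(\<lambda>v. poly (case_coord (\<lambda>r. [:0, \<nu> (X r):]) (\<lambda>r. [:\<nu> (Y r):]) v) t) = act t 0 0 1 \<nu>"
      by (rule coord_fun_eqI) simp_all
    thus "peval (\<lambda>v. poly (case_coord (\<lambda>r. [:0, \<nu> (X r):]) (\<lambda>r. [:\<nu> (Y r):]) v) t) f = peval \<nu> f"
      using inv[of t 0 0 1 \<nu>] \<open>t \<noteq> 0\<close> by (simp add: aut)
  qed (auto simp: hull_closed intro!: hull_inc split: coord.split)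
  show "\<exists>W. subalgebra W \<and> ?S - {s} \<subseteq> W \<and> s \<notin> W" if s: "s \<in> ?S" for s
  proof -
    consider "s = 1" | r where "s = yvar r" using s by blast
    thus ?thesis
    proof cases
      case 1 thus ?thesis by (intro separated_std[of "{#}"]) (auto simp: coef_calc)
    next
      case 2 thus ?thesis by (intro separated_std[of "{#Y r#}"]) (auto simp: coef_calc)
    qed
  qed
qed (auto simp: aut)

text \<open>The assumptions are what \<open>alg_B3\<close> and \<open>alg_D2\<close> have in common:
  automorphisms fix \<open>x\<close>, and a torus contracts \<open>y\<close> to 0. For
  \<open>alg_B3\<close> there are also automorphisms with \<open>b \<noteq> 0\<close>, which alter
  \<open>y\<close> only.\<close>

lemma minimal_generating_set_xvar:
  fixes mul :: "'a::field_char_0 ^ 2 \<Rightarrow> 'a ^ 2 \<Rightarrow> 'a ^ 2"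
  assumes aut: "\<And>a b c d. aut_matrix mul a b c d \<Longrightarrow> a = 1 \<and> c = 0"
    and tor: "\<And>t. t \<noteq> 0 \<Longrightarrow> aut_matrix mul 1 0 0 t"
  shows "minimal_generating_set ({1} \<union> {xvar r |r. 1 \<le> r \<and> r \<le> m}) (invariants (*s) mul b1 b2 m)"
    (is "minimal_generating_set ?S _")
proof (rule minimal_generating_set_invariants)
  show "f \<in> subalgebra hull ?S" if f: "f \<in> coord_ring m"
    and inv: "\<And>a b c d \<nu>. aut_matrix mul a b c d \<Longrightarrow> peval (act a b c d \<nu>) f = peval \<nu> f" for f
  proof (rule hull_limit[OF f, where \<sigma> = "case_coord xvar (\<lambda>_. 0)" and
        P = "\<lambda>\<nu>. case_coord (\<lambda>r. [:\<nu> (X r):]) (\<lambda>r. [:0, \<nu> (Y r):])"])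
    fix t :: 'a and \<nu> assume "t \<noteq> 0"
    have "(\<lambda>v. poly (case_coord (\<lambda>r. [:\<nu> (X r):]) (\<lambda>r. [:0, \<nu> (Y r):]) v) t) = act 1 0 0 t \<nu>"
      by (rule coord_fun_eqI) simp_all
    thus "peval (\<lambda>v. poly (case_coord (\<lambda>r. [:\<nu> (X r):]) (\<lambda>r. [:0, \<nu> (Y r):]) v) t) f = peval \<nu> f"
      using inv[OF tor[OF \<open>t \<noteq> 0\<close>], of \<nu>] by simp
  qed (auto simp: hull_closed intro!: hull_inc split: coord.split)
  show "\<exists>W. subalgebra W \<and> ?S - {s} \<subseteq> W \<and> s \<notin> W" if s: "s \<in> ?S" for s
  proof -
    consider "s = 1" | r where "s = xvar r" using s by blast
    thus ?thesis
    proof cases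
      case 1 thus ?thesis by (intro separated_std[of "{#}"]) (auto simp: coef_calc)
    next
      case 2 thus ?thesis by (intro separated_std[of "{#X r#}"]) (auto simp: coef_calc)
    qed
  qed
qed (auto dest!: aut)

text \<open>The automorphisms with columns \<open>(1, 0)\<close> and \<open>(1 - t, t)\<close>
  degenerate at \<open>t = 0\<close> to the projection sending both basis vectors to
  \<open>b1\<close>. It carries a point to \<open>(x + y, 0)\<close>, so an invariant is a
  polynomial in the sums.\<close>

lemma minimal_generating_set_trace:
  fixes mul :: "'a::field_char_0 ^ 2 \<Rightarrow> 'a ^ 2 \<Rightarrow> 'a ^ 2"
  assumes aut: "\<And>a b c d. aut_matrix mul a b c d \<longleftrightarrow> a * d - b * c \<noteq> 0 \<and> a + b = 1 \<and> c + d = 1"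
  shows "minimal_generating_set ({1} \<union> {xvar r + yvar r |r. 1 \<le> r \<and> r \<le> m}) (invariants (*s) mul b1 b2 m)"
    (is "minimal_generating_set ?S _")
proof (rule minimal_generating_set_invariants)
  show "?S \<subseteq> coord_ring m" by (auto intro!: coord_ring_closed)
  show "peval (act a b c d \<nu>) s = peval \<nu> s" if "s \<in> ?S" "aut_matrix mul a b c d" for s a b c d \<nu>
  proof -
    have "a * x + c * y + (b * x + d * y) = x + y" for x y
    proof -
      have "a * x + c * y + (b * x + d * y) = (a + b) * x + (c + d) * y" by (simp add: algebra_simps)
      thus ?thesis using that by (simp add: aut)
    qed
    thus ?thesis using that(1) by auto
  qed
  show "f \<in> subalgebra hull ?S" if f: "f \<in> coord_ring m"
    and inv: "\<And>a b c d \<nu>. aut_matrix mul a b c d \<Longrightarrow> peval (act a b c d \<nu>) f = peval \<nu> f" for f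
  proof (rule hull_limit[OF f, where \<sigma> = "case_coord (\<lambda>r. xvar r + yvar r) (\<lambda>_. 0)" and
        P = "\<lambda>\<nu>. case_coord (\<lambda>r. [:\<nu> (X r) + \<nu> (Y r), - \<nu> (Y r):]) (\<lambda>r. [:0, \<nu> (Y r):])"])
    fix t :: 'a and \<nu> assume "t \<noteq> 0"
    have "(\<lambda>v. poly (case_coord (\<lambda>r. [:\<nu> (X r) + \<nu> (Y r), - \<nu> (Y r):]) (\<lambda>r. [:0, \<nu> (Y r):]) v) t) =
        act 1 0 (1 - t) t \<nu>"
      by (rule coord_fun_eqI) (simp_all add: algebra_simps)
    thus "peval (\<lambda>v. poly (case_coord (\<lambda>r. [:\<nu> (X r) + \<nu> (Y r), - \<nu> (Y r):]) (\<lambda>r. [:0, \<nu> (Y r):]) v) t) f =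
        peval \<nu> f"
      using inv[of 1 0 "1 - t" t \<nu>] \<open>t \<noteq> 0\<close> by (simp add: aut)
  qed (auto simp: hull_closed intro!: hull_inc split: coord.split)
  show "\<exists>W. subalgebra W \<and> ?S - {s} \<subseteq> W \<and> s \<notin> W" if s: "s \<in> ?S" for s
  proof -
    consider "s = 1" | r where "s = xvar r + yvar r" using s by blast
    thus ?thesis
    proof cases
      case 1 thus ?thesis by (intro separated_std[of "{#}"]) (auto simp: coef_calc)
    next
      case 2 thus ?thesis by (intro separated_std[of "{#X r#}"]) (auto simp: coef_calc)
    qed
  qed
qed

text \<open>The involution sends \<open>(x, y)\<close> to \<open>(x + y, - y)\<close>, so
  \<open>2 x + y\<close> is even and \<open>y\<close> is odd; together they span the coordinates,
  and the products of odd elements complete the generators.\<close>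

lemma minimal_generating_set_D1:
  fixes mul :: "'a::field_char_0 ^ 2 \<Rightarrow> 'a ^ 2 \<Rightarrow> 'a ^ 2"
  assumes aut: "\<And>a b c d. aut_matrix mul a b c d \<longleftrightarrow>
    a = 1 \<and> b = 0 \<and> (c = 0 \<and> d = 1 \<or> c = 1 \<and> d = - 1)"
  shows "minimal_generating_set ({1} \<union> {2 * xvar r + yvar r |r. 1 \<le> r \<and> r \<le> m}
         \<union> {yvar r * yvar s |r s. 1 \<le> r \<and> r \<le> s \<and> s \<le> m}) (invariants (*s) mul b1 b2 m)"
    (is "minimal_generating_set ?S _")
proof (rule minimal_generating_set_invariants)
  let ?D = "{yvar r |r. 1 \<le> r \<and> r \<le> m} :: 'a mpoly set"
  show "?S \<subseteq> coord_ring m" by (auto intro!: coord_ring_closed)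
  show "peval (act a b c d \<nu>) s = peval \<nu> s" if "s \<in> ?S" "aut_matrix mul a b c d" for s a b c d \<nu>
    using that by (auto simp: aut; simp add: algebra_simps)
  show "f \<in> subalgebra hull ?S" if f: "f \<in> coord_ring m"
    and inv: "\<And>a b c d \<nu>. aut_matrix mul a b c d \<Longrightarrow> peval (act a b c d \<nu>) f = peval \<nu> f" for f
  proof (rule hull_even[where D = ?D and T = "act 1 0 1 (- 1)"])
    show "f \<in> subalgebra hull (?S \<union> ?D)"
    proof (rule subsetD[OF coord_ring_subset f])
      fix r assume r: "1 \<le> r" "r \<le> m"
      have "xvar r = cst (1 / 2) * ((2 * xvar r + yvar r) - yvar r :: 'a mpoly)"
        by (rule peval_ext) simp
      also have "\<dots> \<in> subalgebra hull (?S \<union> ?D)"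
        using r by (intro hull_closed hull_inc) auto
      finally show "xvar r \<in> subalgebra hull (?S \<union> ?D)" .
    qed (auto intro!: hull_inc)
    have "yvar r * yvar s \<in> subalgebra hull ?S" if "1 \<le> r" "r \<le> m" "1 \<le> s" "s \<le> m" for r s
    proof (cases "r \<le> s")
      case True
      thus ?thesis using that by (intro hull_inc) blast
    next
      case False
      hence "yvar s * yvar r \<in> ?S" using that by (simp only: not_le) (blast dest: less_imp_le)
      thus ?thesis by (subst mult.commute) (rule hull_inc)
    qed
    thus "d * d' \<in> subalgebra hull ?S" if "d \<in> ?D" "d' \<in> ?D" for d d' using that by blast
    show "peval (act 1 0 1 (- 1) \<nu>) f = peval \<nu> f" for \<nu> by (rule inv) (simp add: aut)
  qed auto
  show "\<exists>W. subalgebra W \<and> ?S - {s} \<subseteq> W \<and> s \<notin> W" if s: "s \<in> ?S" for s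
  proof -
    consider "s = 1" | r where "s = 2 * xvar r + yvar r" | r t where "s = yvar r * yvar t" "r \<le> t"
      using s by blast
    thus ?thesis
    proof cases
      case 1 thus ?thesis by (intro separated_std[of "{#}"]) (auto simp: coef_calc)
    next
      case 2 thus ?thesis by (intro separated_std[of "{#X r#}"]) (auto simp: coef_calc)
    next
      case 3
      \<comment> \<open>Substituting \<open>y = - 2 x\<close> kills the linear generators and turns
        \<open>y_r y_t\<close> into \<open>4 x_r x_t\<close>, so that one quadratic coefficient
        isolates one product.\<close>
      show ?thesis
        by (rule separated_lower[of "{#X r, X t#}" ?S s "case_coord xvar (\<lambda>r. cst (- 2) * xvar r)"];
            use 3 in auto; auto simp: coef_calc add_eq_conv_ex)
    qed
  qed
qed

lemma minimal_generating_set_swap: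
  fixes mul :: "'a::field_char_0 ^ 2 \<Rightarrow> 'a ^ 2 \<Rightarrow> 'a ^ 2"
  assumes aut: "\<And>a b c d. aut_matrix mul a b c d \<longleftrightarrow>
    a = 1 \<and> b = 0 \<and> c = 0 \<and> d = 1 \<or> a = 0 \<and> b = 1 \<and> c = 1 \<and> d = 0"
  shows "minimal_generating_set
    ({1} \<union> {xvar r + yvar r |r. 1 \<le> r \<and> r \<le> m} \<union> {xvar r * yvar r |r. 1 \<le> r \<and> r \<le> m}
         \<union> {xvar r * yvar s + yvar r * xvar s |r s. 1 \<le> r \<and> r < s \<and> s \<le> m})
    (invariants (*s) mul b1 b2 m)"
    (is "minimal_generating_set ?S _")
proof (rule minimal_generating_set_invariants)
  let ?D = "{xvar r - yvar r |r. 1 \<le> r \<and> r \<le> m} :: 'a mpoly set"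
  show "?S \<subseteq> coord_ring m" by (auto intro!: coord_ring_closed)
  show "peval (act a b c d \<nu>) s = peval \<nu> s" if "s \<in> ?S" "aut_matrix mul a b c d" for s a b c d \<nu>
    using that by (auto simp: aut; simp add: algebra_simps)
  show "f \<in> subalgebra hull ?S" if f: "f \<in> coord_ring m"
    and inv: "\<And>a b c d \<nu>. aut_matrix mul a b c d \<Longrightarrow> peval (act a b c d \<nu>) f = peval \<nu> f" for f
  proof (rule hull_even[where D = ?D and T = "act 0 1 1 0"])
    show "f \<in> subalgebra hull (?S \<union> ?D)"
    proof (rule subsetD[OF coord_ring_subset f])
      fix r assume r: "1 \<le> r" "r \<le> m"
      have "xvar r = cst (1 / 2) * ((xvar r + yvar r) + (xvar r - yvar r) :: 'a mpoly)"
        by (rule peval_ext) simp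
      also have "\<dots> \<in> subalgebra hull (?S \<union> ?D)"
        using r by (intro hull_closed hull_inc) auto
      finally show "xvar r \<in> subalgebra hull (?S \<union> ?D)" .
      have "yvar r = cst (1 / 2) * ((xvar r + yvar r) - (xvar r - yvar r) :: 'a mpoly)"
        by (rule peval_ext) simp
      also have "\<dots> \<in> subalgebra hull (?S \<union> ?D)"
        using r by (intro hull_closed hull_inc) auto
      finally show "yvar r \<in> subalgebra hull (?S \<union> ?D)" .
    qed (auto intro!: hull_inc)
    have mixed: "xvar r * yvar s + yvar r * xvar s \<in> subalgebra hull ?S"
      if "1 \<le> r" "r \<le> m" "1 \<le> s" "s \<le> m" for r s
    proof (cases r s rule: linorder_cases)
      case less thus ?thesis using that by (intro hull_inc) blast
    next
      case equal
      have "xvar r * yvar r \<in> subalgebra hull ?S" using that by (intro hull_inc) blast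
      from subalgebra_add[OF subalgebra_hull this this]
      show ?thesis using equal by (simp add: mult.commute)
    next
      case greater
      hence "xvar s * yvar r + yvar s * xvar r \<in> subalgebra hull ?S" using that by (intro hull_inc) blast
      thus ?thesis by (simp add: mult.commute add.commute)
    qed
    have "(xvar r - yvar r) * (xvar s - yvar s) \<in> subalgebra hull ?S"
      if "1 \<le> r" "r \<le> m" "1 \<le> s" "s \<le> m" for r s
    proof -
      have "(xvar r - yvar r) * (xvar s - yvar s) =
          (xvar r + yvar r) * (xvar s + yvar s) - 2 * (xvar r * yvar s + yvar r * xvar s :: 'a mpoly)"
        by (simp add: algebra_simps)
      also have "\<dots> \<in> subalgebra hull ?S"
      proof -
        have "xvar r + yvar r \<in> ?S" "xvar s + yvar s \<in> ?S" using that by blast+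
        hence "(xvar r + yvar r) * (xvar s + yvar s) \<in> subalgebra hull ?S"
          by (intro subalgebra_mult[OF subalgebra_hull] hull_inc)
        thus ?thesis
          by (rule subalgebra_diff[OF subalgebra_hull]) (intro in_hull_numeral_mult mixed that)
      qed
      finally show ?thesis .
    qed
    thus "d * d' \<in> subalgebra hull ?S" if "d \<in> ?D" "d' \<in> ?D" for d d' using that by blast
    show "peval (act 0 1 1 0 \<nu>) f = peval \<nu> f" for \<nu> by (rule inv) (simp add: aut)
  qed (auto simp: add.commute mult.commute)
  show "\<exists>W. subalgebra W \<and> ?S - {s} \<subseteq> W \<and> s \<notin> W" if s: "s \<in> ?S" for s
  proof -
    \<comment> \<open>Substituting \<open>y = - x\<close> kills the sums \<open>x_r + y_r\<close>
      and sends the quadratic generators to nonzero multiples of distinct monomials in the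
      \<open>x_r\<close>.\<close>
    let ?\<sigma> = "case_coord xvar (\<lambda>r. cst (- 1) * xvar r) :: coord \<Rightarrow> 'a mpoly"
    consider "s = 1" | r where "s = xvar r + yvar r" | r where "s = xvar r * yvar r"
      | r t where "s = xvar r * yvar t + yvar r * xvar t" "r < t"
      using s by blast
    thus ?thesis
    proof cases
      case 1 thus ?thesis by (intro separated_std[of "{#}"]) (auto simp: coef_calc)
    next
      case 2 thus ?thesis by (intro separated_std[of "{#X r#}"]) (auto simp: coef_calc)
    next
      case 3
      show ?thesis
        by (rule separated_lower[of "{#X r, X r#}" ?S s ?\<sigma>];
            use 3 in auto; auto simp: coef_calc add_eq_conv_ex)
    next
      case 4
      show ?thesis
        by (rule separated_lower[of "{#X r, X t#}" ?S s ?\<sigma>];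
            use 4 in auto; auto simp: coef_calc add_eq_conv_ex)
    qed
  qed
qed

section \<open>Invariants of the symmetric group on three idempotents\<close>

text \<open>For the primitive cube roots of unity \<open>w\<close>, \<open>w'\<close> put
  \<open>p = x + w y\<close> and \<open>q = x + w' y\<close>. Then
  \<open>quad r s = p_r q_s + q_r p_s\<close>, and \<open>cub\<close> below is
  \<open>p_r p_s p_t + q_r q_s q_t\<close>: the polarised basic invariants of \<open>S_3\<close> in
  its plane representation.\<close>

definition quad :: "nat \<Rightarrow> nat \<Rightarrow> 'a::comm_ring_1 mpoly" where
  "quad r s = 2 * xvar r * xvar s - xvar r * yvar s - yvar r * xvar s + 2 * yvar r * yvar s"

definition cub :: "nat \<Rightarrow> nat \<Rightarrow> nat \<Rightarrow> 'a::comm_ring_1 mpoly" where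
  "cub r s t = 2 * xvar r * xvar s * xvar t - xvar r * xvar s * yvar t - xvar r * yvar s * xvar t
     - xvar r * yvar s * yvar t - yvar r * xvar s * xvar t - yvar r * xvar s * yvar t
     - yvar r * yvar s * xvar t + 2 * yvar r * yvar s * yvar t"

lemma quad_commute: "quad r s = quad s r"
  by (simp add: quad_def algebra_simps)

lemma cub_commute: "cub r s t = cub s r t" "cub r s t = cub r t s"
  by (simp_all add: cub_def algebra_simps)

text \<open>Exactly one monomial of a \<open>quad\<close> or a \<open>cub\<close> is free of
  \<open>y\<close>, with coefficient 2. Coefficients at monomials in the \<open>x_r\<close> alone
  therefore tell the generators apart.\<close>

lemma coef_quad:
  "coef (quad a b :: 'a::comm_ring_1 mpoly) {#X r, X s#} = (if {#a, b#} = {#r, s#} then 2 else 0)"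
  "coef (quad a b :: 'a mpoly) {#X r, X s, X t#} = 0"
  "coef (quad a b :: 'a mpoly) {#v#} = 0" "coef (quad a b :: 'a mpoly) {#} = 0"
  by (auto simp: quad_def coef_calc add_eq_conv_ex)

lemma coef_cub:
  "coef (cub a b c :: 'a::comm_ring_1 mpoly) {#X r, X s, X t#} = (if {#a, b, c#} = {#r, s, t#} then 2 else 0)"
  "coef (cub a b c :: 'a mpoly) {#X r, X s#} = 0"
  "coef (cub a b c :: 'a mpoly) {#v#} = 0" "coef (cub a b c :: 'a mpoly) {#} = 0"
proof -
  have inj: "{#X a, X b, X c#} = {#X r, X s, X t#} \<longleftrightarrow> {#a, b, c#} = {#r, s, t#}"
  proof -
    have "inj X" by (simp add: inj_def)
    from inj_eq[OF multiset.inj_map[OF this], of "{#a, b, c#}" "{#r, s, t#}"] show ?thesis by simp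
  qed
  have Y0: "M \<noteq> {#X r, X s, X t#}" if "Y u \<in># M" for u M using that by auto
  have Y: "add_mset (Y u) N \<noteq> {#X r, X s, X t#}" "add_mset v (add_mset (Y u) N) \<noteq> {#X r, X s, X t#}"
    "add_mset v (add_mset v' (add_mset (Y u) N)) \<noteq> {#X r, X s, X t#}" for u v v' N
    by (rule Y0[of u]; simp)+
  show "coef (cub a b c :: 'a mpoly) {#X r, X s, X t#} = (if {#a, b, c#} = {#r, s, t#} then 2 else 0)"
    by (simp add: cub_def coef_calc inj[symmetric] Y) (auto simp: add_mset_commute)
qed (auto simp: cub_def coef_calc add_eq_conv_ex)

lemma odd_part_eigen:
  assumes "f \<in> odd_part H D" "\<And>b. b \<in> H \<Longrightarrow> peval \<mu> b = peval \<nu> b"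
    and "\<And>d. d \<in> D \<Longrightarrow> peval \<mu> d = k * peval \<nu> d"
  shows "peval \<mu> f = k * peval \<nu> f"
  using assms(1) by induction (simp_all add: assms(2,3) algebra_simps)

text \<open>A grading modulo 3: \<open>p\<close> has degree 1, \<open>q\<close> has degree 2, and
  \<open>M\<close>, \<open>D1\<close>, \<open>D2\<close> stand for the degrees 0, 1, 2.
  Multiplication by \<open>p\<close> moves each part to the next. Exchanging \<open>p\<close> and
  \<open>q\<close> exchanges \<open>D1\<close> and \<open>D2\<close>, which is how multiplication by
  \<open>q\<close> is covered.\<close>

lemma cyclic_mult:
  assumes sub: "subalgebra M"
    and pq: "\<And>r s. r \<in> I \<Longrightarrow> s \<in> I \<Longrightarrow> p r * q s \<in> M"
    and ppp: "\<And>r s t. r \<in> I \<Longrightarrow> s \<in> I \<Longrightarrow> t \<in> I \<Longrightarrow> p r * p s * p t \<in> M"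
    and i: "i \<in> I"
  defines "D1 \<equiv> {p r |r. r \<in> I} \<union> {q r * q s |r s. r \<in> I \<and> s \<in> I}"
    and "D2 \<equiv> {q r |r. r \<in> I} \<union> {p r * p s |r s. r \<in> I \<and> s \<in> I}"
  shows "f \<in> M \<Longrightarrow> p i * f \<in> odd_part M D1"
    and "f \<in> odd_part M D1 \<Longrightarrow> p i * f \<in> odd_part M D2"
    and "f \<in> odd_part M D2 \<Longrightarrow> p i * f \<in> M"
proof -
  show "p i * f \<in> odd_part M D1" if "f \<in> M"
    using odd_part_base[OF that, of "p i" D1] i by (auto simp: D1_def mult.commute)
  show "p i * f \<in> odd_part M D2" if "f \<in> odd_part M D1"
  proof (rule odd_part_mult_odd[OF that])
    fix b d assume b: "b \<in> M" and "d \<in> D1"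
    then consider r where "r \<in> I" "d = p r" | r s where "r \<in> I" "s \<in> I" "d = q r * q s"
      by (auto simp: D1_def)
    thus "p i * (b * d) \<in> odd_part M D2"
    proof cases
      case 1
      hence "b * (p i * p r) \<in> odd_part M D2" using b i by (intro odd_part_base) (auto simp: D2_def)
      thus ?thesis by (simp add: 1 mult.left_commute)
    next
      case 2
      hence "(b * (p i * q r)) * q s \<in> odd_part M D2"
        using b i by (intro odd_part_base subalgebra_mult[OF sub] pq) (auto simp: D2_def)
      thus ?thesis by (simp add: 2 mult.assoc mult.left_commute)
    qed
  qed
  show "p i * f \<in> M" if "f \<in> odd_part M D2"
  proof (rule odd_part_mult[OF that sub])
    fix b d assume b: "b \<in> M" and "d \<in> D2"
    then consider r where "r \<in> I" "d = q r" | r s where "r \<in> I" "s \<in> I" "d = p r * p s"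
      by (auto simp: D2_def)
    thus "p i * (b * d) \<in> M"
    proof cases
      case 1
      hence "b * (p i * q r) \<in> M" using b i by (intro subalgebra_mult[OF sub] pq)
      thus ?thesis by (simp add: 1 mult.left_commute)
    next
      case 2
      hence "b * (p i * p r * p s) \<in> M" using b i by (intro subalgebra_mult[OF sub] ppp)
      thus ?thesis by (simp add: 2 mult.assoc mult.left_commute)
    qed
  qed
qed

text \<open>The symmetric group \<open>S\<^sub>3\<close> acts; over a primitive cube root of unity \<open>w\<close> the coordinates
  \<open>p r\<close>, \<open>q r\<close> diagonalise the 3-cycle and are exchanged by a transposition.\<close>

lemma S3_invariants:
  fixes f :: "'a::field_char_0 mpoly"
  assumes w: "w * w = - 1 - (w :: 'a)" and f: "f \<in> coord_ring m"
    and T: "\<And>\<nu>. peval (act 0 1 (- 1) (- 1) \<nu>) f = peval \<nu> f"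
    and T2: "\<And>\<nu>. peval (act (- 1) (- 1) 1 0 \<nu>) f = peval \<nu> f"
    and T3: "\<And>\<nu>. peval (act 1 0 (- 1) (- 1) \<nu>) f = peval \<nu> f"
    and quad: "\<And>r s. 1 \<le> r \<Longrightarrow> r \<le> s \<Longrightarrow> s \<le> m \<Longrightarrow> quad r s \<in> S"
    and cub: "\<And>r s t. 1 \<le> r \<Longrightarrow> r \<le> s \<Longrightarrow> s \<le> t \<Longrightarrow> t \<le> m \<Longrightarrow> cub r s t \<in> S"
    and S: "\<And>g. g \<in> S \<Longrightarrow> g = 1 \<or> (\<exists>r s. g = quad r s) \<or> (\<exists>r s t. g = cub r s t)" "1 \<in> S"
  shows "f \<in> subalgebra hull S"
proof -
  let ?I = "{1..m}" and ?H = "subalgebra hull S"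
  define w' where "w' = - 1 - w"
  have "w * w' = 1" "w' * w' = w" unfolding w'_def using w by algebra+
  hence ww: "w * w' = 1" "w' * w = 1" "w * w = w'" "w' * w' = w" "1 + w + w' = 0"
    using w by (simp_all add: w'_def mult.commute)
  define p where "p r = xvar r + cst w * yvar r" for r
  define q where "q r = xvar r + cst w' * yvar r" for r
  have peval_p: "peval \<nu> (p r) = \<nu> (X r) + w * \<nu> (Y r)"
    and peval_q: "peval \<nu> (q r) = \<nu> (X r) + w' * \<nu> (Y r)" for \<nu> r
    by (simp_all add: p_def q_def)
  have quad_pq: "quad r s = p r * q s + q r * p s" for r s
  proof (rule peval_ext)
    fix \<nu>
    show "peval \<nu> (quad r s) = peval \<nu> (p r * q s + q r * p s)"
      unfolding quad_def peval_simps peval_diff peval_numeral peval_p peval_q using ww by algebra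
  qed
  have cub_pq: "cub r s t = p r * p s * p t + q r * q s * q t" for r s t
  proof (rule peval_ext)
    fix \<nu>
    show "peval \<nu> (cub r s t) = peval \<nu> (p r * p s * p t + q r * q s * q t)"
      unfolding cub_def peval_simps peval_diff peval_numeral peval_p peval_q using ww by algebra
  qed
  \<comment> \<open>The antisymmetric partners \<open>d\<close> and \<open>e\<close> of
    \<open>quad\<close> and \<open>cub\<close> are fixed by the 3-cycle and negated by the
    transposition exchanging \<open>p\<close> and \<open>q\<close>.\<close>
  define d where "d r s = p r * q s - q r * p s" for r s
  define e where "e r s t = p r * p s * p t - q r * q s * q t" for r s t
  define D where "D = {d r s |r s. r \<in> ?I \<and> s \<in> ?I} \<union> {e r s t |r s t. r \<in> ?I \<and> s \<in> ?I \<and> t \<in> ?I}"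
  have quad_H: "quad r s \<in> ?H" if "r \<in> ?I" "s \<in> ?I" for r s
  proof (cases "r \<le> s")
    case True
    thus ?thesis using that quad[of r s] by (intro hull_inc) auto
  next
    case False
    hence "quad s r \<in> ?H" using that quad[of s r] by (intro hull_inc) auto
    thus ?thesis by (simp only: quad_commute[of r s])
  qed
  have cub_H: "cub r s t \<in> ?H" if I: "r \<in> ?I" "s \<in> ?I" "t \<in> ?I" for r s t
  proof -
    have *: "cub i j k \<in> ?H" if "i \<in> ?I" "k \<in> ?I" "i \<le> j" "j \<le> k" for i j k
      using cub[of i j k] that by (auto intro: hull_inc)
    consider "r \<le> s \<and> s \<le> t" | "r \<le> t \<and> t \<le> s" | "s \<le> r \<and> r \<le> t" | "s \<le> t \<and> t \<le> r"
      | "t \<le> r \<and> r \<le> s" | "t \<le> s \<and> s \<le> r" by linarith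
    thus ?thesis
    proof cases
      case 1 thus ?thesis using I by (auto intro: *)
    next
      case 2 thus ?thesis using I by (subst cub_commute(2), auto intro: *)
    next
      case 3 thus ?thesis using I by (subst cub_commute(1), auto intro: *)
    next
      case 4 thus ?thesis using I by (subst cub_commute(1), subst cub_commute(2), auto intro: *)
    next
      case 5 thus ?thesis using I by (subst cub_commute(2), subst cub_commute(1), auto intro: *)
    next
      case 6 thus ?thesis using I by (subst cub_commute(1), subst cub_commute(2), subst cub_commute(1), auto intro: *)
    qed
  qed
  have dd: "d r s * d t u \<in> ?H" if "r \<in> ?I" "s \<in> ?I" "t \<in> ?I" "u \<in> ?I" for r s t u
  proof -
    have "d r s * d t u = quad r u * quad s t - quad r t * quad s u"
      by (simp add: d_def quad_pq algebra_simps)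
    thus ?thesis using that by (simp add: hull_closed quad_H)
  qed
  have ed: "e r s t * d u v \<in> ?H" if "r \<in> ?I" "s \<in> ?I" "t \<in> ?I" "u \<in> ?I" "v \<in> ?I" for r s t u v
  proof -
    have "e r s t * d u v = cub r s u * quad t v - cub r s v * quad t u"
      by (simp add: d_def e_def quad_pq cub_pq algebra_simps)
    thus ?thesis using that by (simp add: hull_closed quad_H cub_H)
  qed
  have ee: "e r s t * e i j k \<in> ?H"
    if "r \<in> ?I" "s \<in> ?I" "t \<in> ?I" "i \<in> ?I" "j \<in> ?I" "k \<in> ?I" for r s t i j k
  proof -
    \<comment> \<open>The products \<open>p_i q_j\<close> and \<open>q_i p_j\<close> are the halves
      of \<open>quad + d\<close> and \<open>quad - d\<close>. In the mixed terms of the product,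
      written as triple products of these, the parts odd in \<open>d\<close> cancel and
      \<open>?R\<close> is what remains.\<close>
    let ?R = "quad r i * quad s j * quad t k + quad r i * (d s j * d t k)
       + quad s j * (d r i * d t k) + quad t k * (d r i * d s j)"
    have "e r s t * e i j k = cub r s t * cub i j k - cst (1 / 2) * ?R"
    proof (rule peval_ext)
      fix \<nu>
      have "peval \<nu> (e r s t * e i j k) * 2 = peval \<nu> (cub r s t * cub i j k) * 2 - peval \<nu> ?R"
        by (simp add: d_def e_def quad_pq cub_pq algebra_simps)
      thus "peval \<nu> (e r s t * e i j k) = peval \<nu> (cub r s t * cub i j k - cst (1 / 2) * ?R)"
        unfolding peval_simps peval_diff by (simp add: field_simps)
    qed
    also have "\<dots> \<in> ?H" using that
      by (intro subalgebra_diff[OF subalgebra_hull] in_hull_cst_mult subalgebra_add[OF subalgebra_hull]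
          subalgebra_mult[OF subalgebra_hull] quad_H cub_H dd)
    finally show ?thesis .
  qed
  have DD: "a * b \<in> ?H" if "a \<in> D" "b \<in> D" for a b
    using that dd ed ee unfolding D_def by (auto simp: mult.commute[of "d i j" "e r s t" for i j r s t])
  \<comment> \<open>This is the degree 0 part of the grading modulo 3; it will absorb everything
    that the 3-cycle leaves invariant.\<close>
  define M where "M = subalgebra hull (S \<union> D)"
  have sub: "subalgebra M" by (simp add: M_def)
  have one: "1 \<in> M" using S(2) by (auto simp: M_def intro: hull_inc)
  have HM: "?H \<subseteq> M" unfolding M_def by (rule hull_mono) simp
  have DM: "D \<subseteq> M" unfolding M_def by (meson hull_subset le_sup_iff order_trans)
  have half: "a \<in> M" if "a + a \<in> M" for a
  proof -
    have "a = cst (1 / 2) * (a + a)" by (rule peval_ext) simp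
    thus ?thesis using subalgebra_cst_mult[OF sub that] by metis
  qed
  have pq: "p r * q s \<in> M" if "r \<in> ?I" "s \<in> ?I" for r s
  proof (rule half)
    have "d r s \<in> D" using that unfolding D_def by blast
    hence "quad r s + d r s \<in> M"
      using that quad_H HM DM by (intro subalgebra_add[OF sub]) blast+
    thus "p r * q s + p r * q s \<in> M" by (simp add: quad_pq d_def)
  qed
  have ppp: "p r * p s * p t \<in> M" if "r \<in> ?I" "s \<in> ?I" "t \<in> ?I" for r s t
  proof (rule half)
    have "e r s t \<in> D" using that unfolding D_def by blast
    hence "cub r s t + e r s t \<in> M"
      using that cub_H HM DM by (intro subalgebra_add[OF sub]) blast+
    thus "p r * p s * p t + p r * p s * p t \<in> M" by (simp add: cub_pq e_def)
  qed
  have qqq: "q r * q s * q t \<in> M" if "r \<in> ?I" "s \<in> ?I" "t \<in> ?I" for r s t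
  proof -
    have "cub r s t - p r * p s * p t \<in> M"
      using that cub_H HM ppp by (intro subalgebra_diff[OF sub]) blast+
    thus ?thesis by (simp add: cub_pq)
  qed
  have qp: "q r * p s \<in> M" if "r \<in> ?I" "s \<in> ?I" for r s
    using pq[OF that(2,1)] by (simp add: mult.commute)
  define D1 where "D1 = {p r |r. r \<in> ?I} \<union> {q r * q s |r s. r \<in> ?I \<and> s \<in> ?I}"
  define D2 where "D2 = {q r |r. r \<in> ?I} \<union> {p r * p s |r s. r \<in> ?I \<and> s \<in> ?I}"
  note pmult = cyclic_mult[of M ?I p q, OF sub pq ppp, folded D1_def D2_def]
  note qmult = cyclic_mult[of M ?I q p, OF sub qp qqq, folded D1_def D2_def]
  define G where "G = {1} \<union> p ` ?I \<union> q ` ?I"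
  have "f \<in> subalgebra hull G"
  proof (rule subsetD[OF coord_ring_subset f])
    have ne: "w - w' \<noteq> 0"
    proof
      assume "w - w' = 0"
      hence "(3::'a) = 0" using ww by algebra
      thus False by simp
    qed
    fix r assume "1 \<le> r" "r \<le> m"
    hence r: "p r \<in> subalgebra hull G" "q r \<in> subalgebra hull G" by (auto simp: G_def intro!: hull_inc)
    have y: "yvar r = cst (1 / (w - w')) * (p r - q r)"
    proof (rule peval_ext)
      fix \<nu>
      have "peval \<nu> (p r - q r) = (w - w') * \<nu> (Y r)"
        by (simp add: peval_p peval_q algebra_simps)
      thus "peval \<nu> (yvar r) = peval \<nu> (cst (1 / (w - w')) * (p r - q r))"
        using ne by (simp only: peval_simps) simp
    qed
    show Y: "yvar r \<in> subalgebra hull G"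
      unfolding y using r by (intro in_hull_cst_mult hull_closed)
    have x: "xvar r = p r - cst w * yvar r" by (simp add: p_def)
    show "xvar r \<in> subalgebra hull G"
      unfolding x using r Y by (intro in_hull_cst_mult subalgebra_diff[OF subalgebra_hull])
  qed (auto simp: G_def intro: hull_inc)
  moreover have "1 \<in> G" by (simp add: G_def)
  ultimately have "\<exists>f0\<in>M. \<exists>f1\<in>odd_part M D1. \<exists>f2\<in>odd_part M D2. f = f0 + f1 + f2"
  proof (induction rule: hull_induct_left)
    case one
    show ?case using \<open>1 \<in> M\<close> odd_part.zero by (metis add.right_neutral)
  next
    case (add g h)
    then obtain g0 g1 g2 h0 h1 h2 where "g0 \<in> M" "g1 \<in> odd_part M D1" "g2 \<in> odd_part M D2"
      "h0 \<in> M" "h1 \<in> odd_part M D1" "h2 \<in> odd_part M D2" "g = g0 + g1 + g2" "h = h0 + h1 + h2"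
      by blast
    hence "g0 + h0 \<in> M" "g1 + h1 \<in> odd_part M D1" "g2 + h2 \<in> odd_part M D2"
      "g + h = (g0 + h0) + (g1 + h1) + (g2 + h2)"
      by (auto intro: subalgebra_add[OF sub] odd_part_add simp: algebra_simps)
    thus ?case by blast
  next
    case (scale c g)
    then obtain g0 g1 g2 where g: "g0 \<in> M" "g1 \<in> odd_part M D1" "g2 \<in> odd_part M D2" "g = g0 + g1 + g2"
      by blast
    have c: "cst c * h \<in> odd_part M E" if "h \<in> odd_part M E" for h E
      by (rule odd_part_mult_odd[OF that])
         (metis mult.assoc odd_part_base subalgebra_cst_mult[OF sub])
    have "cst c * g = cst c * g0 + cst c * g1 + cst c * g2" by (simp add: g ring_distribs)
    moreover have "cst c * g0 \<in> M" using subalgebra_cst_mult[OF sub g(1)] .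
    ultimately show ?case using c g by blast
  next
    case (mult s g)
    then obtain g0 g1 g2 where g: "g0 \<in> M" "g1 \<in> odd_part M D1" "g2 \<in> odd_part M D2" "g = g0 + g1 + g2"
      by blast
    from mult(1) consider "s = 1" | r where "r \<in> ?I" "s = p r" | r where "r \<in> ?I" "s = q r"
      by (auto simp: G_def)
    thus ?case
    proof cases
      case 1 thus ?thesis using mult by simp
    next
      case 2
      have "s * g = p r * g2 + p r * g0 + p r * g1" by (simp add: 2 g ring_distribs add_ac)
      thus ?thesis using pmult[OF _ _ _ _ _ 2(1)] g by blast
    next
      case 3
      have "s * g = q r * g1 + q r * g2 + q r * g0" by (simp add: 3 g ring_distribs add_ac)
      thus ?thesis using qmult[OF _ _ _ _ _ 3(1)] g by blast
    qed
  qed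
  then obtain f0 f1 f2 where f012: "f0 \<in> M" "f1 \<in> odd_part M D1" "f2 \<in> odd_part M D2" "f = f0 + f1 + f2"
    by blast
  let ?T = "act 0 1 (- 1) (- 1)" and ?T2 = "act (- 1) (- 1) 1 0" and ?T3 = "act 1 0 (- 1) (- 1)"
  have act: "peval (?T \<nu>) (p r) = w * peval \<nu> (p r)" "peval (?T \<nu>) (q r) = w' * peval \<nu> (q r)"
    "peval (?T2 \<nu>) (p r) = w' * peval \<nu> (p r)" "peval (?T2 \<nu>) (q r) = w * peval \<nu> (q r)"
    "peval (?T3 \<nu>) (p r) = peval \<nu> (q r)" "peval (?T3 \<nu>) (q r) = peval \<nu> (p r)" for \<nu> r
    unfolding peval_p peval_q act_simps using ww by algebra+
  have cancel: "w * a * (w' * b) = a * b" "w' * a * (w * b) = a * b"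
    "w * a * (w * b) * (w * c) = a * b * c" "w' * a * (w' * b) * (w' * c) = a * b * c"
    "w * a * (w * b) = w' * (a * b)" "w' * a * (w' * b) = w * (a * b)" for a b c
    using ww by algebra+
  have SD: "peval (?T \<nu>) s = peval \<nu> s \<and> peval (?T2 \<nu>) s = peval \<nu> s" if "s \<in> S \<union> D" for s \<nu>
    using that S(1)[of s] unfolding D_def
    by (auto simp: quad_pq cub_pq d_def e_def act cancel)
  have M_inv: "peval (?T \<nu>) g = peval \<nu> g" "peval (?T2 \<nu>) g = peval \<nu> g" if "g \<in> M" for g \<nu>
    using that SD peval_hull_invariant unfolding M_def by blast+
  have "f = f0"
  proof (rule peval_ext)
    fix \<nu>
    have 1: "peval (?T \<nu>) f1 = w * peval \<nu> f1" "peval (?T2 \<nu>) f1 = w' * peval \<nu> f1"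
      by (rule odd_part_eigen[OF f012(2)]; auto simp: M_inv D1_def act cancel)+
    have 2: "peval (?T \<nu>) f2 = w' * peval \<nu> f2" "peval (?T2 \<nu>) f2 = w * peval \<nu> f2"
      by (rule odd_part_eigen[OF f012(3)]; auto simp: M_inv D2_def act cancel)+
    \<comment> \<open>Summation over the powers of the 3-cycle: the eigenvalues 1, \<open>w\<close>,
      \<open>w'\<close> add up to 0, so the components \<open>f1\<close> and \<open>f2\<close> drop
      out.\<close>
    have "3 * peval \<nu> f = peval \<nu> f + peval (?T \<nu>) f + peval (?T2 \<nu>) f"
      by (simp add: T T2)
    also have "\<dots> = 3 * peval \<nu> f0 + (1 + w + w') * (peval \<nu> f1 + peval \<nu> f2)"
      unfolding f012(4) peval_simps M_inv[OF f012(1)] 1 2 by (simp add: algebra_simps)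
    finally show "peval \<nu> f = peval \<nu> f0" using ww by simp
  qed
  hence "f \<in> subalgebra hull (S \<union> D)" using f012(1) by (simp add: M_def)
  thus ?thesis
  proof (rule hull_even[where T = ?T3])
    show "peval (?T3 \<nu>) s = peval \<nu> s" if "s \<in> S" for s \<nu>
      using S(1)[OF that] by (auto simp: quad_pq cub_pq act; simp add: algebra_simps)
    show "peval (?T3 \<nu>) s = - peval \<nu> s" if "s \<in> D" for s \<nu>
      using that unfolding D_def by (auto simp: d_def e_def act)
  qed (use S(2) DD T3 in auto)
qed

lemma minimal_generating_set_S3:
  fixes mul :: "'a::{alg_closed_field, field_char_0} ^ 2 \<Rightarrow> 'a ^ 2 \<Rightarrow> 'a ^ 2"
  assumes aut: "\<And>a b c d. aut_matrix mul a b c d \<longleftrightarrow>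
    (a, b, c, d) \<in> {(1, 0, 0, 1), (0, 1, 1, 0), (1, 0, - 1, - 1), (- 1, - 1, 1, 0), (0, 1, - 1, - 1), (- 1, - 1, 0, 1)}"
  shows "minimal_generating_set ({1} \<union> {quad r s |r s. 1 \<le> r \<and> r \<le> s \<and> s \<le> m}
         \<union> {cub r s t |r s t. 1 \<le> r \<and> r \<le> s \<and> s \<le> t \<and> t \<le> m}) (invariants (*s) mul b1 b2 m)"
    (is "minimal_generating_set ?S _")
proof (rule minimal_generating_set_invariants)
  have "quad r s \<in> coord_ring m" "cub r s t \<in> coord_ring m"
    if "1 \<le> r" "r \<le> s" "s \<le> t" "t \<le> m" for r s t
    using that unfolding quad_def cub_def by (intro coord_ring_closed; simp)+
  thus "?S \<subseteq> coord_ring m" by auto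
  show "peval (act a b c d \<nu>) s = peval \<nu> s" if "s \<in> ?S" "aut_matrix mul a b c d" for s a b c d \<nu>
  proof -
    from that(1) consider "s = 1" | r t where "s = quad r t" | i r t where "s = cub i r t" by blast
    thus ?thesis
    proof cases
      case 1 thus ?thesis by simp
    next
      case 2
      show ?thesis unfolding 2 using that(2) by (auto simp: aut quad_def; simp add: algebra_simps)
    next
      case 3
      show ?thesis unfolding 3 using that(2) by (auto simp: aut cub_def; simp add: algebra_simps)
    qed
  qed
  show "f \<in> subalgebra hull ?S" if f: "f \<in> coord_ring m"
    and inv: "\<And>a b c d \<nu>. aut_matrix mul a b c d \<Longrightarrow> peval (act a b c d \<nu>) f = peval \<nu> f" for f
  proof -
    have "\<exists>w::'a. poly [:1, 1, 1:] w = 0"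
      by (rule alg_closed_imp_poly_has_root) simp
    then obtain w :: 'a where "1 + w + w * w = 0" by (auto simp: algebra_simps)
    hence w: "w * w = - 1 - w" by algebra
    show ?thesis
      by (rule S3_invariants[OF w f]) ((rule inv; simp add: aut) | blast)+
  qed
  show "\<exists>W. subalgebra W \<and> ?S - {s} \<subseteq> W \<and> s \<notin> W" if s: "s \<in> ?S" for s
  proof -
    have one: "coef (1 :: 'a mpoly) M = (if M = {#} then 1 else 0)" for M
      by (auto simp: coef_calc)
    consider "s = 1" | r t where "s = quad r t" "r \<le> t" | i r t where "s = cub i r t" "i \<le> r" "r \<le> t"
      using s by blast
    thus ?thesis
    proof cases
      case 1 thus ?thesis by (intro separated_std[of "{#}"]) (auto simp: one coef_quad coef_cub)
    next
      case 2
      thus ?thesis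
        by (intro separated_std[of "{#X r, X t#}"]) (auto simp: one coef_quad coef_cub add_eq_conv_ex)
    next
      case 3
      \<comment> \<open>Index triples of generators are nondecreasing, so triples with the same
        multiset of indices coincide.\<close>
      have eq: "a = i \<and> b = r \<and> c = t" if "{#a, b, c#} = {#i, r, t#}" "a \<le> b" "b \<le> c" for a b c
      proof -
        have "sort [i, r, t] = [a, b, c]" using that by (intro properties_for_sort) auto
        moreover have "sort [i, r, t] = [i, r, t]" using 3 by (intro properties_for_sort) auto
        ultimately show ?thesis by simp
      qed
      show ?thesis
        by (rule separated_std[of "{#X i, X r, X t#}"]) (use 3 in \<open>auto simp: one coef_quad coef_cub dest!: eq\<close>)
    qed
  qed
qed

section \<open>Isomorphisms and eigenbases of automorphisms\<close>

lemma algebra_iso_linear: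
  assumes "algebra_iso s m s' m' g"
  shows "g (x + y) = g x + g y" "g (s c x) = s' c (g x)"
proof -
  interpret Vector_Spaces.linear s s' g using assms by (simp add: algebra_iso_def)
  show "g (x + y) = g x + g y" "g (s c x) = s' c (g x)" by (rule add, rule scale)
qed

lemma algebra_isoI:
  assumes "vector_space s" "vector_space s'" "\<And>x y. g (x + y) = g x + g y" "\<And>c x. g (s c x) = s' c (g x)"
    "bij g" "\<And>x y. g (m x y) = m' (g x) (g y)"
  shows "algebra_iso s m s' m' g"
  using assms unfolding algebra_iso_def Vector_Spaces.linear_def module_hom_def module_hom_axioms_def
  by (auto simp: vector_space_def module_def)

lemma algebra_iso_spaces:
  assumes "algebra_iso s m s' m' g"
  shows "vector_space s" "vector_space s'"
  using assms by (auto simp: algebra_iso_def Vector_Spaces.linear_def)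

lemma algebra_iso_trans:
  assumes "algebra_iso s m s' m' g" "algebra_iso s' m' s'' m'' h"
  shows "algebra_iso s m s'' m'' (h \<circ> g)"
  using assms
  by (intro algebra_isoI) (auto simp: algebra_iso_linear algebra_iso_spaces algebra_iso_def intro: bij_comp)

lemma algebra_iso_sym:
  assumes "algebra_iso s m s' m' g"
  shows "algebra_iso s' m' s m (inv g)"
proof (rule algebra_isoI[OF algebra_iso_spaces(2,1)[OF assms]])
  have bij: "bij g" and mult: "\<And>x y. g (m x y) = m' (g x) (g y)"
    using assms by (auto simp: algebra_iso_def)
  have gi: "g (inv g y) = y" for y using bij by (simp add: bij_is_surj surj_f_inv_f)
  have eq: "x = inv g y" if "g x = y" for x y using that bij by (metis bij_inv_eq_iff)
  show "bij (inv g)" using bij by (rule bij_imp_bij_inv)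
  show "inv g (x + y) = inv g x + inv g y" for x y
    by (rule eq[symmetric]) (simp add: algebra_iso_linear[OF assms] gi)
  show "inv g (s' c x) = s c (inv g x)" for c x
    by (rule eq[symmetric]) (simp add: algebra_iso_linear[OF assms] gi)
  show "inv g (m' x y) = m (inv g x) (inv g y)" for x y
    by (rule eq[symmetric]) (simp add: mult gi)
qed

lemma id_in_Aut:
  assumes "vector_space s"
  shows "id \<in> Aut s m"
  unfolding Aut_def using assms by (auto intro!: algebra_isoI)

lemma Aut_transfer:
  assumes g: "algebra_iso s m s' m' g" and nontrivial: "Aut s m \<noteq> {id}"
  shows "\<exists>h\<in>Aut s' m'. h \<noteq> id"
proof -
  obtain k where k: "algebra_iso s m s m k" "k \<noteq> id"
    using nontrivial id_in_Aut[OF algebra_iso_spaces(1)[OF g], of m] by (auto simp: Aut_def)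
  let ?h = "g \<circ> (k \<circ> inv g)"
  have "algebra_iso s' m' s' m' ?h"
    by (intro algebra_iso_trans[OF _ g] algebra_iso_trans[OF _ k(1)] algebra_iso_sym[OF g])
  moreover have "?h \<noteq> id"
  proof
    assume h: "?h = id"
    have bij: "bij g" using g by (simp add: algebra_iso_def)
    have "k x = x" for x
    proof -
      have "g (k x) = ?h (g x)" using bij by (simp add: bij_is_inj)
      hence "g (k x) = g x" by (simp add: h)
      thus ?thesis using bij by (simp add: bij_is_inj inj_eq)
    qed
    thus False using k(2) by auto
  qed
  ultimately show ?thesis by (auto simp: Aut_def)
qed

lemma two_dim_algebra_iso_alg:
  fixes smul :: "'a::field \<Rightarrow> 'v::ab_group_add \<Rightarrow> 'v"
  assumes "two_dim_algebra smul mul e1 e2"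
  shows "\<exists>p q r s g. algebra_iso smul mul (*s) (alg p q r s) g"
proof -
  interpret two_dim_algebra smul mul e1 e2 by fact
  let ?R = "representation {e1, e2}"
  define g :: "'v \<Rightarrow> 'a ^ 2" where "g w = vector [?R w e1, ?R w e2]" for w
  define h where "h z = smul (z $ 1) e1 + smul (z $ 2) e2" for z :: "'a ^ 2"
  note ind = basis_independent
  have sp: "w \<in> span {e1, e2}" for w using basis_span by blast
  have hg: "h (g w) = w" for w
  proof -
    have "(\<Sum>b\<in>{e1, e2}. smul (?R w b) b) = w"
      by (rule sum_representation_eq) (use ind sp in auto)
    thus ?thesis using basis_distinct by (simp add: h_def g_def)
  qed
  have g_add: "g (x + y) = g x + g y" and g_scale: "g (smul c x) = c *s g x" for x y c
    by (simp_all add: g_def vec2_eq_iff representation_add[OF ind sp sp] representation_scale[OF ind sp])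
  have "g e1 = b1" "g e2 = b2"
    using basis_distinct by (simp_all add: g_def vec2_eq_iff representation_basis[OF ind])
  hence gh: "g (h z) = z" for z by (simp add: h_def g_add g_scale b_expand[symmetric])
  have mul_left: "mul (x + y) z = mul x z + mul y z" "mul (smul c x) z = smul c (mul x z)" for x y z c
    using linear_mul_left[of z] unfolding Vector_Spaces.linear_def module_hom_def module_hom_axioms_def by blast+
  have mul_right: "mul z (x + y) = mul z x + mul z y" "mul z (smul c x) = smul c (mul z x)" for x y z c
    using linear_mul_right[of z] unfolding Vector_Spaces.linear_def module_hom_def module_hom_axioms_def by blast+
  let ?m = "alg (g (mul e1 e1)) (g (mul e1 e2)) (g (mul e2 e1)) (g (mul e2 e2))"
  have "g (mul x y) = ?m (g x) (g y)" for x y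
  proof -
    have "mul x y = mul (h (g x)) (h (g y))" by (simp add: hg)
    thus ?thesis
      by (simp add: h_def mul_left mul_right g_add g_scale vec2_eq_iff algebra_simps)
  qed
  moreover have "bij g" by (rule o_bij[of h]) (simp_all add: fun_eq_iff gh hg)
  ultimately have "algebra_iso smul mul (*s) ?m g"
    using algebra_isoI[of smul "(*s)" g mul ?m, OF vector_space_axioms vec.vector_space_axioms]
      g_add g_scale by metis
  thus ?thesis by blast
qed

section \<open>Change of basis and Jordan form\<close>

definition iso2 :: "('a::field ^ 2 \<Rightarrow> 'a ^ 2 \<Rightarrow> 'a ^ 2) \<Rightarrow> ('a ^ 2 \<Rightarrow> 'a ^ 2 \<Rightarrow> 'a ^ 2) \<Rightarrow> bool" where
  "iso2 m m' \<longleftrightarrow> (\<exists>g. algebra_iso (*s) m (*s) m' g)"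

lemma iso2_trans: "iso2 m m' \<Longrightarrow> iso2 m' m'' \<Longrightarrow> iso2 m m''"
  unfolding iso2_def using algebra_iso_trans by blast

lemma alg_hom:
  assumes "lin2 a b c d p' = alg p q r s (lin2 a b c d b1) (lin2 a b c d b1)"
    "lin2 a b c d q' = alg p q r s (lin2 a b c d b1) (lin2 a b c d b2)"
    "lin2 a b c d r' = alg p q r s (lin2 a b c d b2) (lin2 a b c d b1)"
    "lin2 a b c d s' = alg p q r s (lin2 a b c d b2) (lin2 a b c d b2)"
  shows "lin2 a b c d (alg p' q' r' s' u v) = alg p q r s (lin2 a b c d u) (lin2 a b c d v)"
proof -
  let ?g = "lin2 a b c d" and ?m = "alg p q r s"
  have "?g (alg p' q' r' s' u v) = (u $ 1 * v $ 1) *s ?g p' + (u $ 1 * v $ 2) *s ?g q' +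
      (u $ 2 * v $ 1) *s ?g r' + (u $ 2 * v $ 2) *s ?g s'"
    by (simp add: vec2_eq_iff algebra_simps)
  also have "\<dots> = ?m (?g u) (?g v)"
    unfolding assms by (simp add: vec2_eq_iff algebra_simps)
  finally show ?thesis .
qed

text \<open>The columns \<open>(a, b)\<close>, \<open>(c, d)\<close> are the new basis.\<close>

lemma iso2_alg:
  assumes "a * d - b * c \<noteq> 0"
    "lin2 a b c d p' = alg p q r s (lin2 a b c d b1) (lin2 a b c d b1)"
    "lin2 a b c d q' = alg p q r s (lin2 a b c d b1) (lin2 a b c d b2)"
    "lin2 a b c d r' = alg p q r s (lin2 a b c d b2) (lin2 a b c d b1)"
    "lin2 a b c d s' = alg p q r s (lin2 a b c d b2) (lin2 a b c d b2)"
  shows "iso2 (alg p q r s) (alg p' q' r' s')"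
proof -
  have "algebra_iso (*s) (alg p' q' r' s') (*s) (alg p q r s) (lin2 a b c d)"
    using assms(1) alg_hom[OF assms(2-)]
    by (simp add: algebra_iso_def lin2_linear bij_lin2_iff)
  thus ?thesis unfolding iso2_def by (blast intro: algebra_iso_sym)
qed

text \<open>The columns \<open>(e, f)\<close> and \<open>(k, h)\<close> are a new basis, and
  \<open>(a', b')\<close>, \<open>(c', d')\<close> are the coordinates in it of the images of its
  vectors. Automorphism and structure constants are rewritten together.\<close>

lemma conjugate_aut:
  assumes aut: "aut_matrix (alg p q r s) a b c d" and det: "e * h - f * k \<noteq> 0"
    and 1: "lin2 a b c d (lin2 e f k h b1) = lin2 e f k h (vector [a', b'])"
    and 2: "lin2 a b c d (lin2 e f k h b2) = lin2 e f k h (vector [c', d'])"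
  shows "\<exists>p' q' r' s'. iso2 (alg p q r s) (alg p' q' r' s') \<and> aut_matrix (alg p' q' r' s') a' b' c' d'"
proof -
  let ?H = "lin2 e f k h" and ?G = "lin2 a b c d" and ?G' = "lin2 a' b' c' d'"
  have bij: "bij ?H" using det by (simp add: bij_lin2_iff)
  have surj: "?H (inv ?H x) = x" for x using bij by (simp add: bij_is_surj surj_f_inv_f)
  let ?m = "alg p q r s"
  define p' where "p' = inv ?H (?m (?H b1) (?H b1))"
  define q' where "q' = inv ?H (?m (?H b1) (?H b2))"
  define r' where "r' = inv ?H (?m (?H b2) (?H b1))"
  define s' where "s' = inv ?H (?m (?H b2) (?H b2))"
  let ?m' = "alg p' q' r' s'"
  have eq: "?H p' = ?m (?H b1) (?H b1)" "?H q' = ?m (?H b1) (?H b2)"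
    "?H r' = ?m (?H b2) (?H b1)" "?H s' = ?m (?H b2) (?H b2)"
    by (simp_all add: p'_def q'_def r'_def s'_def surj)
  note hom = alg_hom[OF eq]
  have GH: "?G (?H x) = ?H (?G' x)" for x
  proof -
    have "?G (?H x) = x $ 1 *s ?G (?H b1) + x $ 2 *s ?G (?H b2)"
      by (simp add: vec2_eq_iff algebra_simps)
    also have "\<dots> = ?H (?G' x)" unfolding 1 2 by (simp add: vec2_eq_iff algebra_simps)
    finally show ?thesis .
  qed
  have aut': "?G (?m x y) = ?m (?G x) (?G y)" for x y using aut by (simp add: aut_matrix_def)
  have bijG: "bij ?G" using aut by (simp add: bij_lin2_iff aut_matrix_def)
  have "?G' = inv ?H \<circ> (?G \<circ> ?H)"
    using bij by (auto simp: fun_eq_iff GH bij_is_inj)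
  hence "bij ?G'" using bij bijG by (metis bij_comp bij_imp_bij_inv)
  moreover have "?G' (?m' x y) = ?m' (?G' x) (?G' y)" for x y
  proof -
    have "?H (?G' (?m' x y)) = ?H (?m' (?G' x) (?G' y))"
      by (simp only: GH[symmetric] hom aut')
    thus ?thesis using bij by (simp add: bij_is_inj inj_eq)
  qed
  ultimately have "aut_matrix ?m' a' b' c' d'" by (simp add: aut_matrix_def bij_lin2_iff)
  thus ?thesis using iso2_alg[OF det eq] by blast
qed

lemma quadratic_root:
  fixes b c :: "'a::alg_closed_field"
  shows "\<exists>x y. x + y = b \<and> x * y = c"
proof -
  have "\<exists>x. poly [:c, - b, 1:] x = 0" by (rule alg_closed_imp_poly_has_root) simp
  then obtain x where "c + x * (x - b) = 0" by auto
  hence "x * (b - x) = c" by algebra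
  moreover have "x + (b - x) = b" by simp
  ultimately show ?thesis by blast
qed

text \<open>The eigenvalues \<open>k\<close>, \<open>l\<close> are found from trace and determinant,
  and a nonzero off-diagonal entry gives explicit eigenvectors. If \<open>k = l\<close> and the
  matrix is not diagonal, the eigenvector is completed by a standard basis vector whose image is
  \<open>k\<close> times itself plus that eigenvector.\<close>

lemma eigenbasis:
  fixes p q r s :: "'a::alg_closed_field ^ 2"
  assumes aut: "aut_matrix (alg p q r s) a b c d" and ne: "\<not> (a = 1 \<and> b = 0 \<and> c = 0 \<and> d = 1)"
  shows "\<exists>p' q' r' s'. iso2 (alg p q r s) (alg p' q' r' s') \<and>
    (\<exists>k l. (aut_matrix (alg p' q' r' s') k 0 0 l \<and> (k \<noteq> 1 \<or> l \<noteq> 1)) \<or> aut_matrix (alg p' q' r' s') k 0 1 k)"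
proof -
  obtain k l where kl: "k + l = a + d" "k * l = a * d - b * c"
    using quadratic_root by blast
  have tr: "d = k + l - a" using kl(1) by (simp add: algebra_simps)
  have bc: "c * b = (k + l - a) * a - k * l" using kl(2) tr by (simp add: algebra_simps)
  consider "b = 0 \<and> c = 0" | "c \<noteq> 0" "k \<noteq> l" | "c \<noteq> 0" "k = l" | "b \<noteq> 0" "k \<noteq> l" | "b \<noteq> 0" "k = l"
    by blast
  thus ?thesis
  proof cases
    case 1
    have "iso2 (alg p q r s) (alg p q r s)"
      by (rule iso2_alg[of 1 1 0 0]) (simp_all add: vec2_eq_iff)
    thus ?thesis using aut ne 1 by blast
  next
    case 2
    \<comment> \<open>The new basis vectors \<open>(c, k - a)\<close> and \<open>(c, l - a)\<close>
      are eigenvectors for \<open>k\<close> and \<open>l\<close>.\<close>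
    have "\<exists>p' q' r' s'. iso2 (alg p q r s) (alg p' q' r' s') \<and> aut_matrix (alg p' q' r' s') k 0 0 l"
    proof (rule conjugate_aut[OF aut, of c "l - a" "k - a" c])
      show "c * (l - a) - (k - a) * c \<noteq> 0" using 2 by (simp add: algebra_simps)
    qed (simp_all add: vec2_eq_iff tr bc mult.commute[of b c]; simp add: algebra_simps)+
    moreover have "k \<noteq> 1 \<or> l \<noteq> 1" using 2 by auto
    ultimately show ?thesis by blast
  next
    case 3
    have "\<exists>p' q' r' s'. iso2 (alg p q r s) (alg p' q' r' s') \<and> aut_matrix (alg p' q' r' s') k 0 1 k"
    proof (rule conjugate_aut[OF aut, of c 1 "k - a" 0])
      show "c * 1 - (k - a) * 0 \<noteq> 0" using 3 by simp
    qed (simp_all add: vec2_eq_iff tr bc mult.commute[of b c] 3; simp add: algebra_simps)+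
    thus ?thesis by blast
  next
    case 4
    have "\<exists>p' q' r' s'. iso2 (alg p q r s) (alg p' q' r' s') \<and> aut_matrix (alg p' q' r' s') k 0 0 l"
    proof (rule conjugate_aut[OF aut, of "k - d" b b "l - d"])
      show "(k - d) * b - b * (l - d) \<noteq> 0" using 4 by (simp add: algebra_simps)
    qed (simp_all add: vec2_eq_iff tr bc mult.commute[of b c]; simp add: algebra_simps bc)+
    moreover have "k \<noteq> 1 \<or> l \<noteq> 1" using 4 by auto
    ultimately show ?thesis by blast
  next
    case 5
    have "\<exists>p' q' r' s'. iso2 (alg p q r s) (alg p' q' r' s') \<and> aut_matrix (alg p' q' r' s') k 0 1 k"
    proof (rule conjugate_aut[OF aut, of "k - d" 0 b 1])
      show "(k - d) * 0 - b * 1 \<noteq> 0" using 5 by simp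
    qed (simp_all add: vec2_eq_iff tr bc mult.commute[of b c] 5; simp add: algebra_simps bc)+
    thus ?thesis by blast
  qed
qed

section \<open>Classification\<close>

definition occurs ::
  "('a::field \<times> 'a) set \<Rightarrow> 'a triple set \<Rightarrow> nat \<Rightarrow> ('a ^ 2 \<Rightarrow> 'a ^ 2 \<Rightarrow> 'a ^ 2) \<Rightarrow> bool" where
  "occurs U Vt m mul \<longleftrightarrow> (\<exists>mul' S. listed U Vt m mul' S \<and> iso2 mul mul')"

lemma occursI: "listed U Vt m mul' S \<Longrightarrow> iso2 mul mul' \<Longrightarrow> occurs U Vt m mul"
  unfolding occurs_def by blast

lemma occurs_iso2: "iso2 mul mul' \<Longrightarrow> occurs U Vt m mul' \<Longrightarrow> occurs U Vt m mul"
  unfolding occurs_def using iso2_trans by blast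

text \<open>Here \<open>C1 = C2\<close>, so the triple has the form \<open>(c, c, r)\<close>. Its
  representative in \<open>Vt\<close> is a rearrangement; if the first two entries differed, the
  third would have to differ from both, which is impossible with \<open>c\<close> repeated. Hence
  the representative is \<open>(c, c, r)\<close> itself.\<close>

lemma listed_E1_symmetric:
  fixes \<alpha> \<beta> :: "'a::field"
  assumes Vt: "is_V_tilde Vt" and t: "\<alpha> + \<beta> \<noteq> 1" "\<alpha> + \<beta> \<noteq> - 1"
  shows "\<exists>S. listed U Vt m (alg_E1 \<alpha> \<beta> \<beta> \<alpha>) S"
proof (cases "(\<alpha>, \<beta>) = (- 1, - 1)")
  case True
  thus ?thesis using listed.E1_special by blast
next
  case False
  let ?\<Gamma> = "(\<alpha>, \<beta>, \<beta>, \<alpha>)"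
  let ?c = "(\<beta>, \<alpha>)" and ?r = "par_C3 ?\<Gamma>"
  have C: "par_C1 ?\<Gamma> = ?c" "par_C2 ?\<Gamma> = ?c" by (simp_all add: par_C1_def par_C2_def)
  have "par_D ?\<Gamma> = (\<alpha> + \<beta> - 1) * (\<alpha> + \<beta> + 1)"
    by (simp add: par_D_def algebra_simps)
  hence adm: "?\<Gamma> \<in> admissible"
    using t by (simp add: admissible_def C T_set_def add.commute eq_neg_iff_add_eq_0)
  hence "(?c, ?c, ?r) \<in> triples" unfolding triples_def using C by (metis (no_types, lifting) image_eqI)
  then obtain x where x: "x \<in> Vt" "x \<in> S3_orbit (?c, ?c, ?r)"
    using Vt unfolding is_V_tilde_def orbit_representatives_def by blast
  have distinct: "p \<noteq> q \<Longrightarrow> r \<noteq> p \<and> r \<noteq> q" if "(p, q, r) \<in> Vt" for p q r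
    using Vt that unfolding is_V_tilde_def by blast
  from x(2) have "x = (?c, ?c, ?r) \<or> x = (?c, ?r, ?c) \<or> x = (?r, ?c, ?c)"
    by (auto simp: S3_orbit_def)
  hence "(?c, ?c, ?r) \<in> Vt" using x(1) distinct by metis
  hence "?\<Gamma> \<in> V_set Vt" using adm by (simp add: V_set_def C)
  thus ?thesis using listed.E1 False by blast
qed

lemma square_root:
  fixes x :: "'a::alg_closed_field"
  shows "\<exists>y. y * y = x"
  using nth_root_exists[of 2 x] by (auto simp: power2_eq_square)

text \<open>The algebras graded by parity with \<open>b1\<close> even and \<open>b2\<close> odd,
  equivalently (in characteristic other than 2) those with the automorphism that negates
  \<open>b2\<close>.\<close>

abbreviation diag_alg :: "'a \<Rightarrow> 'a \<Rightarrow> 'a \<Rightarrow> 'a \<Rightarrow> 'a::field ^ 2 \<Rightarrow> 'a ^ 2 \<Rightarrow> 'a ^ 2" where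
  "diag_alg a b c d \<equiv> alg (vector [a, 0]) (vector [0, b]) (vector [0, c]) (vector [d, 0])"

text \<open>When \<open>b + c = 1\<close>, both \<open>b1\<close> and \<open>b1 + b2\<close> are
  idempotent; they are the new basis.\<close>

lemma occurs_E5:
  fixes b c :: "'a::field"
  assumes "b + c = 1"
  shows "occurs U Vt m (diag_alg 1 b c 0)"
proof (rule occursI[OF listed.E5[of _ _ _ b]])
  have c: "c = 1 - b" using assms by algebra
  show "iso2 (diag_alg 1 b c 0) (alg_E5 b)"
    unfolding alg_E5_def c
    by (rule iso2_alg[where a = 1 and b = 0 and c = 1 and d = 1]) (simp_all add: vec2_eq_iff algebra_simps)
qed

text \<open>The square of \<open>x b1 + y b2\<close> is \<open>(x^2 + y^2) b1 + t x y b2\<close>, so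
  idempotents with \<open>y \<noteq> 0\<close> have \<open>x = 1 / t\<close> and
  \<open>y^2 = (t - 1) / t^2\<close>. In general there are two, leading to \<open>alg_E1\<close>.
  For \<open>t = 1\<close> there is none and exchanging the basis vectors gives
  \<open>alg_C_0\<close>; for \<open>t = 0\<close> a vector of square zero takes their place and
  gives \<open>alg_D1\<close>.\<close>

lemma occurs_diag_unital:
  fixes b c :: "'a::{alg_closed_field, field_char_0}"
  assumes U: "is_U U" and Vt: "is_V_tilde Vt"
  shows "occurs U Vt m (diag_alg 1 b c 1)"
proof -
  define t where "t = b + c"
  consider "t = 1" | "t = 0" | "t \<noteq> 0" "t \<noteq> 1" by blast
  thus ?thesis
  proof cases
    case 1
    hence c: "c = 1 - b" unfolding t_def by algebra
    show ?thesis
    proof (rule occursI[OF listed.C_0[of _ _ _ b]])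
      show "iso2 (diag_alg 1 b c 1) (alg_C_0 b)"
        unfolding alg_C_0_def c
        by (rule iso2_alg[where a = 0 and b = 1 and c = 1 and d = 0]) (simp_all add: vec2_eq_iff)
    qed
  next
    case 2
    hence c: "c = - b" unfolding t_def by algebra
    obtain i :: 'a where i: "i * i = - 1" using square_root by blast
    define \<alpha> where "\<alpha> = (1 + b) / 2"
    have b: "b = 2 * \<alpha> - 1" by (simp add: \<alpha>_def field_simps)
    have "\<exists>r. r \<in> U \<and> r \<in> U_orbit (\<alpha>, 2 * \<alpha> - 1)"
      using U unfolding is_U_def orbit_representatives_def by blast
    \<comment> \<open>The involution fixes \<open>(\<alpha>, 2 * \<alpha> - 1)\<close>, so this
      orbit has one point and \<open>U\<close> must contain it.\<close>
    moreover have "1 - \<alpha> + (2 * \<alpha> - 1) = \<alpha>" by simp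
    ultimately have \<alpha>U: "(\<alpha>, 2 * \<alpha> - 1) \<in> U" by (auto simp: U_orbit_def)
    show ?thesis
    proof (rule occursI[OF listed.D1[OF \<alpha>U]])
      have i0: "i \<noteq> 0" using i by auto
      \<comment> \<open>The second basis vector \<open>(b1 + i b2) / 2\<close> has square zero
        because \<open>i^2 = - 1\<close> and \<open>b + c = 0\<close>.\<close>
      show "iso2 (diag_alg 1 b c 1) (alg_D1 \<alpha> (2 * \<alpha> - 1))"
        unfolding alg_D1_def c b
        by (rule iso2_alg[where a = 1 and b = 0 and c = "1 / 2" and d = "i / 2"])
           (simp_all add: vec2_eq_iff i i0 field_simps)
    qed
  next
    case 3
    obtain w where w: "w * w = b + c - 1" using square_root by blast
    define i where "i = 1 / t"
    have i: "i * (b + c) = 1" using 3 by (simp add: i_def t_def)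
    have w0: "w \<noteq> 0" using w 3 by (auto simp: t_def)
    have i0: "i \<noteq> 0" using i by auto
    define \<alpha> where "\<alpha> = (1 - b) * i"
    define \<beta> where "\<beta> = (1 - c) * i"
    have s: "\<alpha> + \<beta> = 2 * i - 1" unfolding \<alpha>_def \<beta>_def using i by algebra
    have i1: "i \<noteq> 1" using i 3 by (auto simp: t_def)
    have "\<alpha> + \<beta> \<noteq> 1" using s i1 by auto
    moreover have "\<alpha> + \<beta> \<noteq> - 1" using s i0 by auto
    ultimately obtain S where S: "listed U Vt m (alg_E1 \<alpha> \<beta> \<beta> \<alpha>) S"
      using listed_E1_symmetric[OF Vt] by blast
    show ?thesis
    proof (rule occursI[OF S])
      show "iso2 (diag_alg 1 b c 1) (alg_E1 \<alpha> \<beta> \<beta> \<alpha>)"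
        unfolding alg_E1_def
      proof (rule iso2_alg[where a = i and b = "w * i" and c = i and d = "- (w * i)"])
        have "i * - (w * i) - w * i * i = - 2 * (w * i * i)" by (simp add: algebra_simps)
        thus "i * - (w * i) - w * i * i \<noteq> 0" using w0 i0 by simp
      qed (simp_all add: vec2_eq_iff \<alpha>_def \<beta>_def, ((intro conjI)?; (use i w in algebra | simp add: algebra_simps))+)
    qed
  qed
qed

text \<open>A nonzero idempotent \<open>x b1 + y b2\<close> satisfies \<open>(b + c) x = 1\<close>
  and \<open>d y^2 = x\<close>. If \<open>b + c \<noteq> 0\<close> there are two, they form a basis,
  and the result is \<open>alg_E3\<close>. If \<open>b + c = 0\<close> there is none, and exchanging
  and rescaling the basis vectors suffices.\<close>

lemma occurs_diag_nilpotent: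
  fixes b c d :: "'a::{alg_closed_field, field_char_0}"
  assumes d: "d \<noteq> 0"
  shows "occurs U Vt m (diag_alg 0 b c d)"
proof -
  consider "b + c \<noteq> 0" | "b + c = 0" "c \<noteq> 0" | "b = 0" "c = 0" by force
  thus ?thesis
  proof cases
    case 1
    define i where "i = 1 / (b + c)"
    have i: "i * (b + c) = 1" using 1 by (simp add: i_def)
    have i0: "i \<noteq> 0" using i by auto
    obtain y where "y * y = i / d" using square_root by blast
    hence y: "y * y * d = i" using d by (simp add: field_simps)
    have y0: "y \<noteq> 0" using y i0 by auto
    show ?thesis
    proof (rule occursI[OF listed.E3[of _ _ _ "c * i"]])
      show "iso2 (diag_alg 0 b c d) (alg_E3 (c * i))"
        unfolding alg_E3_def
      proof (rule iso2_alg[where a = i and b = y and c = i and d = "- y"])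
        have "i * - y - y * i = - 2 * (y * i)" by (simp add: algebra_simps)
        thus "i * - y - y * i \<noteq> 0" using y0 i0 by simp
      qed (simp_all add: vec2_eq_iff, ((intro conjI)?; (use i y in algebra | simp add: algebra_simps))+)
    qed
  next
    case 2
    hence b: "b = - c" by algebra
    obtain k where "k * k = 1 / (c * d)" using square_root by blast
    hence k: "k * k * c * d = 1" using 2 d by (simp add: field_simps)
    have k0: "k \<noteq> 0" using k by auto
    show ?thesis
    proof (rule occursI[OF listed.A4_0])
      show "iso2 (diag_alg 0 b c d) alg_A4_0"
        unfolding alg_A4_0_def b
        by (rule iso2_alg[where a = 0 and b = k and c = "1 / c" and d = 0])
           (use 2 k k0 in \<open>simp_all add: vec2_eq_iff field_simps\<close>)
    qed
  next
    case 3
    show ?thesis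
    proof (rule occursI[OF listed.A3])
      show "iso2 (diag_alg 0 b c d) alg_A3"
        unfolding alg_A3_def 3
        by (rule iso2_alg[where a = 0 and b = 1 and c = d and d = 0]) (use d in \<open>simp_all add: vec2_eq_iff\<close>)
    qed
  qed
qed

lemma occurs_N:
  assumes "p = 0" "q = 0" "r = 0" "s = 0"
  shows "occurs U Vt m (alg p q r s)"
proof (rule occursI[OF listed.N])
  show "iso2 (alg p q r s) alg_N"
    unfolding alg_N_def assms
    by (rule iso2_alg[where a = 1 and b = 0 and c = 0 and d = 1]) (simp_all add: vec2_eq_iff)
qed

lemma occurs_diag:
  fixes a b c d :: "'a::{alg_closed_field, field_char_0}"
  assumes U: "is_U U" and Vt: "is_V_tilde Vt"
  shows "occurs U Vt m (diag_alg a b c d)"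
proof -
  consider "a \<noteq> 0" "d \<noteq> 0" | "a = 0" "d \<noteq> 0" | "a \<noteq> 0" "d = 0"
    | "a = 0" "d = 0" "b + c \<noteq> 0" | "a = 0" "d = 0" "b + c = 0" "b \<noteq> 0" | "a = 0" "d = 0" "b = 0" "c = 0"
    by force
  thus ?thesis
  proof cases
    case 1
    obtain k where "k * k = 1 / (a * d)" using square_root by blast
    hence k: "k * k * a * d = 1" using 1 by (simp add: field_simps)
    have k0: "k \<noteq> 0" using k by auto
    have "iso2 (diag_alg a b c d) (diag_alg 1 (b / a) (c / a) 1)"
      by (rule iso2_alg[where a = "1 / a" and b = 0 and c = 0 and d = k])
         (use 1 k k0 in \<open>simp_all add: vec2_eq_iff field_simps\<close>)
    thus ?thesis using occurs_diag_unital[OF U Vt] occurs_iso2 by blast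
  next
    case 2
    thus ?thesis using occurs_diag_nilpotent by blast
  next
    case 3
    have iso: "iso2 (diag_alg a b c d) (diag_alg 1 (b / a) (c / a) 0)"
      by (rule iso2_alg[where a = "1 / a" and b = 0 and c = 0 and d = 1])
         (use 3 in \<open>simp_all add: vec2_eq_iff field_simps\<close>)
    have "occurs U Vt m (diag_alg 1 (b / a) (c / a) 0)"
    proof (cases "b / a + c / a = 1")
      case True
      thus ?thesis by (rule occurs_E5)
    next
      case False
      hence "(b / a, c / a) \<notin> T_set" by (simp add: T_set_def)
      thus ?thesis
      proof (rule occursI[OF listed.D2])
        show "iso2 (diag_alg 1 (b / a) (c / a) 0) (alg_D2 (b / a) (c / a))"
          unfolding alg_D2_def
          by (rule iso2_alg[where a = 1 and b = 0 and c = 0 and d = 1]) (simp_all add: vec2_eq_iff)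
      qed
    qed
    thus ?thesis using iso occurs_iso2 by blast
  next
    case 4
    show ?thesis
    proof (rule occursI[OF listed.B2[of _ _ _ "b / (b + c)"]])
      have "1 - b / (b + c) = c / (b + c)" using 4 by (simp add: field_simps)
      thus "iso2 (diag_alg a b c d) (alg_B2 (b / (b + c)))"
        unfolding alg_B2_def
        by (intro iso2_alg[where a = 0 and b = 1 and c = "1 / (b + c)" and d = 0])
           (use 4 in \<open>simp_all add: vec2_eq_iff\<close>)
    qed
  next
    case 5
    hence c: "c = - b" by algebra
    show ?thesis
    proof (rule occursI[OF listed.B3])
      show "iso2 (diag_alg a b c d) alg_B3"
        unfolding alg_B3_def c
        by (rule iso2_alg[where a = "1 / b" and b = 0 and c = 0 and d = 1])
           (use 5 in \<open>simp_all add: vec2_eq_iff\<close>)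
    qed
  next
    case 6
    thus ?thesis by (intro occurs_N) (simp_all add: vec2_eq_iff)
  qed
qed

text \<open>These structure constants are what a unipotent Jordan block leaves. The block fixes the
  first basis vector while the shears of the listed algebras fix the second, so the vectors are
  exchanged, and then scaled to normalise \<open>x + y\<close> and \<open>z\<close>.\<close>

lemma occurs_jordan:
  fixes x y z :: "'a::field"
  shows "occurs U Vt m (alg 0 (vector [x, 0]) (vector [y, 0]) (vector [z, x + y]))"
    (is "occurs U Vt m ?A")
proof -
  consider "x + y \<noteq> 0" "z \<noteq> 0" | "x + y \<noteq> 0" "z = 0" | "x + y = 0" "y \<noteq> 0" "z \<noteq> 0"
    | "x + y = 0" "y \<noteq> 0" "z = 0" | "x = 0" "y = 0" "z \<noteq> 0" | "x = 0" "y = 0" "z = 0"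
    by force
  thus ?thesis
  proof cases
    case 1
    define s where "s = x + y"
    have s: "s \<noteq> 0" "x = s - y" using 1 by (simp_all add: s_def)
    show ?thesis
    proof (rule occursI[OF listed.A1[of _ _ _ "y / s"]])
      show "iso2 ?A (alg_A1 (y / s))"
        unfolding alg_A1_def s(2)
        by (rule iso2_alg[where a = 0 and b = "1 / s" and c = "z / (s * s)" and d = 0])
           (use 1 s in \<open>simp_all add: vec2_eq_iff field_simps\<close>)
    qed
  next
    case 2
    define s where "s = x + y"
    have s: "s \<noteq> 0" "x = s - y" using 2 by (simp_all add: s_def)
    have "iso2 ?A (diag_alg 1 (y / s) (x / s) 0)"
      unfolding s(2)
      by (rule iso2_alg[where a = 0 and b = "1 / s" and c = 1 and d = 0])
         (use 2 s in \<open>simp_all add: vec2_eq_iff field_simps\<close>)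
    moreover have "y / s + x / s = 1" using s by (simp add: s(2) field_simps)
    ultimately show ?thesis using occurs_E5 occurs_iso2 by blast
  next
    case 3
    hence x: "x = - y" by algebra
    show ?thesis
    proof (rule occursI[OF listed.A2])
      show "iso2 ?A alg_A2"
        unfolding alg_A2_def x
        by (rule iso2_alg[where a = 0 and b = "1 / y" and c = "z / (y * y)" and d = 0])
           (use 3 in \<open>simp_all add: vec2_eq_iff field_simps\<close>)
    qed
  next
    case 4
    hence x: "x = - y" by algebra
    show ?thesis
    proof (rule occursI[OF listed.B3])
      show "iso2 ?A alg_B3"
        unfolding alg_B3_def x
        by (rule iso2_alg[where a = 0 and b = "1 / y" and c = 1 and d = 0])
           (use 4 in \<open>simp_all add: vec2_eq_iff field_simps\<close>)
    qed
  next
    case 5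
    show ?thesis
    proof (rule occursI[OF listed.A3])
      show "iso2 ?A alg_A3"
        unfolding alg_A3_def 5
        by (rule iso2_alg[where a = 0 and b = 1 and c = z and d = 0])
           (use 5 in \<open>simp_all add: vec2_eq_iff\<close>)
    qed
  next
    case 6
    thus ?thesis by (intro occurs_N) (simp_all add: vec2_eq_iff)
  qed
qed

text \<open>An eigenvector can occur in the product of two eigenvectors only if its eigenvalue is
  the product of theirs. If one eigenvalue is 1, this leaves a \<open>diag_alg\<close>, possibly
  after exchanging the basis vectors; otherwise only the squares of the basis vectors survive, each
  a multiple of the other vector.\<close>

lemma occurs_of_diagonal_aut:
  fixes p q r s :: "'a::{alg_closed_field, field_char_0} ^ 2"
  assumes U: "is_U U" and Vt: "is_V_tilde Vt"
    and aut: "aut_matrix (alg p q r s) k 0 0 l" and ne: "k \<noteq> 1 \<or> l \<noteq> 1"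
  shows "occurs U Vt m (alg p q r s)"
proof -
  note E = aut_matrix_algD[OF aut, simplified]
  have kl: "k \<noteq> 0" "l \<noteq> 0" using E(1) by auto
  have p: "k = 1 \<or> p $ 1 = 0" "l = k * k \<or> p $ 2 = 0" using E(2,3) kl by auto
  have q: "l = 1 \<or> q $ 1 = 0" "k = 1 \<or> q $ 2 = 0" using E(4,5) kl by auto
  have r: "l = 1 \<or> r $ 1 = 0" "k = 1 \<or> r $ 2 = 0" using E(6,7) kl by auto
  have s: "k = l * l \<or> s $ 1 = 0" "l = 1 \<or> s $ 2 = 0" using E(8,9) kl by auto
  consider "k = 1" "l \<noteq> 1" | "k \<noteq> 1" "l = 1" | "k \<noteq> 1" "l \<noteq> 1" using ne by blast
  thus ?thesis
  proof cases
    case 1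
    hence "p = vector [p $ 1, 0]" "q = vector [0, q $ 2]" "r = vector [0, r $ 2]" "s = vector [s $ 1, 0]"
      using p q r s by (auto simp: vec2_eq_iff)
    thus ?thesis using occurs_diag[OF U Vt] by metis
  next
    case 2
    hence z: "p $ 1 = 0" "q $ 2 = 0" "r $ 2 = 0" "s $ 1 = 0" using p q r s by auto
    have "iso2 (alg p q r s) (diag_alg (s $ 2) (r $ 1) (q $ 1) (p $ 2))"
      by (rule iso2_alg[where a = 0 and b = 1 and c = 1 and d = 0]) (simp_all add: vec2_eq_iff z)
    thus ?thesis using occurs_diag[OF U Vt] occurs_iso2 by blast
  next
    case 3
    hence z: "p $ 1 = 0" "s $ 2 = 0" "q = 0" "r = 0" using p q r s by (auto simp: vec2_eq_iff)
    consider "p $ 2 = 0" | "s $ 1 = 0" | "p $ 2 \<noteq> 0" "s $ 1 \<noteq> 0" by blast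
    thus ?thesis
    proof cases
      case 1
      hence "p = vector [0, 0]" "q = vector [0, 0]" "r = vector [0, 0]" "s = vector [s $ 1, 0]"
        using z by (auto simp: vec2_eq_iff)
      thus ?thesis using occurs_diag[OF U Vt] by metis
    next
      case 2
      have "iso2 (alg p q r s) (diag_alg 0 0 0 (p $ 2))"
        by (rule iso2_alg[where a = 0 and b = 1 and c = 1 and d = 0]) (simp_all add: vec2_eq_iff z 2)
      thus ?thesis using occurs_diag[OF U Vt] occurs_iso2 by blast
    next
      case 3
      define P where "P = p $ 2"
      define Q where "Q = s $ 1"
      have PQ: "P \<noteq> 0" "Q \<noteq> 0" using 3 by (simp_all add: P_def Q_def)
      \<comment> \<open>With \<open>b1 b1 = P b2\<close> and \<open>b2 b2 = Q b1\<close>, the vector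
        \<open>x b1 + y b2\<close> is idempotent when \<open>y = P x^2\<close> and
        \<open>x = Q y^2\<close>, hence the cube root. Replacing \<open>x\<close> by
        \<open>w x\<close> and \<open>y\<close> by \<open>w^2 y\<close> gives a second
        idempotent.\<close>
      obtain x where "x ^ 3 = 1 / (P * P * Q)" using nth_root_exists[of 3 "1 / (P * P * Q)"] by auto
      hence x: "x * x * x * P * P * Q = 1" using PQ by (simp add: field_simps power3_eq_cube)
      have x0: "x \<noteq> 0" using x by auto
      have "\<exists>w::'a. poly [:1, 1, 1:] w = 0"
        by (rule alg_closed_imp_poly_has_root) simp
      then obtain w :: 'a where "1 + w + w * w = 0" by (auto simp: algebra_simps)
      hence w: "w * w = - 1 - w" by algebra
      have w1: "w \<noteq> 1"
      proof
        assume "w = 1"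
        with w have "(3::'a) = 0" by algebra
        thus False by simp
      qed
      have w0: "w \<noteq> 0" using w by auto
      let ?y = "x * x * P"
      have "iso2 (alg p q r s) (alg_E1 (- 1) (- 1) (- 1) (- 1))"
        unfolding alg_E1_def
      proof (rule iso2_alg[where a = x and b = ?y and c = "w * x" and d = "w * w * ?y"])
        have "x * (w * w * ?y) - ?y * (w * x) = w * (w - 1) * (x * x * x * P)"
          by (simp add: algebra_simps)
        thus "x * (w * w * ?y) - ?y * (w * x) \<noteq> 0" using w0 w1 x0 PQ by simp
      qed (simp_all add: vec2_eq_iff z P_def[symmetric] Q_def[symmetric], ((intro conjI)?; (use x w in algebra | simp add: algebra_simps))+)
      thus ?thesis by (rule occursI[OF listed.E1_special])
    qed
  qed
qed

text \<open>Products lie in the generalised eigenspace of \<open>k^2\<close>, which is zero unless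
  \<open>k = 1\<close>. For \<open>k = 1\<close> the equation from the square of \<open>b2\<close>
  reads \<open>2 (p $ 1) = 0\<close>, and characteristic zero reduces the algebra to the form in
  \<open>occurs_jordan\<close>.\<close>

lemma occurs_of_jordan_aut:
  fixes p q r s :: "'a::field_char_0 ^ 2"
  assumes aut: "aut_matrix (alg p q r s) k 0 1 k"
  shows "occurs U Vt m (alg p q r s)"
proof -
  note E = aut_matrix_algD[OF aut]
  have k: "k \<noteq> 0" using E(1) by auto
  have p2: "k = 1 \<or> p $ 2 = 0" using E(3) k by auto
  show ?thesis
  proof (cases "k = 1")
    case False
    have p: "p $ 2 = 0" "p $ 1 = 0" using p2 E(2) False k by auto
    have q: "q $ 2 = 0" "q $ 1 = 0" using E(4,5) False k p by auto
    have r: "r $ 2 = 0" "r $ 1 = 0" using E(6,7) False k p by auto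
    have s: "s $ 2 = 0" "s $ 1 = 0" using E(8,9) False k p q r by auto
    show ?thesis using p q r s by (intro occurs_N) (simp_all add: vec2_eq_iff)
  next
    case True
    have p2: "p $ 2 = 0" using E(2) True by simp
    have q2: "q $ 2 = p $ 1" using E(4) True by simp
    have r2: "r $ 2 = p $ 1" using E(6) True by simp
    have "p $ 1 + p $ 1 = 0" using E(9) True p2 q2 r2 by simp
    hence p1: "p $ 1 = 0" by simp
    have s2: "s $ 2 = q $ 1 + r $ 1" using E(8) True p1 by simp
    have "p = 0" "q = vector [q $ 1, 0]" "r = vector [r $ 1, 0]" "s = vector [s $ 1, q $ 1 + r $ 1]"
      using p1 p2 q2 r2 s2 by (simp_all add: vec2_eq_iff)
    thus ?thesis using occurs_jordan by metis
  qed
qed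

lemma occurs_of_nontrivial_aut:
  fixes p q r s :: "'a::{alg_closed_field, field_char_0} ^ 2"
  assumes U: "is_U U" and Vt: "is_V_tilde Vt" and g: "g \<in> Aut (*s) (alg p q r s)" "g \<noteq> id"
  shows "occurs U Vt m (alg p q r s)"
proof -
  obtain a b c d where abcd: "aut_matrix (alg p q r s) a b c d" "g = lin2 a b c d"
    using g(1) by (auto simp: Aut_iff)
  have "\<not> (a = 1 \<and> b = 0 \<and> c = 0 \<and> d = 1)"
    using g(2) by (auto simp: abcd(2) fun_eq_iff vec2_eq_iff)
  from eigenbasis[OF abcd(1) this] obtain p' q' r' s' k l where
    iso: "iso2 (alg p q r s) (alg p' q' r' s')" and
    "(aut_matrix (alg p' q' r' s') k 0 0 l \<and> (k \<noteq> 1 \<or> l \<noteq> 1)) \<or> aut_matrix (alg p' q' r' s') k 0 1 k"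
    by blast
  hence "occurs U Vt m (alg p' q' r' s')"
    using occurs_of_diagonal_aut[OF U Vt] occurs_of_jordan_aut by blast
  with iso show ?thesis by (rule occurs_iso2)
qed

lemma listed_minimal_generating_set:
  fixes mul :: "'a::{alg_closed_field, field_char_0} ^ 2 \<Rightarrow> 'a ^ 2 \<Rightarrow> 'a ^ 2"
  assumes "listed U Vt m mul S"
  shows "minimal_generating_set S (invariants (*s) mul b1 b2 m)"
  using assms
proof cases
  case (A1 \<alpha>)
  show ?thesis unfolding A1 by (rule minimal_generating_set_shear) (rule aut_matrix_A1)
next
  case A2
  show ?thesis unfolding A2 by (rule minimal_generating_set_shear) (rule aut_matrix_A2)
next
  case A3
  show ?thesis unfolding A3
    by (rule minimal_generating_set_constants[of _ 1]) (use aut_matrix_A3 in \<open>simp add: power2_eq_square\<close>)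
next
  case A4_0
  show ?thesis unfolding A4_0 by (rule minimal_generating_set_sign) (rule aut_matrix_A4_0)
next
  case (B2 \<alpha>)
  show ?thesis unfolding B2 by (rule minimal_generating_set_yvar) (rule aut_matrix_B2)
next
  case B3
  show ?thesis unfolding B3 by (rule minimal_generating_set_xvar) (simp_all add: aut_matrix_B3)
next
  case (C_0 \<alpha>)
  show ?thesis unfolding C_0 by (rule minimal_generating_set_sign) (rule aut_matrix_C_0)
next
  case (D1 \<alpha>)
  show ?thesis unfolding D1(1,2) by (rule minimal_generating_set_D1) (rule aut_matrix_D1)
next
  case (D2 \<alpha> \<beta>)
  show ?thesis unfolding D2(1,2)
    by (rule minimal_generating_set_xvar) (simp_all add: aut_matrix_D2[OF D2(3)])
next
  case (E1 \<alpha> \<beta>)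
  have t: "\<alpha> + \<beta> \<noteq> 1" "\<alpha> + \<beta> \<noteq> - 1"
  proof -
    have "par_D (\<alpha>, \<beta>, \<beta>, \<alpha>) \<noteq> 0" using E1(3) by (simp add: V_set_def admissible_def)
    moreover have "par_D (\<alpha>, \<beta>, \<beta>, \<alpha>) = (\<alpha> + \<beta> - 1) * (\<alpha> + \<beta> + 1)"
      by (simp add: par_D_def algebra_simps)
    ultimately show "\<alpha> + \<beta> \<noteq> 1" "\<alpha> + \<beta> \<noteq> - 1" by auto
  qed
  show ?thesis unfolding E1(1,2)
    by (rule minimal_generating_set_swap) (rule aut_matrix_E1_symmetric[OF t E1(4)])
next
  case E1_special
  show ?thesis unfolding E1_special
    using minimal_generating_set_S3[OF aut_matrix_E1_special] unfolding quad_def cub_def .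
next
  case (E3 \<alpha>)
  show ?thesis unfolding E3 by (rule minimal_generating_set_swap) (rule aut_matrix_E3)
next
  case (E5 \<alpha>)
  show ?thesis unfolding E5 by (rule minimal_generating_set_trace) (rule aut_matrix_E5)
next
  case N
  show ?thesis unfolding N
    by (rule minimal_generating_set_constants[of _ 0]) (simp add: aut_matrix_N)
qed

theorem theorem7p6:
  fixes smul :: "'a::{alg_closed_field, field_char_0} \<Rightarrow> 'v::ab_group_add \<Rightarrow> 'v"
    and mul :: "'v \<Rightarrow> 'v \<Rightarrow> 'v" and e1 e2 :: 'v
    and U :: "('a \<times> 'a) set" and Vt :: "'a triple set" and m :: nat
  assumes "two_dim_algebra smul mul e1 e2" and "m > 0"
    and "is_U U" and "is_V_tilde Vt"
  shows "(Aut smul mul = {id} \<longrightarrow> invariants smul mul e1 e2 m = coord_ring m) \<and>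
    (Aut smul mul \<noteq> {id} \<longrightarrow>
       (\<exists>mul' S g. listed U Vt m mul' S \<and> algebra_iso smul mul (*s) mul' g)) \<and>
    (\<forall>mul' S. listed U Vt m mul' S \<longrightarrow>
       minimal_generating_set S (invariants (*s) mul' b1 b2 m))"
proof (intro conjI impI allI)
  assume "Aut smul mul = {id}"
  thus "invariants smul mul e1 e2 m = coord_ring m" by (auto simp: invariants_def)
next
  assume nontrivial: "Aut smul mul \<noteq> {id}"
  obtain p q r s g where g: "algebra_iso smul mul (*s) (alg p q r s :: 'a ^ 2 \<Rightarrow> _) g"
    using two_dim_algebra_iso_alg[OF assms(1)] by blast
  obtain h where "h \<in> Aut (*s) (alg p q r s)" "h \<noteq> id"
    using Aut_transfer[OF g nontrivial] by blast
  hence "occurs U Vt m (alg p q r s)"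
    by (rule occurs_of_nontrivial_aut[OF assms(3,4)])
  then obtain mul' S k where "listed U Vt m mul' S" "algebra_iso (*s) (alg p q r s) (*s) mul' k"
    unfolding occurs_def iso2_def by blast
  thus "\<exists>mul' S g. listed U Vt m mul' S \<and> algebra_iso smul mul (*s) mul' g"
    using algebra_iso_trans[OF g] by blast
next
  fix mul' :: "'a ^ 2 \<Rightarrow> 'a ^ 2 \<Rightarrow> 'a ^ 2" and S assume "listed U Vt m mul' S"
  thus "minimal_generating_set S (invariants (*s) mul' b1 b2 m)"
    by (rule listed_minimal_generating_set)
qed

end
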